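(* Let $(X,d,\mu)$ be a complete metric measure space with $\mu$ a doubling Borel measure, and suppose that $X$ supports a $1$-Poincaré inequality. Then there exists $C\ge1$ such that for every $x,y\in X$ with $x\ne y$ there exist a compact family of curves $\Gamma_{xy}\subset\Gamma^C_{xy}$ and a Radon probability measure $\alpha_{xy}$ on $\Gamma_{xy}$ which constitute a Semmes family of curves, i.e. for every Borel set $A\subset X$, $$\int_{\Gamma_{xy}}\int_\gamma\chi_A\,ds\,d\alpha_{xy}(\gamma)\le C\int_{CB_{x,y}\cap A}R_{xy}(z)\,d\mu(z).$$
   Context: Setting: $(X,d)$ is a complete metric space and $\mu$ is a Borel measure on $X$ with $0<\mu(B)<\infty$ for every ball $B$. $\mu$ is doubling if there is $C\ge1$ with $\mu(2B)\le C\mu(B)$ for every ball $B$ ($\lambda B$ is the ball with the same center and $\lambda$ times the radius). Write $u_B=\frac1{\mu(B)}\int_Bu\,d\mu$. $\int_\gamma\rho\,ds$ denotes the path integral with respect to the arc-length parametrization of the rectifiable curve $\gamma$. A non-negative Borel function $g$ is an upper gradient of $u$ if $|u(\gamma(a))-u(\gamma(b))|\le\int_\gamma g\,ds$ for every non-constant rectifiable curve $\gamma:[a,b]\to X$. $X$ supports a $1$-Poincaré inequality if there are positive constants $C,\lambda$ such that for every ball $B$, every $u$ integrable on balls and every upper gradient $g$ of $u$, $$\frac1{\mu(B)}\int_B|u-u_B|\,d\mu\le C\,\mathrm{rad}(B)\,\frac1{\mu(\lambda B)}\int_{\lambda B}g\,d\mu.$$ For $C\ge1$ and $x\neq y$,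 $\Gamma^C_{xy}$ is the set of pairs $(\gamma,I)$ where $I\subset[0,C\,d(x,y)]$ is a compact interval with left endpoint $0$ and $\gamma:I\to X$ is $1$-Lipschitz with $\gamma(0)=x$ and $\gamma(\max I)=y$ (in particular such $\gamma$ has length at most $C\,d(x,y)$). It is metrized by the Hausdorff distance between the graphs $\{(t,\gamma(t)):t\in I\}\subset\mathbb R\times X$; compactness and Borel/Radon measures refer to this metric. $CB_{x,y}=B(x,Cd(x,y))\cup B(y,Cd(x,y))$ and $R_{xy}(z)=\frac{d(x,z)}{\mu(B(x,d(x,z)))}+\frac{d(y,z)}{\mu(B(y,d(y,z)))}$ (a term with zero distance is read as $0$). *)

theory Defs
  imports "HOL-Analysis.Analysis" "HOL-Probability.Probability_Measure"
begin

section \<open>Rectifiable curves and path integrals\<close>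

definition curve_length :: "(real \<Rightarrow> 'a::metric_space) \<Rightarrow> real \<Rightarrow> real \<Rightarrow> ennreal" where
  "curve_length \<gamma> a b =
     (SUP (n, t) \<in> {(n::nat, t). mono_on {..n} t \<and> t ` {..n} \<subseteq> {a..b}}.
        \<Sum>i<n. ennreal (dist (\<gamma> (t i)) (\<gamma> (t (Suc i)))))"

definition rectifiable_curve :: "(real \<Rightarrow> 'a::metric_space) \<Rightarrow> real \<Rightarrow> real \<Rightarrow> bool" where
  "rectifiable_curve \<gamma> a b \<longleftrightarrow> a \<le> b \<and> continuous_on {a..b} \<gamma> \<and> curve_length \<gamma> a b < \<infinity>"

text \<open>
  The arc-length parametrization is the map on \<open>[0, length]\<close> taking \<open>s\<close> to \<open>\<gamma> t\<close>, where \<open>t\<close> is any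
  parameter at which the length of \<open>\<gamma>\<close> restricted to \<open>[a, t]\<close> equals \<open>s\<close>. For a rectifiable curve
  such \<open>t\<close> exists, and \<open>\<gamma> t\<close> does not depend on its choice.
\<close>

definition arclength_param :: "(real \<Rightarrow> 'a::metric_space) \<Rightarrow> real \<Rightarrow> real \<Rightarrow> real \<Rightarrow> 'a" where
  "arclength_param \<gamma> a b s = \<gamma> (SOME t. t \<in> {a..b} \<and> curve_length \<gamma> a t = ennreal s)"

definition path_integral ::
  "(real \<Rightarrow> 'a::metric_space) \<Rightarrow> real \<Rightarrow> real \<Rightarrow> ('a \<Rightarrow> ennreal) \<Rightarrow> ennreal" where
  "path_integral \<gamma> a b \<rho> =
     (\<integral>\<^sup>+ s \<in> {0..enn2real (curve_length \<gamma> a b)}. \<rho> (arclength_param \<gamma> a b s) \<partial>lborel)"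

section \<open>Doubling measures and the Poincare inequality\<close>

definition doubling_measure :: "'a::metric_space measure \<Rightarrow> bool" where
  "doubling_measure M \<longleftrightarrow>
     (\<exists>C::real. 1 \<le> C \<and>
        (\<forall>x r. 0 < r \<longrightarrow> emeasure M (ball x (2 * r)) \<le> ennreal C * emeasure M (ball x r)))"

definition upper_gradient :: "('a::metric_space \<Rightarrow> real) \<Rightarrow> ('a \<Rightarrow> real) \<Rightarrow> bool" where
  "upper_gradient u g \<longleftrightarrow>
     g \<in> borel_measurable borel \<and> (\<forall>z. 0 \<le> g z) \<and>
     (\<forall>\<gamma> a b. rectifiable_curve \<gamma> a b \<and> \<not> \<gamma> constant_on {a..b} \<longrightarrow>
        ennreal \<bar>u (\<gamma> a) - u (\<gamma> b)\<bar> \<le> path_integral \<gamma> a b (\<lambda>z. ennreal (g z)))"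

definition average_on :: "'a measure \<Rightarrow> 'a set \<Rightarrow> ('a \<Rightarrow> real) \<Rightarrow> real" where
  "average_on M B u = (LINT z:B|M. u z) / measure M B"

text \<open>
  The integral of \<open>g\<close> may be infinite, so the inequality is stated in the extended non-negative
  reals; the left-hand side is finite because \<open>u\<close> is integrable on balls.
\<close>

definition supports_1_Poincare :: "'a::metric_space measure \<Rightarrow> bool" where
  "supports_1_Poincare M \<longleftrightarrow>
     (\<exists>C l::real. 0 < C \<and> 0 < l \<and>
        (\<forall>x r u g. 0 < r \<longrightarrow> (\<forall>y s. set_integrable M (ball y s) u) \<longrightarrow> upper_gradient u g \<longrightarrow>
           ennreal (average_on M (ball x r) (\<lambda>z. \<bar>u z - average_on M (ball x r) u\<bar>))
           \<le> ennreal (C * r) *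
              ((\<integral>\<^sup>+ z \<in> ball x (l * r). ennreal (g z) \<partial>M) / emeasure M (ball x (l * r)))))"

section \<open>The space of curves joining two points\<close>

text \<open>
  Curves are pairs \<open>(\<gamma>, I)\<close>. Functions are total, so \<open>\<gamma>\<close> is required to take the fixed default value
  outside \<open>I\<close>; thus a pair is determined by its graph over \<open>I\<close>. The maximum of the compact interval
  \<open>I\<close> is written as its supremum.
\<close>

type_synonym 'a curve = "(real \<Rightarrow> 'a) \<times> real set"

definition curves_between :: "real \<Rightarrow> 'a::metric_space \<Rightarrow> 'a \<Rightarrow> 'a curve set" where
  "curves_between C x y =
     {(\<gamma>, I). (\<exists>T. 0 \<le> T \<and> T \<le> C * dist x y \<and> I = {0..T}) \<and>
        \<gamma> \<in> extensional I \<and> 1-lipschitz_on I \<gamma> \<and> \<gamma> 0 = x \<and> \<gamma> (Sup I) = y}"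

definition curve_graph :: "'a curve \<Rightarrow> (real \<times> 'a) set" where
  "curve_graph = (\<lambda>(\<gamma>, I). (\<lambda>t. (t, \<gamma> t)) ` I)"

text \<open>
  The value 0 outside the bounded nonempty sets is a convention that is needed because the library
  locale for metrics on a carrier requires nonnegativity for all arguments.
\<close>

definition hausdorff_dist :: "'b::metric_space set \<Rightarrow> 'b set \<Rightarrow> real" where
  "hausdorff_dist A B =
     (if bounded A \<and> bounded B \<and> A \<noteq> {} \<and> B \<noteq> {}
      then max (SUP a\<in>A. infdist a B) (SUP b\<in>B. infdist b A) else 0)"

definition curve_dist :: "'a::metric_space curve \<Rightarrow> 'a curve \<Rightarrow> real" where
  "curve_dist p q = hausdorff_dist (curve_graph p) (curve_graph q)"

definition curve_topology :: "real \<Rightarrow> 'a::metric_space \<Rightarrow> 'a \<Rightarrow> 'a curve topology" where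
  "curve_topology C x y = Metric_space.mtopology (curves_between C x y) curve_dist"

subsection \<open>The Hausdorff distance of graphs is a metric\<close>

lemma bdd_above_infdist_image:
  fixes A B :: "'b::metric_space set"
  assumes "bounded A"
  shows "bdd_above ((\<lambda>a. infdist a B) ` A)"
proof (cases "B = {}")
  case True
  then show ?thesis by (auto simp: infdist_def intro!: bdd_aboveI2[of _ _ 0])
next
  case False
  then obtain b where b: "b \<in> B" by blast
  obtain e where e: "\<forall>a\<in>A. dist b a \<le> e"
    using assms bounded_any_center by blast
  show ?thesis
  proof (rule bdd_aboveI2)
    fix a assume "a \<in> A"
    then show "infdist a B \<le> e"
      using infdist_le[OF b, of a] e by (auto simp: dist_commute intro: order_trans)
  qed
qed

lemma hausdorff_dist_commute: "hausdorff_dist A B = hausdorff_dist B A"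
  by (auto simp: hausdorff_dist_def max.commute)

lemma infdist_le_hausdorff_dist:
  assumes "bounded A" "bounded B" "B \<noteq> {}" "a \<in> A"
  shows "infdist a B \<le> hausdorff_dist A B"
proof -
  have "infdist a B \<le> (SUP a\<in>A. infdist a B)"
    using assms by (intro cSUP_upper bdd_above_infdist_image)
  moreover have "A \<noteq> {}" using assms(4) by blast
  ultimately show ?thesis using assms(1-3) by (simp add: hausdorff_dist_def)
qed

lemma hausdorff_dist_nonneg: "0 \<le> hausdorff_dist A B"
proof (cases "bounded A \<and> bounded B \<and> A \<noteq> {} \<and> B \<noteq> {}")
  case True
  then obtain a where "a \<in> A" by blast
  with True have "infdist a B \<le> hausdorff_dist A B"
    by (intro infdist_le_hausdorff_dist) auto
  then show ?thesis using infdist_nonneg[of a B] by linarith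
next
  case False
  then show ?thesis by (auto simp: hausdorff_dist_def)
qed

lemma hausdorff_dist_le:
  assumes "A \<noteq> {}" "B \<noteq> {}" "\<And>a. a \<in> A \<Longrightarrow> infdist a B \<le> r" "\<And>b. b \<in> B \<Longrightarrow> infdist b A \<le> r"
  shows "hausdorff_dist A B \<le> r"
proof -
  obtain a where "a \<in> A" using assms(1) by blast
  then have "0 \<le> r" using assms(3)[of a] infdist_nonneg[of a B] by linarith
  then show ?thesis
    using assms by (auto simp: hausdorff_dist_def intro!: cSUP_least)
qed

lemma hausdorff_dist_eq_0_iff:
  assumes "compact A" "A \<noteq> {}" "compact B" "B \<noteq> {}"
  shows "hausdorff_dist A B = 0 \<longleftrightarrow> A = B"
proof
  have sub: "S \<subseteq> T"
    if "hausdorff_dist S T = 0" "compact S" "compact T" "T \<noteq> {}" for S T :: "'a set"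
  proof
    fix s assume "s \<in> S"
    then have "infdist s T = 0"
      using infdist_le_hausdorff_dist[of S T s] that infdist_nonneg[of s T]
      by (simp add: compact_imp_bounded)
    then show "s \<in> T"
      using in_closed_iff_infdist_zero[of T s] compact_imp_closed that by blast
  qed
  assume "hausdorff_dist A B = 0"
  then show "A = B"
    using sub[of A B] sub[of B A] assms by (auto simp: hausdorff_dist_commute)
next
  assume "A = B"
  have "hausdorff_dist A A \<le> 0"
    using assms by (intro hausdorff_dist_le) auto
  with \<open>A = B\<close> show "hausdorff_dist A B = 0"
    using hausdorff_dist_nonneg[of A A] by simp
qed

lemma hausdorff_dist_triangle:
  assumes "compact A" "A \<noteq> {}" "compact B" "B \<noteq> {}" "compact C" "C \<noteq> {}"
  shows "hausdorff_dist A C \<le> hausdorff_dist A B + hausdorff_dist B C"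
proof -
  have *: "infdist s U \<le> hausdorff_dist S T + hausdorff_dist T U"
    if h: "s \<in> S" "compact S" "compact T" "T \<noteq> {}" "compact U" "U \<noteq> {}" for s and S T U :: "'a set"
  proof -
    have "continuous_on T (dist s)"
      by (intro continuous_intros)
    then obtain t where t: "t \<in> T" "\<And>t'. t' \<in> T \<Longrightarrow> dist s t \<le> dist s t'"
      using continuous_attains_inf[OF h(3,4)] by blast
    have "dist s t \<le> infdist s T"
      using t h(4) by (auto simp: infdist_def intro!: cINF_greatest)
    moreover have "infdist s T \<le> hausdorff_dist S T"
      using h by (intro infdist_le_hausdorff_dist) (auto simp: compact_imp_bounded)
    moreover have "infdist t U \<le> hausdorff_dist T U"
      using h t by (intro infdist_le_hausdorff_dist) (auto simp: compact_imp_bounded)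
    ultimately show ?thesis
      using infdist_triangle[of s U t] by linarith
  qed
  show ?thesis
    using *[of _ A B C] *[of _ C B A] assms
    by (intro hausdorff_dist_le) (auto simp: hausdorff_dist_commute add.commute)
qed

lemma compact_curve_graph:
  assumes "p \<in> curves_between C x y"
  shows "compact (curve_graph p)" "curve_graph p \<noteq> {}"
proof -
  obtain \<gamma> T where p: "p = (\<gamma>, {0..T})" "0 \<le> T" "1-lipschitz_on {0..T} \<gamma>"
    using assms by (auto simp: curves_between_def)
  have "continuous_on {0..T} (\<lambda>t. (t, \<gamma> t))"
    by (intro continuous_intros lipschitz_on_continuous_on[OF p(3)])
  then show "compact (curve_graph p)" "curve_graph p \<noteq> {}"
    using p by (auto simp: curve_graph_def intro: compact_continuous_image)
qed

lemma inj_on_curve_graph: "inj_on curve_graph (curves_between C x y)"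
proof (rule inj_onI)
  fix p q assume pq: "p \<in> curves_between C x y" "q \<in> curves_between C x y"
    and eq: "curve_graph p = curve_graph q"
  obtain \<gamma> I \<gamma>' I' where p: "p = (\<gamma>, I)" and q: "q = (\<gamma>', I')" by fastforce
  have g: "(t, z) \<in> curve_graph (\<gamma>, I) \<longleftrightarrow> t \<in> I \<and> z = \<gamma> t" for t z and \<gamma> :: "real \<Rightarrow> 'a" and I
    by (auto simp: curve_graph_def)
  have I: "I = I'" using g[of _ _ \<gamma> I] g[of _ _ \<gamma>' I'] eq p q by blast
  have "\<gamma> t = \<gamma>' t" if "t \<in> I" for t
    using g[of t "\<gamma> t" \<gamma> I] g[of t "\<gamma> t" \<gamma>' I'] eq p q that by simp
  moreover have "\<gamma> \<in> extensional I" "\<gamma>' \<in> extensional I"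
    using pq p q I by (auto simp: curves_between_def)
  ultimately show "p = q" using p q I extensionalityI by blast
qed

lemma Metric_space_curves_between: "Metric_space (curves_between C x y) curve_dist"
proof
  fix p q r :: "'a curve"
  show "curve_dist p q = curve_dist q p" "0 \<le> curve_dist p q"
    by (simp_all add: curve_dist_def hausdorff_dist_nonneg hausdorff_dist_commute)
  assume p: "p \<in> curves_between C x y" and q: "q \<in> curves_between C x y"
  show "curve_dist p q = 0 \<longleftrightarrow> p = q"
    unfolding curve_dist_def
    using hausdorff_dist_eq_0_iff[OF compact_curve_graph[OF p] compact_curve_graph[OF q]]
      inj_on_eq_iff[OF inj_on_curve_graph p q] by simp
  assume r: "r \<in> curves_between C x y"
  show "curve_dist p r \<le> curve_dist p q + curve_dist q r"
    unfolding curve_dist_def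
    by (intro hausdorff_dist_triangle compact_curve_graph[OF p] compact_curve_graph[OF q]
        compact_curve_graph[OF r])
qed

section \<open>Semmes families of curves\<close>

definition radon_measure_on :: "'b topology \<Rightarrow> 'b measure \<Rightarrow> bool" where
  "radon_measure_on T N \<longleftrightarrow>
     space N = topspace T \<and>
     sets N = sigma_sets (topspace T) {U. openin T U} \<and>
     (\<forall>x\<in>topspace T. \<exists>U. openin T U \<and> x \<in> U \<and> emeasure N U < \<infinity>) \<and>
     (\<forall>A\<in>sets N. emeasure N A = (SUP K\<in>{K. compactin T K \<and> K \<subseteq> A}. emeasure N K))"

definition double_ball :: "real \<Rightarrow> 'a::metric_space \<Rightarrow> 'a \<Rightarrow> 'a set" where
  "double_ball C x y = ball x (C * dist x y) \<union> ball y (C * dist x y)"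

text \<open>A term with zero distance vanishes because of the library convention for division by 0.\<close>

definition riesz_kernel :: "'a::metric_space measure \<Rightarrow> 'a \<Rightarrow> 'a \<Rightarrow> 'a \<Rightarrow> real" where
  "riesz_kernel M x y z =
     dist x z / measure M (ball x (dist x z)) + dist y z / measure M (ball y (dist y z))"

text \<open>
  The library integral is a lower integral on non-measurable functions, so the measurability that is
  implicit in writing the integral over the family of curves is spelled out.
\<close>

definition semmes_family ::
  "'a::metric_space measure \<Rightarrow> real \<Rightarrow> 'a \<Rightarrow> 'a \<Rightarrow> 'a curve set \<Rightarrow> 'a curve measure \<Rightarrow> bool" where
  "semmes_family M C x y \<Gamma> \<alpha> \<longleftrightarrow>
     \<Gamma> \<subseteq> curves_between C x y \<and>
     compactin (curve_topology C x y) \<Gamma> \<and>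
     radon_measure_on (subtopology (curve_topology C x y) \<Gamma>) \<alpha> \<and>
     prob_space \<alpha> \<and>
     (\<forall>A\<in>sets borel.
        (\<lambda>(\<gamma>, I). path_integral \<gamma> 0 (Sup I) (indicator A)) \<in> borel_measurable \<alpha> \<and>
        (\<integral>\<^sup>+ (\<gamma>, I) \<in> \<Gamma>. path_integral \<gamma> 0 (Sup I) (indicator A) \<partial>\<alpha>)
        \<le> ennreal C * (\<integral>\<^sup>+ z \<in> double_ball C x y \<inter> A. ennreal (riesz_kernel M x y z) \<partial>M))"

end

theory Submission
  imports Defs "HOL-Analysis.Regularity" "HOL-Probability.Helly_Selection"
    "HOL-Probability.Probability_Mass_Function"
begin

text \<open>
  For a bounded continuous \<open>\<rho>\<close> bounded below by a positive constant, the cheapest \<open>\<rho>\<close>-cost of a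
  \<open>\<delta>\<close>-chain from \<open>x\<close> is a continuous function with upper gradient \<open>\<rho>\<close>. For \<open>\<rho> = 1\<close> the Poincare
  inequality on concentric balls bounds it at \<open>y\<close> by a multiple of \<open>d(x, y)\<close>, uniformly in \<open>\<delta>\<close>;
  letting \<open>\<delta>\<close> tend to 0 gives quasiconvexity. Quasiconvexity allows chains of balls that approach
  \<open>x\<close> and \<open>y\<close> through annuli, so for general \<open>\<rho>\<close> the cost is at most a multiple of the integral of
  \<open>\<rho> R\<^sub>x\<^sub>y\<close>. With \<open>\<rho> = g + a\<close> and a suitable constant \<open>a\<close>, the limit of the chains is a curve of length
  at most \<open>C d(x, y)\<close> along which the integral of \<open>g\<close> is at most a multiple of the integral of
  \<open>g R\<^sub>x\<^sub>y\<close>.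

  A minimax argument turns these curves, one for each \<open>g\<close>, into a single measure: Blackwell's
  approachability strategy yields a sequence of curves whose empirical measures satisfy the
  inequality asymptotically for countably many test functions, and a weak limit of these measures
  satisfies it for all of them. Inner regularity extends it to Borel sets. The limit is obtained from
  Helly's theorem on the line, into which the compact space of curves is coded.
\<close>

section \<open>Arc length\<close>

text \<open>Costs of chains replace infima over curves because nothing is known about curves at the
  outset: an infimum over curves of the integral of \<rho> may be infinite and need not be
  measurable, whereas the cost of \<delta>-chains is Lipschitz at scale \<delta>. Every point is
  then a Lebesgue point of the cost, so ball averages telescope to its values at x and y themselves.
  The random curve lives in parameter time. Integrals of Lipschitz functions over a 1-Lipschitz
  parametrization are continuous in the curve, pass to weak limits, and dominate the arc-length
  integrals, which are not continuous in the curve. The comparison with arc length is made only at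
  the end, and the measurability of arc-length integrals needs an argument of its own, since length
  is merely lower semicontinuous. All inner regularity is drawn from the line and the plane: the
  random curve is a continuous image of a random real number.\<close>

lemma curve_length_upper:
  assumes "mono_on {..n} t" "t ` {..n} \<subseteq> {a..b}"
  shows "ennreal (\<Sum>i<n. dist (\<gamma> (t i)) (\<gamma> (t (Suc i)))) \<le> curve_length \<gamma> a b"
proof -
  have "ennreal (\<Sum>i<n. dist (\<gamma> (t i)) (\<gamma> (t (Suc i)))) = (\<Sum>i<n. ennreal (dist (\<gamma> (t i)) (\<gamma> (t (Suc i)))))"
    by (simp add: sum_ennreal)
  also have "\<dots> \<le> curve_length \<gamma> a b"
    unfolding curve_length_def
    by (rule SUP_upper2[where i="(n,t)"]) (use assms in auto)
  finally show ?thesis .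
qed

lemma curve_length_least:
  assumes "\<And>n t. mono_on {..n} t \<Longrightarrow> t ` {..n} \<subseteq> {a..b} \<Longrightarrow>
     ennreal (\<Sum>i<n. dist (\<gamma> (t i)) (\<gamma> (t (Suc i)))) \<le> z"
  shows "curve_length \<gamma> a b \<le> z"
  unfolding curve_length_def
proof (rule SUP_least, clarify)
  fix n and t :: "nat \<Rightarrow> real" assume "mono_on {..n} t" "t ` {..n} \<subseteq> {a..b}"
  from assms[OF this] show "(\<Sum>i<n. ennreal (dist (\<gamma> (t i)) (\<gamma> (t (Suc i))))) \<le> z"
    by (simp add: sum_ennreal)
qed

lemma curve_length_mono:
  assumes "a \<le> c" "d \<le> b"
  shows "curve_length \<gamma> c d \<le> curve_length \<gamma> a b"
  by (rule curve_length_least, rule curve_length_upper) (use assms in force)+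

lemma dist_le_curve_length:
  assumes "a \<le> b"
  shows "ennreal (dist (\<gamma> a) (\<gamma> b)) \<le> curve_length \<gamma> a b"
proof -
  have "mono_on {..Suc 0} (\<lambda>i. if i = 0 then a else b)"
    using assms by (auto simp: mono_on_def)
  moreover have "(\<lambda>i::nat. if i = 0 then a else b) ` {..Suc 0} \<subseteq> {a..b}"
    using assms by auto
  ultimately show ?thesis
    using curve_length_upper[of "Suc 0" "\<lambda>i. if i = 0 then a else b" a b \<gamma>] by simp
qed

lemma curve_length_refl: "curve_length \<gamma> a a = 0"
proof -
  have "curve_length \<gamma> a a \<le> 0"
  proof (rule curve_length_least)
    fix n and t :: "nat \<Rightarrow> real" assume "t ` {..n} \<subseteq> {a..a}"
    then have "t i = a" if "i \<le> n" for i using that by auto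
    then show "ennreal (\<Sum>i<n. dist (\<gamma> (t i)) (\<gamma> (t (Suc i)))) \<le> 0" by simp
  qed
  then show ?thesis by simp
qed

lemma curve_length_cong:
  assumes "\<And>t. t \<in> {a..b} \<Longrightarrow> \<gamma> t = \<gamma>' t"
  shows "curve_length \<gamma> a b = curve_length \<gamma>' a b"
proof -
  have *: "(\<Sum>i<n. dist (\<gamma> (t i)) (\<gamma> (t (Suc i)))) = (\<Sum>i<n. dist (\<gamma>' (t i)) (\<gamma>' (t (Suc i))))"
    if "t ` {..n} \<subseteq> {a..b}" for n and t :: "nat \<Rightarrow> real"
  proof (rule sum.cong)
    fix i assume "i \<in> {..<n}"
    then have "i \<in> {..n}" "Suc i \<in> {..n}" by auto
    then have "t i \<in> {a..b}" "t (Suc i) \<in> {a..b}" using that by blast+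
    then show "dist (\<gamma> (t i)) (\<gamma> (t (Suc i))) = dist (\<gamma>' (t i)) (\<gamma>' (t (Suc i)))"
      using assms by simp
  qed simp
  show ?thesis
  proof (rule antisym; rule curve_length_least)
    fix n and t :: "nat \<Rightarrow> real" assume a: "mono_on {..n} t" "t ` {..n} \<subseteq> {a..b}"
    show "ennreal (\<Sum>i<n. dist (\<gamma> (t i)) (\<gamma> (t (Suc i)))) \<le> curve_length \<gamma>' a b"
      unfolding *[OF a(2)] by (rule curve_length_upper[OF a])
    show "ennreal (\<Sum>i<n. dist (\<gamma>' (t i)) (\<gamma>' (t (Suc i)))) \<le> curve_length \<gamma> a b"
      unfolding *[OF a(2), symmetric] by (rule curve_length_upper[OF a])
  qed
qed

lemma curve_length_superadd:
  assumes "a \<le> s" "s \<le> b"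
  shows "curve_length \<gamma> a s + curve_length \<gamma> s b \<le> curve_length \<gamma> a b"
proof -
  have fin: "ennreal S + ennreal S' \<le> curve_length \<gamma> a b"
    if t: "mono_on {..n} t" "t ` {..n} \<subseteq> {a..s}" "S = (\<Sum>i<n. dist (\<gamma> (t i)) (\<gamma> (t (Suc i))))"
      and t': "mono_on {..m} t'" "t' ` {..m} \<subseteq> {s..b}" "S' = (\<Sum>i<m. dist (\<gamma> (t' i)) (\<gamma> (t' (Suc i))))"
    for n m t t' S S'
  proof -
    \<comment> \<open>The joined partition has \<open>Suc n + m\<close> steps: the extra one runs
      from \<open>t n\<close> to \<open>t' 0\<close> and only adds to the sum.\<close>
    define u where "u = (\<lambda>i. if i \<le> n then t i else t' (i - Suc n))"
    have "mono_on {..Suc n + m} u"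
    proof (rule mono_onI)
      fix i j assume ij: "i \<in> {..Suc n + m}" "j \<in> {..Suc n + m}" "i \<le> j"
      consider "j \<le> n" | "i \<le> n" "j > n" | "i > n" by linarith
      then show "u i \<le> u j"
      proof cases
        case 1 then show ?thesis using ij t(1) by (auto simp: u_def mono_on_def)
      next
        case 2
        then have "i \<in> {..n}" "j - Suc n \<in> {..m}" using ij by auto
        then have "t i \<in> {a..s}" "t' (j - Suc n) \<in> {s..b}" using t(2) t'(2) by blast+
        then show ?thesis using 2 by (auto simp: u_def)
      next
        case 3
        then have "t' (i - Suc n) \<le> t' (j - Suc n)" using ij by (intro mono_onD[OF t'(1)]) auto
        then show ?thesis using ij 3 by (auto simp: u_def)
      qed
    qed
    moreover have "u ` {..Suc n + m} \<subseteq> {a..b}"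
    proof clarify
      fix i assume i: "i \<le> Suc n + m"
      show "u i \<in> {a..b}"
      proof (cases "i \<le> n")
        case True
        then have "t i \<in> {a..s}" using t(2) by auto
        then show ?thesis using True assms by (auto simp: u_def)
      next
        case False
        then have "i - Suc n \<in> {..m}" using i by auto
        then have "t' (i - Suc n) \<in> {s..b}" using t'(2) by blast
        then show ?thesis using False assms by (auto simp: u_def)
      qed
    qed
    ultimately have *: "ennreal (\<Sum>i<Suc n + m. dist (\<gamma> (u i)) (\<gamma> (u (Suc i)))) \<le> curve_length \<gamma> a b"
      by (rule curve_length_upper)
    have split: "(\<Sum>i<k + m. f i) = (\<Sum>i<k. f i) + (\<Sum>i<m. f (k + i))" for k and f :: "nat \<Rightarrow> real"
      by (induction m) auto
    have "S + S' \<le> (\<Sum>i<Suc n. dist (\<gamma> (u i)) (\<gamma> (u (Suc i)))) + (\<Sum>i<m. dist (\<gamma> (u (Suc n + i))) (\<gamma> (u (Suc (Suc n + i)))))"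
    proof (rule add_mono)
      show "S \<le> (\<Sum>i<Suc n. dist (\<gamma> (u i)) (\<gamma> (u (Suc i))))"
        by (simp add: t(3) u_def)
      show "S' \<le> (\<Sum>i<m. dist (\<gamma> (u (Suc n + i))) (\<gamma> (u (Suc (Suc n + i)))))"
        by (simp add: t'(3) u_def)
    qed
    then have "S + S' \<le> (\<Sum>i<Suc n + m. dist (\<gamma> (u i)) (\<gamma> (u (Suc i))))"
      by (simp only: split)
    moreover have "S \<ge> 0" "S' \<ge> 0" using t(3) t'(3) by (auto intro!: sum_nonneg)
    ultimately show ?thesis
      using * by (metis (no_types, lifting) ennreal_leI ennreal_plus order_trans)
  qed
  have ne: "{(n::nat, t::nat\<Rightarrow>real). mono_on {..n} t \<and> t ` {..n} \<subseteq> {c..d}} \<noteq> {}" if "c \<le> d" for c d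
  proof -
    have "(0, \<lambda>_. c) \<in> {(n::nat, t::nat\<Rightarrow>real). mono_on {..n} t \<and> t ` {..n} \<subseteq> {c..d}}"
      using that by (auto simp: mono_on_def)
    then show ?thesis by blast
  qed
  show ?thesis
    unfolding curve_length_def[of \<gamma> a s] curve_length_def[of \<gamma> s b]
    apply (subst ennreal_SUP_add_left[symmetric])
     apply (rule ne[OF assms(1)])
    apply (rule SUP_least, clarify)
    apply (subst add.commute)
    apply (subst ennreal_SUP_add_left[symmetric])
     apply (rule ne[OF assms(2)])
    apply (rule SUP_least, clarify)
    subgoal for m t' n t
      using fin[of m t' _ n t, OF _ _ refl _ _ refl] by (simp add: sum_ennreal add.commute)
    done
qed

text \<open>Clamping the partition to \<open>{a..s}\<close> and to \<open>{s'..b}\<close> leaves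
  uncovered only the step that jumps over the gap, and the triangle inequality routes that step
  through \<open>\<gamma> s\<close> and \<open>\<gamma> s'\<close>. The case \<open>s = s'\<close>
  gives additivity; a gap without partition points gives continuity of the length function.\<close>

lemma curve_length_split:
  assumes t: "mono_on {..n} t" "t ` {..n} \<subseteq> {a..b}"
    and s: "a \<le> s" "s \<le> s'" "s' \<le> b"
    and gap: "\<And>i. i \<le> n \<Longrightarrow> t i \<le> s \<or> s' \<le> t i"
  shows "ennreal (\<Sum>i<n. dist (\<gamma> (t i)) (\<gamma> (t (Suc i))))
    \<le> curve_length \<gamma> a s + ennreal (dist (\<gamma> s) (\<gamma> s')) + curve_length \<gamma> s' b"
proof -
  define t1 where "t1 = (\<lambda>i. min (t i) s)"
  define t2 where "t2 = (\<lambda>i. max (t i) s')"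
  define J where "J = {i. i < n \<and> t i \<le> s \<and> s' \<le> t (Suc i)}"
  have rng: "a \<le> t i" "t i \<le> b" if "i \<le> n" for i using t(2) that by auto
  have m: "t i \<le> t j" if "i \<le> j" "j \<le> n" for i j using t(1) that by (auto simp: mono_on_def)
  have step: "dist (\<gamma> (t i)) (\<gamma> (t (Suc i))) \<le> dist (\<gamma> (t1 i)) (\<gamma> (t1 (Suc i)))
     + (if i \<in> J then dist (\<gamma> s) (\<gamma> s') else 0) + dist (\<gamma> (t2 i)) (\<gamma> (t2 (Suc i)))"
    if i: "i < n" for i
  proof -
    have le: "t i \<le> t (Suc i)" using m i by simp
    consider "t (Suc i) \<le> s" | "s' \<le> t i" | "t i \<le> s" "s' \<le> t (Suc i)"
      using gap[of i] gap[of "Suc i"] i by (metis Suc_leI less_imp_le)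
    then show ?thesis
    proof cases
      case 1
      then have "t1 i = t i" "t1 (Suc i) = t (Suc i)" using le by (auto simp: t1_def)
      then show ?thesis by simp
    next
      case 2
      then have "t2 i = t i" "t2 (Suc i) = t (Suc i)" using le by (auto simp: t2_def)
      then show ?thesis by simp
    next
      case 3
      then have "i \<in> J" using i by (simp add: J_def)
      moreover have "t1 i = t i" "t1 (Suc i) = s" "t2 i = s'" "t2 (Suc i) = t (Suc i)"
        using 3 s by (auto simp: t1_def t2_def)
      ultimately show ?thesis
        using dist_triangle[of "\<gamma> (t i)" "\<gamma> (t (Suc i))" "\<gamma> s"]
          dist_triangle[of "\<gamma> s" "\<gamma> (t (Suc i))" "\<gamma> s'"] by simp
    qed
  qed
  \<comment> \<open>If \<open>s < s'\<close>, at most one step crosses the gap. If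
    \<open>s = s'\<close>, several may touch the point \<open>s\<close>, as partition points can
    repeat, but each contributes distance 0.\<close>
  have J: "(\<Sum>i<n. if i \<in> J then dist (\<gamma> s) (\<gamma> s') else 0) \<le> dist (\<gamma> s) (\<gamma> s')"
  proof (cases "s = s'")
    case True
    then have "dist (\<gamma> s) (\<gamma> s') = 0" by simp
    then show ?thesis by (simp only: if_cancel sum.neutral_const order_refl)
  next
    case False
    have JJ: "i = j" if "i \<in> J" "j \<in> J" for i j
    proof (rule ccontr)
      assume "i \<noteq> j"
      then consider "Suc i \<le> j" | "Suc j \<le> i" by linarith
      then show False
        using that m[of "Suc i" j] m[of "Suc j" i] s False by cases (auto simp: J_def)
    qed
    have "card J \<le> 1"
    proof (cases "J = {}")
      case False
      then obtain i where "i \<in> J" by blast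
      then have "J = {i}" using JJ by blast
      then show ?thesis by simp
    qed simp
    moreover have "(\<Sum>i<n. if i \<in> J then dist (\<gamma> s) (\<gamma> s') else 0) = card J * dist (\<gamma> s) (\<gamma> s')"
    proof -
      have "{..<n} \<inter> J = J" by (auto simp: J_def)
      then show ?thesis by (simp add: sum.If_cases)
    qed
    moreover have "card J * dist (\<gamma> s) (\<gamma> s') \<le> 1 * dist (\<gamma> s) (\<gamma> s')"
      using \<open>card J \<le> 1\<close> by (intro mult_right_mono) auto
    ultimately show ?thesis by linarith
  qed
  let ?S1 = "\<Sum>i<n. dist (\<gamma> (t1 i)) (\<gamma> (t1 (Suc i)))"
  let ?S2 = "\<Sum>i<n. dist (\<gamma> (t2 i)) (\<gamma> (t2 (Suc i)))"
  have "(\<Sum>i<n. dist (\<gamma> (t i)) (\<gamma> (t (Suc i)))) \<le> (\<Sum>i<n. dist (\<gamma> (t1 i)) (\<gamma> (t1 (Suc i)))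
     + (if i \<in> J then dist (\<gamma> s) (\<gamma> s') else 0) + dist (\<gamma> (t2 i)) (\<gamma> (t2 (Suc i))))"
    using step by (intro sum_mono) auto
  also have "\<dots> \<le> ?S1 + dist (\<gamma> s) (\<gamma> s') + ?S2"
    using J by (simp add: sum.distrib)
  finally have "ennreal (\<Sum>i<n. dist (\<gamma> (t i)) (\<gamma> (t (Suc i)))) \<le> ennreal (?S1 + dist (\<gamma> s) (\<gamma> s') + ?S2)"
    by (rule ennreal_leI)
  also have "\<dots> = ennreal ?S1 + ennreal (dist (\<gamma> s) (\<gamma> s')) + ennreal ?S2"
    by (simp add: ennreal_plus sum_nonneg)
  also have "\<dots> \<le> curve_length \<gamma> a s + ennreal (dist (\<gamma> s) (\<gamma> s')) + curve_length \<gamma> s' b"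
  proof (intro add_mono order_refl curve_length_upper)
    show "mono_on {..n} t1" "mono_on {..n} t2"
      using m by (auto simp: mono_on_def t1_def t2_def min_def max_def) (smt (verit, best))+
    show "t1 ` {..n} \<subseteq> {a..s}" "t2 ` {..n} \<subseteq> {s'..b}"
      using rng s by (auto simp: t1_def t2_def)
  qed
  finally show ?thesis .
qed

lemma curve_length_add:
  assumes "a \<le> s" "s \<le> b"
  shows "curve_length \<gamma> a b = curve_length \<gamma> a s + curve_length \<gamma> s b"
proof (rule antisym[OF _ curve_length_superadd[OF assms]])
  show "curve_length \<gamma> a b \<le> curve_length \<gamma> a s + curve_length \<gamma> s b"
  proof (rule curve_length_least)
    fix n and t :: "nat \<Rightarrow> real" assume "mono_on {..n} t" "t ` {..n} \<subseteq> {a..b}"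
    from curve_length_split[OF this, of s s \<gamma>] assms
    show "ennreal (\<Sum>i<n. dist (\<gamma> (t i)) (\<gamma> (t (Suc i)))) \<le> curve_length \<gamma> a s + curve_length \<gamma> s b"
      by fastforce
  qed
qed

lemma curve_length_lipschitz:
  assumes "a \<le> b" "1-lipschitz_on {a..b} \<gamma>"
  shows "curve_length \<gamma> a b \<le> ennreal (b - a)"
proof (rule curve_length_least)
  fix n and t :: "nat \<Rightarrow> real" assume t: "mono_on {..n} t" "t ` {..n} \<subseteq> {a..b}"
  have rng: "t i \<in> {a..b}" if "i \<le> n" for i using t(2) that by auto
  have "(\<Sum>i<n. dist (\<gamma> (t i)) (\<gamma> (t (Suc i)))) \<le> (\<Sum>i<n. t (Suc i) - t i)"
  proof (rule sum_mono)
    fix i assume i: "i \<in> {..<n}"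
    then have "dist (\<gamma> (t i)) (\<gamma> (t (Suc i))) \<le> 1 * dist (t i) (t (Suc i))"
      by (intro lipschitz_onD[OF assms(2)] rng) auto
    moreover have "t i \<le> t (Suc i)" using i t(1) by (auto simp: mono_on_def)
    ultimately show "dist (\<gamma> (t i)) (\<gamma> (t (Suc i))) \<le> t (Suc i) - t i"
      by (simp add: dist_real_def)
  qed
  also have "\<dots> = t n - t 0" by (rule sum_lessThan_telescope)
  also have "\<dots> \<le> b - a" using rng[of n] rng[of 0] by simp
  finally show "ennreal (\<Sum>i<n. dist (\<gamma> (t i)) (\<gamma> (t (Suc i)))) \<le> ennreal (b - a)"
    by (rule ennreal_leI)
qed

lemma rectifiable_curve_lipschitz:
  assumes "a \<le> b" "1-lipschitz_on {a..b} \<gamma>"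
  shows "rectifiable_curve \<gamma> a b"
  using curve_length_lipschitz[OF assms] assms lipschitz_on_continuous_on[OF assms(2)]
  by (auto simp: rectifiable_curve_def intro: le_less_trans)

section \<open>The length function and the arc-length parametrization\<close>

definition arclen :: "(real \<Rightarrow> 'a::metric_space) \<Rightarrow> real \<Rightarrow> real \<Rightarrow> real" where
  "arclen \<gamma> a t = enn2real (curve_length \<gamma> a t)"

context
  fixes \<gamma> :: "real \<Rightarrow> 'a::metric_space" and a b :: real
  assumes rect: "rectifiable_curve \<gamma> a b"
begin

lemma rectifiable_bounds: "a \<le> b" "continuous_on {a..b} \<gamma>" "curve_length \<gamma> a b < \<infinity>"
  using rect by (auto simp: rectifiable_curve_def)

lemma curve_length_finite:
  assumes "a \<le> s" "t \<le> b"
  shows "curve_length \<gamma> s t < \<infinity>"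
  using curve_length_mono[OF assms, of \<gamma>] rectifiable_bounds(3) by (rule le_less_trans)

lemma curve_length_eq_arclen:
  assumes "t \<in> {a..b}"
  shows "curve_length \<gamma> a t = ennreal (arclen \<gamma> a t)"
  using curve_length_finite[of a t] assms by (auto simp: arclen_def)

lemma curve_length_eq_arclen_diff:
  assumes "a \<le> s" "s \<le> t" "t \<le> b"
  shows "curve_length \<gamma> s t = ennreal (arclen \<gamma> a t - arclen \<gamma> a s)"
proof -
  obtain l where l: "curve_length \<gamma> s t = ennreal l" "l \<ge> 0"
    using curve_length_finite[of s t] assms by (cases "curve_length \<gamma> s t") auto
  have "ennreal (arclen \<gamma> a t) = ennreal (arclen \<gamma> a s) + ennreal l"
    using curve_length_add[of a s t \<gamma>] assms by (simp add: curve_length_eq_arclen l)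
  moreover have "arclen \<gamma> a s \<ge> 0" "arclen \<gamma> a t \<ge> 0" by (auto simp: arclen_def)
  ultimately have "arclen \<gamma> a t = arclen \<gamma> a s + l"
    using l by (simp flip: ennreal_plus)
  then show ?thesis using l by simp
qed

lemma arclen_mono:
  assumes "a \<le> s" "s \<le> t" "t \<le> b"
  shows "arclen \<gamma> a s \<le> arclen \<gamma> a t"
  unfolding arclen_def
  by (rule enn2real_mono) (use assms curve_length_mono[of a a s t \<gamma>] curve_length_finite[of a t] in auto)

lemma dist_le_arclen_diff:
  assumes "a \<le> s" "s \<le> t" "t \<le> b"
  shows "dist (\<gamma> s) (\<gamma> t) \<le> arclen \<gamma> a t - arclen \<gamma> a s"
  using dist_le_curve_length[of s t \<gamma>] assms arclen_mono[OF assms]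
  by (simp add: curve_length_eq_arclen_diff)

lemma arclen_start: "arclen \<gamma> a a = 0"
  by (simp add: arclen_def curve_length_refl)

lemma arclen_nonneg: "0 \<le> arclen \<gamma> a t"
  by (simp add: arclen_def)

text \<open>
  If a partition misses less than \<open>e\<close> of the length, then on each of its intervals the length
  function and the metric differ by at most \<open>e\<close>.
\<close>

lemma arclen_continuous: "continuous_on {a..b} (arclen \<gamma> a)"
proof (rule continuous_onI)
  fix c e :: real assume c: "c \<in> {a..b}" and e: "0 < e"
  have "\<exists>n t. mono_on {..n} t \<and> t ` {..n} \<subseteq> {a..b} \<and>
     arclen \<gamma> a b - e/2 < (\<Sum>i<n. dist (\<gamma> (t i)) (\<gamma> (t (Suc i))))"
  proof (rule ccontr)
    assume neg: "\<not> ?thesis"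
    have "curve_length \<gamma> a b \<le> ennreal (arclen \<gamma> a b - e/2)"
      by (rule curve_length_least) (use neg in \<open>force intro: ennreal_leI simp: not_less\<close>)
    then have "ennreal (arclen \<gamma> a b) \<le> ennreal (arclen \<gamma> a b - e/2)"
      using curve_length_eq_arclen[of b] rectifiable_bounds(1) by simp
    then have "arclen \<gamma> a b \<le> 0"
      using e arclen_nonneg[of b] by (cases "0 \<le> arclen \<gamma> a b - e/2") (auto simp: ennreal_le_iff ennreal_neg)
    then have 0: "arclen \<gamma> a b = 0" using arclen_nonneg[of b] by simp
    \<comment> \<open>\<open>ennreal\<close> truncates negative numbers to 0, so the comparison
      above only yields length 0; the one-point partition, with sum 0, then refutes
      \<open>neg\<close>.\<close>
    have "mono_on {..0::nat} (\<lambda>_. a)" "(\<lambda>_::nat. a) ` {..0} \<subseteq> {a..b}"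
      using rectifiable_bounds(1) by (auto simp: mono_on_def)
    then have "\<not> arclen \<gamma> a b - e/2 < (\<Sum>i<0::nat. dist (\<gamma> a) (\<gamma> a))" using neg by blast
    then show False using 0 e by simp
  qed
  then obtain n t where t: "mono_on {..n} t" "t ` {..n} \<subseteq> {a..b}"
     "arclen \<gamma> a b - e/2 < (\<Sum>i<n. dist (\<gamma> (t i)) (\<gamma> (t (Suc i))))" by blast
  have est: "arclen \<gamma> a s' - arclen \<gamma> a s \<le> dist (\<gamma> s) (\<gamma> s') + e/2"
    if s: "a \<le> s" "s \<le> s'" "s' \<le> b" and gap: "\<And>i. i \<le> n \<Longrightarrow> t i \<le> s \<or> s' \<le> t i" for s s'
  proof -
    have "ennreal (arclen \<gamma> a b - e/2) \<le> ennreal (\<Sum>i<n. dist (\<gamma> (t i)) (\<gamma> (t (Suc i))))"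
      using t(3) by (intro ennreal_leI) simp
    also have "\<dots> \<le> ennreal (arclen \<gamma> a s) + ennreal (dist (\<gamma> s) (\<gamma> s')) + ennreal (arclen \<gamma> a b - arclen \<gamma> a s')"
      using curve_length_split[OF t(1,2) s gap, of \<gamma>] s curve_length_eq_arclen[of s]
        curve_length_eq_arclen_diff[of s' b] by simp
    also have "\<dots> = ennreal (arclen \<gamma> a s + dist (\<gamma> s) (\<gamma> s') + (arclen \<gamma> a b - arclen \<gamma> a s'))"
      using arclen_mono[of s' b] s arclen_nonneg[of s] by (simp add: ennreal_plus)
    finally have "arclen \<gamma> a b - e/2 \<le> arclen \<gamma> a s + dist (\<gamma> s) (\<gamma> s') + (arclen \<gamma> a b - arclen \<gamma> a s')"
      using arclen_mono[of s' b] s arclen_nonneg[of s] by (subst (asm) ennreal_le_iff) auto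
    then show ?thesis by simp
  qed
  obtain d1 where d1: "d1 > 0" "\<And>s. s \<in> {a..b} \<Longrightarrow> dist s c < d1 \<Longrightarrow> dist (\<gamma> s) (\<gamma> c) < e/2"
    using rectifiable_bounds(2) c e unfolding continuous_on_iff by (meson half_gt_zero)
  \<comment> \<open>No partition point other than \<open>c\<close> lies closer than
    \<open>d2\<close> to \<open>c\<close>, so none lies strictly between \<open>s\<close> and
    \<open>c\<close>, and \<open>est\<close> applies to that interval.\<close>
  have "finite (t ` {..n} - {c})" by simp
  then obtain d2 where d2: "d2 > 0" "\<And>z. z \<in> t ` {..n} - {c} \<Longrightarrow> d2 \<le> dist c z"
    using finite_set_avoid[of "t ` {..n} - {c}" c] by blast
  show "\<exists>d>0. \<forall>s\<in>{a..b}. dist s c < d \<longrightarrow> dist (arclen \<gamma> a s) (arclen \<gamma> a c) \<le> e"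
  proof (intro exI conjI ballI impI)
    show "min d1 d2 > 0" using d1 d2 by simp
    fix s assume s: "s \<in> {a..b}" "dist s c < min d1 d2"
    have far: "t i = c \<or> d2 \<le> \<bar>c - t i\<bar>" if "i \<le> n" for i
      using d2(2)[of "t i"] that by (auto simp: dist_real_def)
    have dd: "dist (\<gamma> s) (\<gamma> c) < e/2" using d1 s by simp
    show "dist (arclen \<gamma> a s) (arclen \<gamma> a c) \<le> e"
    proof (cases "s \<le> c")
      case True
      have "t i \<le> s \<or> c \<le> t i" if "i \<le> n" for i
        using far[OF that] s(2) by (auto simp: dist_real_def abs_if split: if_splits)
      then have "arclen \<gamma> a c - arclen \<gamma> a s \<le> dist (\<gamma> s) (\<gamma> c) + e/2"
        using est[of s c] True s c by auto
      moreover have "arclen \<gamma> a s \<le> arclen \<gamma> a c" using arclen_mono True s c by simp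
      ultimately show ?thesis using dd by (simp add: dist_real_def)
    next
      case False
      have "t i \<le> c \<or> s \<le> t i" if "i \<le> n" for i
        using far[OF that] s(2) by (auto simp: dist_real_def abs_if split: if_splits)
      then have "arclen \<gamma> a s - arclen \<gamma> a c \<le> dist (\<gamma> s) (\<gamma> c) + e/2"
        using est[of c s] False s c by (auto simp: dist_commute)
      moreover have "arclen \<gamma> a c \<le> arclen \<gamma> a s" using arclen_mono False s c by simp
      ultimately show ?thesis using dd by (simp add: dist_real_def)
    qed
  qed
qed

lemma arclen_surj:
  assumes "s \<in> {0..arclen \<gamma> a b}"
  shows "\<exists>t\<in>{a..b}. arclen \<gamma> a t = s"
proof -
  have "\<exists>t\<ge>a. t \<le> b \<and> arclen \<gamma> a t = s"
    by (rule IVT'[OF _ _ rectifiable_bounds(1) arclen_continuous]) (use assms arclen_start in auto)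
  then show ?thesis by auto
qed

text \<open>The parameter chosen by \<open>SOME\<close> may differ from \<open>t\<close>, but two
  parameters with equal arc length bound a piece of length 0, on which \<open>\<gamma>\<close> is
  constant.\<close>

lemma arclength_param_arclen:
  assumes "t \<in> {a..b}"
  shows "arclength_param \<gamma> a b (arclen \<gamma> a t) = \<gamma> t"
proof -
  define s where "s = (SOME s. s \<in> {a..b} \<and> curve_length \<gamma> a s = ennreal (arclen \<gamma> a t))"
  have "s \<in> {a..b} \<and> curve_length \<gamma> a s = ennreal (arclen \<gamma> a t)"
    unfolding s_def by (rule someI[where x=t]) (use assms curve_length_eq_arclen in auto)
  then have s: "s \<in> {a..b}" "arclen \<gamma> a s = arclen \<gamma> a t"
    using arclen_nonneg[of t] by (auto simp: arclen_def)
  have "\<gamma> s = \<gamma> t"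
  proof (cases "s \<le> t")
    case True
    then have "dist (\<gamma> s) (\<gamma> t) \<le> 0" using dist_le_arclen_diff[of s t] s assms by simp
    then show ?thesis by simp
  next
    case False
    then have "dist (\<gamma> t) (\<gamma> s) \<le> 0" using dist_le_arclen_diff[of t s] s assms by simp
    then show ?thesis by simp
  qed
  then show ?thesis by (simp add: arclength_param_def s_def)
qed

lemma arclength_param_lipschitz: "1-lipschitz_on {0..arclen \<gamma> a b} (arclength_param \<gamma> a b)"
proof (rule lipschitz_onI)
  fix s s' assume "s \<in> {0..arclen \<gamma> a b}" "s' \<in> {0..arclen \<gamma> a b}"
  then obtain t t' where t: "t \<in> {a..b}" "s = arclen \<gamma> a t" "t' \<in> {a..b}" "s' = arclen \<gamma> a t'"
    using arclen_surj by metis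
  have "dist (\<gamma> t) (\<gamma> t') \<le> \<bar>s - s'\<bar>"
  proof (cases "t \<le> t'")
    case True
    then show ?thesis using dist_le_arclen_diff[of t t'] t by simp
  next
    case False
    then show ?thesis using dist_le_arclen_diff[of t' t] t dist_commute[of "\<gamma> t" "\<gamma> t'"] by simp
  qed
  then show "dist (arclength_param \<gamma> a b s) (arclength_param \<gamma> a b s') \<le> 1 * dist s s'"
    unfolding t(2,4) arclength_param_arclen[OF t(1)] arclength_param_arclen[OF t(3)]
    by (simp add: dist_real_def)
qed simp

lemma arclength_param_ends:
  "arclength_param \<gamma> a b 0 = \<gamma> a" "arclength_param \<gamma> a b (arclen \<gamma> a b) = \<gamma> b"
  using arclength_param_arclen[of a] arclength_param_arclen[of b] rectifiable_bounds(1) arclen_start by auto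

end

section \<open>Increments bounded by integrals\<close>

text \<open>A mean value inequality without derivatives: bisection (\<open>Bolzano\<close>) reduces
  it to small intervals around a given point, which is why the hypothesis concerns only
  \<open>s \<le> x \<le> t\<close>. It serves both for costs along curves and for the monotone
  substitution in arc length.\<close>

lemma integral_growth_bound:
  fixes v q :: "real \<Rightarrow> real"
  assumes ab: "a \<le> b" and q: "continuous_on {a..b} q"
    and loc: "\<And>x e. x \<in> {a..b} \<Longrightarrow> 0 < e \<Longrightarrow> \<exists>d>0. \<forall>s t. a \<le> s \<and> s \<le> x \<and> x \<le> t \<and> t \<le> b \<and> t - s < d
      \<longrightarrow> v t - v s \<le> (q x + e) * (t - s)"
  shows "v b - v a \<le> integral {a..b} q"
proof (rule field_le_epsilon)
  fix e' :: real assume "0 < e'"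
  define e where "e = e' / (b - a + 1)"
  have e: "0 < e" using \<open>0 < e'\<close> ab by (simp add: e_def)
  have int: "q integrable_on {s..t}" if "a \<le> s" "t \<le> b" for s t
    by (rule integrable_continuous_real, rule continuous_on_subset[OF q]) (use that in auto)
  define P where "P = (\<lambda>s t. a \<le> s \<and> t \<le> b \<longrightarrow> v t - v s \<le> integral {s..t} q + e * (t - s))"
  have "P a b"
    using ab
  proof (induct rule: Bolzano)
    case (trans r s t)
    show ?case unfolding P_def
    proof clarify
      assume rt: "a \<le> r" "t \<le> b"
      have "integral {r..s} q + integral {s..t} q = integral {r..t} q"
        by (rule Henstock_Kurzweil_Integration.integral_combine) (use trans rt int in auto)
      moreover have "v s - v r \<le> integral {r..s} q + e * (s - r)" "v t - v s \<le> integral {s..t} q + e * (t - s)"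
        using trans rt by (auto simp: P_def)
      ultimately show "v t - v r \<le> integral {r..t} q + e * (t - r)" by (simp add: algebra_simps)
    qed
  next
    case (local x)
    then have x: "x \<in> {a..b}" by simp
    obtain d1 where d1: "d1 > 0" "\<And>s t. a \<le> s \<and> s \<le> x \<and> x \<le> t \<and> t \<le> b \<and> t - s < d1
      \<longrightarrow> v t - v s \<le> (q x + e/2) * (t - s)" using loc[OF x, of "e/2"] e by auto
    obtain d2 where d2: "d2 > 0" "\<And>s. s \<in> {a..b} \<Longrightarrow> dist s x < d2 \<Longrightarrow> dist (q s) (q x) < e/2"
      using q x e unfolding continuous_on_iff by (meson half_gt_zero)
    show ?case
    proof (intro exI[of _ "min d1 d2"] conjI allI impI)
      show "min d1 d2 > 0" using d1 d2 by simp
      fix s t assume st: "s \<le> x \<and> x \<le> t \<and> t - s < min d1 d2"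
      show "P s t" unfolding P_def
      proof clarify
        assume b: "a \<le> s" "t \<le> b"
        have "(q x - e/2) * (t - s) = integral {s..t} (\<lambda>_. q x - e/2)"
          using st by simp
        also have "\<dots> \<le> integral {s..t} q"
        proof (rule integral_le)
          show "q integrable_on {s..t}" using int b by simp
          fix r assume "r \<in> {s..t}"
          then have "dist (q r) (q x) < e/2" using b st by (intro d2(2)) (auto simp: dist_real_def)
          then show "q x - e/2 \<le> q r" by (auto simp: dist_real_def abs_if split: if_splits)
        qed (simp add: integrable_const_ivl)
        finally have "(q x - e/2) * (t - s) \<le> integral {s..t} q" .
        moreover have "v t - v s \<le> (q x + e/2) * (t - s)" using d1(2) st b by auto
        moreover have "(q x + e/2) * (t - s) = (q x - e/2) * (t - s) + e * (t - s)" by (simp add: field_simps)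
        ultimately show "v t - v s \<le> integral {s..t} q + e * (t - s)" by linarith
      qed
    qed
  qed
  then have "v b - v a \<le> integral {a..b} q + e * (b - a)" by (simp add: P_def)
  also have "e * (b - a) \<le> e'" using ab \<open>0 < e'\<close> by (simp add: e_def field_simps)
  finally show "v b - v a \<le> integral {a..b} q + e'" by simp
qed

lemma nn_integral_Icc_eq_integral:
  fixes f :: "real \<Rightarrow> real"
  assumes "continuous_on {a..b} f" "\<And>t. t \<in> {a..b} \<Longrightarrow> 0 \<le> f t"
  shows "(\<integral>\<^sup>+ s \<in> {a..b}. ennreal (f s) \<partial>lborel) = ennreal (integral {a..b} f)"
  by (rule nn_integral_has_integral_lebesgue'[OF assms(2)])
    (use assms(1) in \<open>auto intro: integrable_integral integrable_continuous_real\<close>)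

section \<open>Discrete chains\<close>

text \<open>Each step is weighted by \<rho> at its starting point, so the cost is exactly the
  integral of \<rho> along the step function of \<open>step_path_of_chain\<close>.\<close>

definition chain_costs :: "('a::metric_space \<Rightarrow> real) \<Rightarrow> real \<Rightarrow> 'a \<Rightarrow> 'a \<Rightarrow> real set" where
  "chain_costs \<rho> \<delta> x w = {c. \<exists>n z. z 0 = x \<and> z n = w \<and> (\<forall>i<n. dist (z i) (z (Suc i)) \<le> \<delta>) \<and>
     c = (\<Sum>i<n. \<rho> (z i) * dist (z i) (z (Suc i)))}"

text \<open>The truncation at \<open>N\<close> keeps the cost finite where no \<open>\<delta>\<close>-chain arrives.\<close>

definition chain_cost :: "('a::metric_space \<Rightarrow> real) \<Rightarrow> real \<Rightarrow> real \<Rightarrow> 'a \<Rightarrow> 'a \<Rightarrow> real" where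
  "chain_cost \<rho> \<delta> N x w = Inf (insert N (chain_costs \<rho> \<delta> x w))"

context
  fixes \<rho> :: "'a::metric_space \<Rightarrow> real" and \<delta> N B :: real and x :: 'a
  assumes rho_nonneg: "\<And>z. 0 \<le> \<rho> z" and rho_le: "\<And>z. \<rho> z \<le> B" and delta: "0 < \<delta>" and N: "0 \<le> N"
begin

lemma chain_costs_nonneg: "c \<in> chain_costs \<rho> \<delta> x w \<Longrightarrow> 0 \<le> c"
  using rho_nonneg by (auto simp: chain_costs_def intro!: sum_nonneg)

lemma chain_cost_bdd: "bdd_below (insert N (chain_costs \<rho> \<delta> x w))"
  using chain_costs_nonneg N by (intro bdd_belowI[of _ 0]) auto

lemma chain_cost_nonneg: "0 \<le> chain_cost \<rho> \<delta> N x w"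
  unfolding chain_cost_def by (rule cInf_greatest) (use chain_costs_nonneg N in auto)

lemma chain_cost_le: "chain_cost \<rho> \<delta> N x w \<le> N"
  unfolding chain_cost_def by (rule cInf_lower[OF _ chain_cost_bdd]) simp

lemma chain_cost_start: "chain_cost \<rho> \<delta> N x x = 0"
proof -
  have "0 \<in> chain_costs \<rho> \<delta> x x"
    unfolding chain_costs_def by (rule CollectI, rule exI[of _ 0], rule exI[of _ "\<lambda>_. x"]) simp
  then have "chain_cost \<rho> \<delta> N x x \<le> 0"
    unfolding chain_cost_def by (intro cInf_lower[OF _ chain_cost_bdd]) simp
  then show ?thesis using chain_cost_nonneg[of x] by linarith
qed

lemma chain_costs_step:
  assumes "c \<in> chain_costs \<rho> \<delta> x z" "dist z w \<le> \<delta>"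
  shows "c + \<rho> z * dist z w \<in> chain_costs \<rho> \<delta> x w"
proof -
  obtain n p where p: "p 0 = x" "p n = z" "\<forall>i<n. dist (p i) (p (Suc i)) \<le> \<delta>"
     "c = (\<Sum>i<n. \<rho> (p i) * dist (p i) (p (Suc i)))"
    using assms by (auto simp: chain_costs_def)
  define p' where "p' = p(Suc n := w)"
  have "p' 0 = x" "p' (Suc n) = w" "\<forall>i<Suc n. dist (p' i) (p' (Suc i)) \<le> \<delta>"
    using p assms(2) by (auto simp: p'_def less_Suc_eq)
  moreover have "c + \<rho> z * dist z w = (\<Sum>i<Suc n. \<rho> (p' i) * dist (p' i) (p' (Suc i)))"
    using p by (simp add: p'_def)
  ultimately show ?thesis unfolding chain_costs_def by blast
qed

lemma chain_cost_step:
  assumes "dist z w \<le> \<delta>"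
  shows "chain_cost \<rho> \<delta> N x w \<le> chain_cost \<rho> \<delta> N x z + \<rho> z * dist z w"
proof -
  have "chain_cost \<rho> \<delta> N x w - \<rho> z * dist z w \<le> chain_cost \<rho> \<delta> N x z"
    unfolding chain_cost_def[of _ _ _ _ z]
  proof (rule cInf_greatest)
    fix c assume "c \<in> insert N (chain_costs \<rho> \<delta> x z)"
    then consider "c = N" | "c \<in> chain_costs \<rho> \<delta> x z" by auto
    then show "chain_cost \<rho> \<delta> N x w - \<rho> z * dist z w \<le> c"
    proof cases
      case 1
      then show ?thesis using chain_cost_le[of w] mult_nonneg_nonneg[OF rho_nonneg[of z] zero_le_dist[of z w]] by linarith
    next
      case 2
      have "chain_cost \<rho> \<delta> N x w \<le> c + \<rho> z * dist z w"
        unfolding chain_cost_def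
        by (rule cInf_lower[OF _ chain_cost_bdd]) (use chain_costs_step[OF 2 assms] in simp)
      then show ?thesis by simp
    qed
  qed simp
  then show ?thesis by simp
qed

lemma chain_cost_diff:
  assumes "dist z w \<le> \<delta>"
  shows "\<bar>chain_cost \<rho> \<delta> N x z - chain_cost \<rho> \<delta> N x w\<bar> \<le> max (\<rho> z) (\<rho> w) * dist z w"
proof -
  have "\<rho> z * dist z w \<le> max (\<rho> z) (\<rho> w) * dist z w" "\<rho> w * dist w z \<le> max (\<rho> z) (\<rho> w) * dist z w"
    by (auto simp: dist_commute intro: mult_right_mono)
  then show ?thesis
    using chain_cost_step[OF assms] chain_cost_step[of w z] assms by (simp add: dist_commute)
qed

lemma continuous_chain_cost: "continuous_on UNIV (chain_cost \<rho> \<delta> N x)"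
proof (rule continuous_onI)
  fix z e :: real and w :: 'a assume e: "0 < e"
  have B: "0 \<le> B" using rho_nonneg rho_le order_trans by blast
  show "\<exists>d>0. \<forall>z\<in>UNIV. dist z w < d \<longrightarrow> dist (chain_cost \<rho> \<delta> N x z) (chain_cost \<rho> \<delta> N x w) \<le> e"
  proof (intro exI conjI ballI impI)
    show "0 < min \<delta> (e / (B + 1))" using delta e B by simp
    fix z assume z: "dist z w < min \<delta> (e / (B + 1))"
    have "max (\<rho> z) (\<rho> w) * dist z w \<le> (B + 1) * (e / (B + 1))"
      using z rho_le[of z] rho_le[of w] B by (intro mult_mono) auto
    then show "dist (chain_cost \<rho> \<delta> N x z) (chain_cost \<rho> \<delta> N x w) \<le> e"
      using chain_cost_diff[of z w] z B by (simp add: dist_real_def)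
  qed
qed

text \<open>A piece of \<open>f\<close> shorter than \<delta> joins its ends by a single admissible
  step, whose weight is close to \<rho> at any point of the piece. The growth bound is applied to
  the cost and to its negative.\<close>

lemma chain_cost_growth:
  fixes f :: "real \<Rightarrow> 'a" and a b :: real
  assumes c: "continuous_on UNIV \<rho>" and ab: "a \<le> b" and f: "1-lipschitz_on {a..b} f"
  shows "\<bar>chain_cost \<rho> \<delta> N x (f a) - chain_cost \<rho> \<delta> N x (f b)\<bar> \<le> integral {a..b} (\<lambda>t. \<rho> (f t))"
proof -
  let ?u = "\<lambda>t. chain_cost \<rho> \<delta> N x (f t)"
  have cf: "continuous_on {a..b} (\<lambda>t. \<rho> (f t))"
    using continuous_on_compose2[OF c lipschitz_on_continuous_on[OF f]] by simp
  have loc: "\<exists>d>0. \<forall>s t. a \<le> s \<and> s \<le> r \<and> r \<le> t \<and> t \<le> b \<and> t - s < d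
      \<longrightarrow> \<bar>?u t - ?u s\<bar> \<le> (\<rho> (f r) + e) * (t - s)"
    if r: "r \<in> {a..b}" and e: "0 < e" for r e :: real
  proof -
    obtain d where d: "d > 0" "\<And>s. s \<in> {a..b} \<Longrightarrow> dist s r < d \<Longrightarrow> dist (\<rho> (f s)) (\<rho> (f r)) < e"
      using cf r e unfolding continuous_on_iff by meson
    show ?thesis
    proof (intro exI[of _ "min d \<delta>"] conjI allI impI)
      show "0 < min d \<delta>" using d delta by simp
      fix s t assume st: "a \<le> s \<and> s \<le> r \<and> r \<le> t \<and> t \<le> b \<and> t - s < min d \<delta>"
      have D: "dist (f t) (f s) \<le> t - s"
        using lipschitz_onD[OF f, of t s] st by (simp add: dist_real_def)
      have "\<bar>?u t - ?u s\<bar> \<le> max (\<rho> (f t)) (\<rho> (f s)) * dist (f t) (f s)"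
        by (rule chain_cost_diff) (use D st in simp)
      also have "\<dots> \<le> (\<rho> (f r) + e) * (t - s)"
      proof (rule mult_mono)
        show "max (\<rho> (f t)) (\<rho> (f s)) \<le> \<rho> (f r) + e"
          using d(2)[of t] d(2)[of s] st by (auto simp: dist_real_def)
        show "0 \<le> \<rho> (f r) + e" using rho_nonneg[of "f r"] e by simp
      qed (use D in auto)
      finally show "\<bar>?u t - ?u s\<bar> \<le> (\<rho> (f r) + e) * (t - s)" .
    qed
  qed
  have "?u b - ?u a \<le> integral {a..b} (\<lambda>t. \<rho> (f t))"
    by (rule integral_growth_bound[OF ab cf]) (use loc in \<open>meson abs_le_D1\<close>)
  moreover have "(- ?u b) - (- ?u a) \<le> integral {a..b} (\<lambda>t. \<rho> (f t))"
  proof (rule integral_growth_bound[OF ab cf])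
    fix r e assume "r \<in> {a..b}" "0 < (e::real)"
    from loc[OF this] obtain d where "d > 0" "\<forall>s t. a \<le> s \<and> s \<le> r \<and> r \<le> t \<and> t \<le> b \<and> t - s < d
      \<longrightarrow> \<bar>?u t - ?u s\<bar> \<le> (\<rho> (f r) + e) * (t - s)" by blast
    then show "\<exists>d>0. \<forall>s t. a \<le> s \<and> s \<le> r \<and> r \<le> t \<and> t \<le> b \<and> t - s < d
      \<longrightarrow> - ?u t - - ?u s \<le> (\<rho> (f r) + e) * (t - s)" by (intro exI[of _ d]) fastforce
  qed
  ultimately show ?thesis by linarith
qed

lemma upper_gradient_chain_cost:
  assumes c: "continuous_on UNIV \<rho>"
  shows "upper_gradient (chain_cost \<rho> \<delta> N x) \<rho>"
  unfolding upper_gradient_def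
proof (intro conjI allI impI)
  show "\<rho> \<in> borel_measurable borel" using c by (rule borel_measurable_continuous_onI)
  show "0 \<le> \<rho> z" for z by (rule rho_nonneg)
  fix \<gamma> :: "real \<Rightarrow> 'a" and a b assume "rectifiable_curve \<gamma> a b \<and> \<not> \<gamma> constant_on {a..b}"
  then have r: "rectifiable_curve \<gamma> a b" by simp
  let ?f = "arclength_param \<gamma> a b" and ?l = "arclen \<gamma> a b"
  have lip: "1-lipschitz_on {0..?l} ?f" by (rule arclength_param_lipschitz[OF r])
  have "ennreal \<bar>chain_cost \<rho> \<delta> N x (?f 0) - chain_cost \<rho> \<delta> N x (?f ?l)\<bar>
     \<le> ennreal (integral {0..?l} (\<lambda>t. \<rho> (?f t)))"
    by (rule ennreal_leI, rule chain_cost_growth[OF c _ lip]) (simp add: arclen_def)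
  also have "\<dots> = (\<integral>\<^sup>+ s \<in> {0..?l}. ennreal (\<rho> (?f s)) \<partial>lborel)"
    by (rule nn_integral_Icc_eq_integral[symmetric])
      (use continuous_on_compose2[OF c lipschitz_on_continuous_on[OF lip]] rho_nonneg in auto)
  finally show "ennreal \<bar>chain_cost \<rho> \<delta> N x (\<gamma> a) - chain_cost \<rho> \<delta> N x (\<gamma> b)\<bar> \<le> path_integral \<gamma> a b (\<lambda>z. ennreal (\<rho> z))"
    using arclength_param_ends[OF r] by (simp add: path_integral_def arclen_def)
qed

end

text \<open>A value below \<open>K \<le> N\<close> cannot be due to the truncation.\<close>

lemma chain_cost_less_imp_chain:
  assumes "chain_cost \<rho> \<delta> N x w < K" "K \<le> N"
  shows "\<exists>c\<in>chain_costs \<rho> \<delta> x w. c < K"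
proof -
  have "\<exists>c\<in>insert N (chain_costs \<rho> \<delta> x w). c < K"
    using assms unfolding chain_cost_def by (meson cInf_lessD insert_not_empty)
  then show ?thesis using assms(2) by auto
qed

section \<open>Limits of chains\<close>

text \<open>Step functions along chains are not continuous, hence equicontinuity is required only up
  to errors that vanish in the limit.\<close>

lemma Arzela_Ascoli_almost_lipschitz:
  fixes f :: "nat \<Rightarrow> real \<Rightarrow> 'a::metric_space"
  assumes Y: "compact Y" and inY: "\<And>n t. f n t \<in> Y"
    and lip: "\<And>n s t. dist (f n s) (f n t) \<le> \<bar>s - t\<bar> + \<delta> n" and d0: "\<delta> \<longlonglongrightarrow> 0"
  obtains r g where "strict_mono (r::nat\<Rightarrow>nat)" "\<And>t. (\<lambda>n. f (r n) t) \<longlonglongrightarrow> g t"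
    "\<And>t. g t \<in> Y" "1-lipschitz_on UNIV g"
proof -
  define w where "w n = (\<lambda>q::rat. f n (of_rat q))" for n
  \<comment> \<open>Sequential compactness of the countable product over the rationals replaces a
    diagonal extraction.\<close>
  have "compact (PiE UNIV (\<lambda>_::rat. Y))"
    using Y compactin_PiE[of "\<lambda>_::rat. euclidean :: 'a topology" UNIV "\<lambda>_. Y"]
    by (simp add: euclidean_product_topology)
  moreover have "w n \<in> PiE UNIV (\<lambda>_. Y)" for n using inY by (auto simp: w_def)
  ultimately obtain l r where r: "strict_mono r" "(w \<circ> r) \<longlonglongrightarrow> l"
    unfolding compact_eq_seq_compact_metric seq_compact_def by metis
  have conv: "(\<lambda>n. f (r n) (of_rat q)) \<longlonglongrightarrow> l q" for q
  proof -
    have "(\<lambda>n. (w \<circ> r) n q) \<longlonglongrightarrow> l q"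
      using continuous_on_tendsto_compose[OF continuous_on_product_coordinates[of q] r(2)] by simp
    then show ?thesis by (simp add: w_def)
  qed
  have "\<exists>y\<in>Y. (\<lambda>n. f (r n) t) \<longlonglongrightarrow> y" for t
  proof -
    have "Cauchy (\<lambda>n. f (r n) t)"
    proof (rule metric_CauchyI)
      fix e :: real assume e: "0 < e"
      obtain q where q: "\<bar>t - of_rat q\<bar> < e / 8"
      proof -
        obtain q :: rat where "t - e/8 < of_rat q" "of_rat q < t + e/8"
          using of_rat_dense[of "t - e/8" "t + e/8"] e by auto
        then show thesis by (intro that[of q]) linarith
      qed
      have "Cauchy (\<lambda>n. f (r n) (of_rat q))" using conv LIMSEQ_imp_Cauchy by blast
      then obtain M1 where M1: "\<And>m n. m \<ge> M1 \<Longrightarrow> n \<ge> M1 \<Longrightarrow> dist (f (r m) (of_rat q)) (f (r n) (of_rat q)) < e/4"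
        using e metric_CauchyD[of _ "e/4"] by (metis zero_less_divide_iff zero_less_numeral)
      have "\<forall>\<^sub>F n in sequentially. \<delta> n < e/8" using d0 e by (intro order_tendstoD(2)) auto
      then obtain M2 where M2: "\<And>n. n \<ge> M2 \<Longrightarrow> \<delta> n < e/8" by (auto simp: eventually_sequentially)
      show "\<exists>M. \<forall>m\<ge>M. \<forall>n\<ge>M. dist (f (r m) t) (f (r n) t) < e"
      proof (intro exI allI impI)
        fix m n assume mn: "m \<ge> max M1 M2" "n \<ge> max M1 M2"
        have near: "dist (f (r k) t) (f (r k) (of_rat q)) < e/4" if "k \<ge> M2" for k
        proof -
          have "r k \<ge> M2" using that seq_suble[OF r(1), of k] by simp
          then show ?thesis using lip[of "r k" t "of_rat q"] q M2[of "r k"] by linarith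
        qed
        show "dist (f (r m) t) (f (r n) t) < e"
        proof -
          have "dist (f (r m) t) (f (r m) (of_rat q)) < e/4" "dist (f (r n) t) (f (r n) (of_rat q)) < e/4"
            "dist (f (r m) (of_rat q)) (f (r n) (of_rat q)) < e/4"
            using near[of m] near[of n] M1[of m n] mn by simp_all
          then show ?thesis
            using dist_triangle[of "f (r m) t" "f (r n) t" "f (r m) (of_rat q)"]
              dist_triangle2[of "f (r m) (of_rat q)" "f (r n) t" "f (r n) (of_rat q)"] e by linarith
        qed
      qed
    qed
    moreover have "complete Y" using Y by (simp add: compact_imp_complete)
    ultimately show ?thesis using inY by (metis completeE)
  qed
  then obtain g where g: "\<And>t. g t \<in> Y" "\<And>t. (\<lambda>n. f (r n) t) \<longlonglongrightarrow> g t" by metis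
  moreover have "1-lipschitz_on UNIV g"
  proof (rule lipschitz_onI)
    fix s t :: real
    have "(\<lambda>n. dist (f (r n) s) (f (r n) t)) \<longlonglongrightarrow> dist (g s) (g t)"
      by (intro tendsto_dist g)
    moreover have "(\<lambda>n. \<bar>s - t\<bar> + \<delta> (r n)) \<longlonglongrightarrow> \<bar>s - t\<bar> + 0"
      using LIMSEQ_subseq_LIMSEQ[OF d0 r(1)] by (intro tendsto_intros) (simp add: o_def)
    ultimately have "dist (g s) (g t) \<le> \<bar>s - t\<bar> + 0"
      by (rule LIMSEQ_le) (use lip in auto)
    then show "dist (g s) (g t) \<le> 1 * dist s t" by (simp add: dist_real_def)
  qed simp
  ultimately show thesis using that r(1) by blast
qed

text \<open>The chain is run at unit speed: the path rests at \<open>z i\<close> for a time equal to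
  the length of the step that follows, then jumps.\<close>

lemma step_path_of_chain:
  fixes z :: "nat \<Rightarrow> 'a::metric_space" and \<rho> :: "'a \<Rightarrow> real"
  assumes small: "\<And>i. i < n \<Longrightarrow> dist (z i) (z (Suc i)) \<le> \<delta>" and rho: "\<And>w. 0 \<le> \<rho> w" and d: "0 \<le> \<delta>"
  defines "L \<equiv> (\<Sum>i<n. dist (z i) (z (Suc i)))"
  obtains f :: "real \<Rightarrow> 'a" where "\<And>t. t < 0 \<Longrightarrow> f t = z 0" "\<And>t. L \<le> t \<Longrightarrow> f t = z n"
    "\<And>s t. dist (f s) (f t) \<le> \<bar>s - t\<bar> + \<delta>" "\<And>t. dist (z 0) (f t) \<le> L"
    "(\<lambda>t. \<rho> (f t)) \<in> borel_measurable borel"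
    "(\<integral>\<^sup>+ t \<in> {0..<L}. ennreal (\<rho> (f t)) \<partial>lborel) = ennreal (\<Sum>i<n. \<rho> (z i) * dist (z i) (z (Suc i)))"
proof -
  define s where "s k = (\<Sum>i<k. dist (z i) (z (Suc i)))" for k
  have s0: "s 0 = 0" and sS: "s (Suc k) = s k + dist (z k) (z (Suc k))" for k by (auto simp: s_def)
  have smono: "s i \<le> s j" if "i \<le> j" for i j
    using that by (induction rule: dec_induct) (auto simp: sS intro: order_trans)
  have dist_s: "dist (z i) (z j) \<le> s j - s i" if "i \<le> j" for i j
    using that
  proof (induction rule: dec_induct)
    case (step k)
    then show ?case using dist_triangle[of "z i" "z (Suc k)" "z k"] sS[of k] by simp
  qed simp
  \<comment> \<open>Counting the breakpoints passed gives a monotone index even when some steps have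
    length 0, and makes measurability immediate.\<close>
  define idx :: "real \<Rightarrow> nat" where "idx t = (\<Sum>j\<in>{1..n}. if s j \<le> t then 1 else 0)" for t
  have idx_card: "idx t = card {j\<in>{1..n}. s j \<le> t}" for t
    by (simp add: idx_def sum.If_cases Int_def)
  have idx_le: "idx t \<le> n" for t
    using card_mono[of "{1..n}" "{j\<in>{1..n}. s j \<le> t}"] unfolding idx_card by fastforce
  have idx_ge: "i \<le> idx t" if "i \<le> n" "s i \<le> t" for i t
  proof -
    have "{1..i} \<subseteq> {j\<in>{1..n}. s j \<le> t}" using that smono[of _ i] by force
    then have "card {1..i} \<le> card {j\<in>{1..n}. s j \<le> t}" by (intro card_mono) auto
    then show ?thesis by (simp add: idx_card)
  qed
  have idx_less: "idx t < i" if "0 < i" "t < s i" for i t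
  proof -
    have "\<not> s j \<le> t" if "i \<le> j" for j using \<open>t < s i\<close> smono[OF that] by linarith
    then have "{j\<in>{1..n}. s j \<le> t} \<subseteq> {1..<i}" by (auto simp: not_le[symmetric])
    then have "card {j\<in>{1..n}. s j \<le> t} \<le> card {1..<i}" by (intro card_mono) auto
    then show ?thesis using that by (simp add: idx_card)
  qed
  have s_idx: "s (idx t) \<le> t" if "0 < idx t" for t
    using idx_less[of "idx t" t] that by force
  have idx_s: "t < s (Suc (idx t))" if "idx t < n" for t
    using idx_ge[of "Suc (idx t)" t] that by force
  define f where "f t = z (idx t)" for t
  have near: "dist (f t) (f t') \<le> \<bar>t - t'\<bar> + \<delta>" if "t \<le> t'" for t t'
  proof -
    have ij: "idx t \<le> idx t'"
      using that by (auto simp: idx_def intro!: sum_mono)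
    show ?thesis
    proof (cases "idx t < n \<and> 0 < idx t'")
      case True
      have "dist (f t) (f t') \<le> s (idx t') - s (idx t)" using dist_s[OF ij] by (simp add: f_def)
      moreover have "s (idx t') \<le> t'" using s_idx True by simp
      moreover have "s (idx t) \<ge> t - \<delta>" using idx_s[of t] sS[of "idx t"] small[of "idx t"] True by simp
      ultimately show ?thesis using that by simp
    next
      case False
      then have "idx t = idx t'" using ij idx_le[of t'] by auto
      then show ?thesis using d by (simp add: f_def)
    qed
  qed
  have L: "L = s n" by (simp add: L_def s_def)
  have meas_idx: "idx \<in> borel_measurable borel"
    unfolding idx_def by measurable
  have meas: "(\<lambda>t. h (f t)) \<in> borel_measurable borel" for h :: "'a \<Rightarrow> real"
    unfolding f_def by (rule measurable_compose[OF meas_idx]) (rule borel_measurable_continuous_onI, simp)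
  have int: "(\<integral>\<^sup>+ t \<in> {0..<s m}. ennreal (\<rho> (f t)) \<partial>lborel) = ennreal (\<Sum>i<m. \<rho> (z i) * dist (z i) (z (Suc i)))"
    if "m \<le> n" for m
    using that
  proof (induction m)
    case 0 then show ?case by (simp add: s0)
  next
    case (Suc m)
    have sm: "0 \<le> s m" "s m \<le> s (Suc m)" using smono[of 0 m] smono[of m "Suc m"] s0 by auto
    have "(\<integral>\<^sup>+ t \<in> {0..<s (Suc m)}. ennreal (\<rho> (f t)) \<partial>lborel)
      = (\<integral>\<^sup>+ t. ennreal (\<rho> (f t)) * indicator {0..<s m} t + ennreal (\<rho> (z m)) * indicator {s m..<s (Suc m)} t \<partial>lborel)"
    proof (rule nn_integral_cong)
      fix t :: real
      have "idx t = m" if "s m \<le> t" "t < s (Suc m)"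
        using idx_ge[of m t] idx_less[of "Suc m" t] that Suc.prems by simp
      then show "ennreal (\<rho> (f t)) * indicator {0..<s (Suc m)} t
        = ennreal (\<rho> (f t)) * indicator {0..<s m} t + ennreal (\<rho> (z m)) * indicator {s m..<s (Suc m)} t"
        using sm by (auto simp: indicator_def f_def)
    qed
    also have "\<dots> = (\<integral>\<^sup>+ t \<in> {0..<s m}. ennreal (\<rho> (f t)) \<partial>lborel)
       + (\<integral>\<^sup>+ t. ennreal (\<rho> (z m)) * indicator {s m..<s (Suc m)} t \<partial>lborel)"
      using meas[of \<rho>] by (intro nn_integral_add) auto
    also have "(\<integral>\<^sup>+ t. ennreal (\<rho> (z m)) * indicator {s m..<s (Suc m)} t \<partial>lborel)
       = ennreal (\<rho> (z m) * dist (z m) (z (Suc m)))"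
      using sm sS[of m] rho[of "z m"] by (simp add: nn_integral_cmult_indicator ennreal_mult)
    also have "(\<integral>\<^sup>+ t \<in> {0..<s m}. ennreal (\<rho> (f t)) \<partial>lborel) = ennreal (\<Sum>i<m. \<rho> (z i) * dist (z i) (z (Suc i)))"
      using Suc by simp
    also have "\<dots> + ennreal (\<rho> (z m) * dist (z m) (z (Suc m))) = ennreal (\<Sum>i<Suc m. \<rho> (z i) * dist (z i) (z (Suc i)))"
      using rho by (simp add: ennreal_plus sum_nonneg)
    finally show ?case .
  qed
  show thesis
  proof (rule that[of f])
    show "f t = z 0" if "t < 0" for t
    proof -
      have "\<not> 0 < idx t" using s_idx[of t] smono[of 0 "idx t"] s0 that by auto
      then show ?thesis by (simp add: f_def)
    qed
    show "f t = z n" if "L \<le> t" for t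
      using idx_ge[of n t] idx_le[of t] that by (simp add: L f_def)
    show "dist (f t) (f t') \<le> \<bar>t - t'\<bar> + \<delta>" for t t'
      using near[of t t'] near[of t' t] by (cases "t \<le> t'") (simp_all add: dist_commute abs_minus_commute)
    show "dist (z 0) (f t) \<le> L" for t
      using dist_s[of 0 "idx t"] smono[of "idx t" n] idx_le[of t] s0 by (simp add: f_def L)
    show "(\<lambda>t. \<rho> (f t)) \<in> borel_measurable borel" by (rule meas)
    show "(\<integral>\<^sup>+ t \<in> {0..<L}. ennreal (\<rho> (f t)) \<partial>lborel) = ennreal (\<Sum>i<n. \<rho> (z i) * dist (z i) (z (Suc i)))"
      using int[of n] by (simp add: L)
  qed
qed

text \<open>The lower bound \<open>c\<close> limits every chain to length \<open>K / c\<close>, so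
  the step paths stay in one compact ball and a subsequence converges. Fatou's lemma carries the
  bound on the integral to the limit.\<close>

lemma chain_limit:
  fixes \<rho> :: "'a::metric_space \<Rightarrow> real"
  assumes proper: "\<And>r. compact (cball x r)"
    and cont: "continuous_on UNIV \<rho>" and c: "0 < c" and rho: "\<And>z. c \<le> \<rho> z"
    and chains: "\<And>\<delta>. 0 < \<delta> \<Longrightarrow> \<exists>k\<in>chain_costs \<rho> \<delta> x y. k \<le> K"
  obtains T f where "0 \<le> T" "T \<le> K / c" "1-lipschitz_on UNIV f" "\<And>t. t \<le> 0 \<Longrightarrow> f t = x"
    "\<And>t. T \<le> t \<Longrightarrow> f t = y" "integral {0..T} (\<lambda>t. \<rho> (f t)) \<le> K"
proof -
  have rho0: "0 \<le> \<rho> z" for z using rho[of z] c by simp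
  define \<delta> :: "nat \<Rightarrow> real" where "\<delta> k = 1 / (real k + 1)" for k
  have dpos: "0 < \<delta> k" for k by (simp add: \<delta>_def)
  have dlim: "\<delta> \<longlonglongrightarrow> 0" unfolding \<delta>_def by (rule LIMSEQ_inverse_real_of_nat[unfolded inverse_eq_divide Suc_eq_plus1 of_nat_add of_nat_1, simplified])
  define Q where "Q k L f \<longleftrightarrow> 0 \<le> L \<and> L \<le> K / c \<and> (\<forall>t<0. f t = x) \<and> (\<forall>t\<ge>L. f t = y) \<and>
     (\<forall>s t. dist (f s) (f t) \<le> \<bar>s - t\<bar> + \<delta> k) \<and> (\<forall>t. dist x (f t) \<le> L) \<and>
     (\<lambda>t. \<rho> (f t)) \<in> borel_measurable borel \<and>
     (\<integral>\<^sup>+ t \<in> {0..<L}. ennreal (\<rho> (f t)) \<partial>lborel) \<le> ennreal K" for k L f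
  have "\<exists>p. Q k (fst p) (snd p)" for k
  proof -
    obtain n z where z: "z 0 = x" "z n = y" "\<forall>i<n. dist (z i) (z (Suc i)) \<le> \<delta> k"
      "(\<Sum>i<n. \<rho> (z i) * dist (z i) (z (Suc i))) \<le> K"
      using chains[OF dpos[of k]] by (auto simp: chain_costs_def)
    define L where "L = (\<Sum>i<n. dist (z i) (z (Suc i)))"
    have "c * L \<le> (\<Sum>i<n. \<rho> (z i) * dist (z i) (z (Suc i)))"
      unfolding L_def sum_distrib_left by (intro sum_mono mult_right_mono rho) auto
    then have "L \<le> K / c" using z(4) c by (simp add: field_simps)
    moreover have "0 \<le> L" by (simp add: L_def sum_nonneg)
    moreover obtain f where f: "\<And>t. t < 0 \<Longrightarrow> f t = z 0" "\<And>t. L \<le> t \<Longrightarrow> f t = z n"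
      "\<And>s t. dist (f s) (f t) \<le> \<bar>s - t\<bar> + \<delta> k" "\<And>t. dist (z 0) (f t) \<le> L"
      "(\<lambda>t. \<rho> (f t)) \<in> borel_measurable borel"
      "(\<integral>\<^sup>+ t \<in> {0..<L}. ennreal (\<rho> (f t)) \<partial>lborel) = ennreal (\<Sum>i<n. \<rho> (z i) * dist (z i) (z (Suc i)))"
      by (rule step_path_of_chain[of n z "\<delta> k" \<rho>, folded L_def]) (use z(3) rho0 dpos[of k] in auto)
    ultimately show ?thesis
      using z by (intro exI[of _ "(L, f)"]) (auto simp: Q_def intro: ennreal_leI)
  qed
  then have "\<exists>p. \<forall>k. Q k (fst (p k)) (snd (p k))" by (intro choice allI)
  then obtain p where p: "\<And>k. Q k (fst (p k)) (snd (p k))" by blast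
  define L f where "L k = fst (p k)" and "f k = snd (p k)" for k
  have f: "\<And>k. 0 \<le> L k" "\<And>k. L k \<le> K / c" "\<And>k t. t < 0 \<Longrightarrow> f k t = x"
     "\<And>k t. L k \<le> t \<Longrightarrow> f k t = y" "\<And>k s t. dist (f k s) (f k t) \<le> \<bar>s - t\<bar> + \<delta> k"
     "\<And>k t. dist x (f k t) \<le> L k" "\<And>k. (\<lambda>t. \<rho> (f k t)) \<in> borel_measurable borel"
     "\<And>k. (\<integral>\<^sup>+ t \<in> {0..<L k}. ennreal (\<rho> (f k t)) \<partial>lborel) \<le> ennreal K"
    using p by (simp_all add: Q_def L_def f_def)
  have "\<And>k. L k \<in> {0..K / c}" using f(1,2) by simp
  then obtain T r1 where r1: "T \<in> {0..K / c}" "strict_mono r1" "(L \<circ> r1) \<longlonglongrightarrow> T"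
    using compact_imp_seq_compact[OF compact_Icc[of 0 "K / c"]] unfolding seq_compact_def by metis
  obtain r2 g where r2: "strict_mono (r2::nat\<Rightarrow>nat)" "\<And>t. (\<lambda>n. f (r1 (r2 n)) t) \<longlonglongrightarrow> g t"
      and g: "1-lipschitz_on UNIV g"
  proof (rule Arzela_Ascoli_almost_lipschitz[of "cball x (K / c)" "\<lambda>k. f (r1 k)" "\<lambda>k. \<delta> (r1 k)"])
    show "f (r1 k) t \<in> cball x (K / c)" for k t using f(6)[of "r1 k" t] f(2)[of "r1 k"] by simp
    show "(\<lambda>k. \<delta> (r1 k)) \<longlonglongrightarrow> 0" using LIMSEQ_subseq_LIMSEQ[OF dlim r1(2)] by (simp add: o_def)
  qed (use proper f(5) in auto)
  define r where "r = (\<lambda>n. r1 (r2 n))"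
  have conv: "(\<lambda>n. f (r n) t) \<longlonglongrightarrow> g t" for t using r2 by (simp add: r_def)
  have LT: "(\<lambda>n. L (r n)) \<longlonglongrightarrow> T"
    using LIMSEQ_subseq_LIMSEQ[OF r1(3) r2(1)] by (simp add: o_def r_def)
  have gx: "g t = x" if "t < 0" for t
    using LIMSEQ_unique[OF conv[of t]] f(3)[OF that] by simp
  have gy: "g t = y" if "T < t" for t
  proof -
    have "\<forall>\<^sub>F n in sequentially. L (r n) < t" using LT that by (rule order_tendstoD)
    then have "\<forall>\<^sub>F n in sequentially. f (r n) t = y" by eventually_elim (simp add: f(4))
    then have "(\<lambda>n. f (r n) t) \<longlonglongrightarrow> y" by (rule tendsto_eventually)
    then show ?thesis using LIMSEQ_unique[OF conv[of t]] by blast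
  qed
  have gx': "g t = x" if "t \<le> 0" for t
  proof -
    have "dist (g t) x \<le> 0"
    proof (rule field_le_epsilon)
      fix e :: real assume "0 < e"
      then show "dist (g t) x \<le> 0 + e"
        using lipschitz_onD[OF g, of t "t - e"] gx[of "t - e"] that by (simp add: dist_real_def)
    qed
    then show ?thesis by simp
  qed
  have gy': "g t = y" if "T \<le> t" for t
  proof -
    have "dist (g t) y \<le> 0"
    proof (rule field_le_epsilon)
      fix e :: real assume "0 < e"
      then show "dist (g t) y \<le> 0 + e"
        using lipschitz_onD[OF g, of t "t + e"] gy[of "t + e"] that by (simp add: dist_real_def)
    qed
    then show ?thesis by simp
  qed
  have cg: "continuous_on {0..T} (\<lambda>t. \<rho> (g t))"
    using continuous_on_compose2[OF cont, of _ g] lipschitz_on_continuous_on[OF lipschitz_on_subset[OF g]] by blast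
  let ?F = "\<lambda>n t. ennreal (\<rho> (f (r n) t)) * indicator {0..<L (r n)} t"
  have "ennreal (integral {0..T} (\<lambda>t. \<rho> (g t))) = (\<integral>\<^sup>+ t \<in> {0..T}. ennreal (\<rho> (g t)) \<partial>lborel)"
    by (rule nn_integral_Icc_eq_integral[symmetric, OF cg]) (simp add: rho0)
  also have "\<dots> \<le> (\<integral>\<^sup>+ t. liminf (\<lambda>n. ?F n t) \<partial>lborel)"
  proof (rule nn_integral_mono_AE)
    \<comment> \<open>At \<open>t = T\<close> the lengths \<open>L (r n)\<close> may approach from
      below, where the integrands vanish; a single point is harmless.\<close>
    have "AE t in lborel. t \<noteq> T" by (rule AE_lborel_singleton)
    then show "AE t in lborel. ennreal (\<rho> (g t)) * indicator {0..T} t \<le> liminf (\<lambda>n. ?F n t)"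
    proof eventually_elim
      case (elim t)
      show ?case
      proof (cases "t \<in> {0..<T}")
        case True
        then have "\<forall>\<^sub>F n in sequentially. t < L (r n)" using LT by (intro order_tendstoD(1)) auto
        then have ev: "\<forall>\<^sub>F n in sequentially. ennreal (\<rho> (f (r n) t)) = ?F n t"
          by eventually_elim (use True in \<open>simp add: indicator_def\<close>)
        have "(\<lambda>n. ennreal (\<rho> (f (r n) t))) \<longlonglongrightarrow> ennreal (\<rho> (g t))"
          using continuous_on_tendsto_compose[OF cont conv] by (intro tendsto_ennrealI) auto
        then have "(\<lambda>n. ?F n t) \<longlonglongrightarrow> ennreal (\<rho> (g t))"
          using ev by (rule Lim_transform_eventually)
        then have "liminf (\<lambda>n. ?F n t) = ennreal (\<rho> (g t))"
          by (rule lim_imp_Liminf[rotated]) simp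
        then show ?thesis using True by simp
      next
        case False
        then have "t \<notin> {0..T}" using elim by auto
        then have "(indicator {0..T} t :: ennreal) = 0" by (rule indicator_simps(2))
        then show ?thesis by (simp only: mult_zero_right zero_le)
      qed
    qed
  qed
  also have "\<dots> \<le> liminf (\<lambda>n. (\<integral>\<^sup>+ t. ?F n t \<partial>lborel))"
    by (rule nn_integral_liminf) (use f(7) in auto)
  also have "\<dots> \<le> liminf (\<lambda>n. ennreal K)"
    by (rule Liminf_mono) (use f(8) in simp)
  also have "\<dots> = ennreal K" by (simp add: Liminf_const)
  finally have "integral {0..T} (\<lambda>t. \<rho> (g t)) \<le> K \<or> integral {0..T} (\<lambda>t. \<rho> (g t)) \<le> 0"
    using ennreal_le_iff2 by blast
  moreover have "0 \<le> K"
  proof -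
    have "0 \<le> K / c" using r1(1) by auto
    then show ?thesis using c by (simp add: zero_le_divide_iff)
  qed
  ultimately have "integral {0..T} (\<lambda>t. \<rho> (g t)) \<le> K" by auto
  then show thesis using that[of T g] r1(1) g gx' gy' by auto
qed

section \<open>Weak limits of empirical measures on compact metric spaces\<close>

text \<open>The first differing digit contributes \<open>1 / 3 ^ k\<close>, all later ones together
  at most half of that. Digits 0 and 1 in base 3 leave such gaps, unlike in base 2, and so can be
  read off an approximate value of the sum.\<close>

lemma ternary_digits_eq:
  fixes x y :: "nat \<Rightarrow> real"
  assumes x: "\<And>j. x j \<in> {0, 1}" and y: "\<And>j. y j \<in> {0, 1}"
    and close: "\<bar>(\<Sum>j. x j / 3 ^ j) - (\<Sum>j. y j / 3 ^ j)\<bar> < 1 / (2 * 3 ^ N)" and jN: "j \<le> N"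
  shows "x j = y j"
proof (rule ccontr)
  assume "x j \<noteq> y j"
  define k where "k = (LEAST j. x j \<noteq> y j)"
  have k: "x k \<noteq> y k" unfolding k_def by (rule LeastI[of _ j]) fact
  have kj: "k \<le> j" unfolding k_def by (rule Least_le) fact
  have less: "x i = y i" if "i < k" for i using that not_less_Least[of i "\<lambda>j. x j \<noteq> y j"] by (auto simp: k_def)
  have geo: "summable (\<lambda>i. 1 / 3 ^ i :: real)" using summable_geometric[of "1/3 :: real"] by (simp add: power_divide)
  have digit_bound: "norm (c / 3 ^ i) \<le> 1 / 3 ^ i" if "c \<in> {0, 1}" for c :: real and i
    using that by auto
  have sx: "summable (\<lambda>j. x j / 3 ^ j)"
    by (rule summable_comparison_test'[OF geo, of 0]) (use x in \<open>metis digit_bound\<close>)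
  have sy: "summable (\<lambda>j. y j / 3 ^ j)"
    by (rule summable_comparison_test'[OF geo, of 0]) (use y in \<open>metis digit_bound\<close>)
  define d where "d i = (x i - y i) / 3 ^ i" for i
  have sd: "summable d" using summable_diff[OF sx sy] by (simp add: d_def[abs_def] diff_divide_distrib)
  have "(\<Sum>j. x j / 3 ^ j) - (\<Sum>j. y j / 3 ^ j) = suminf d"
    using suminf_diff[OF sx sy] by (simp add: d_def[abs_def] diff_divide_distrib)
  moreover have "suminf d = (\<Sum>i. d (i + Suc k)) + (\<Sum>i<Suc k. d i)"
    by (rule suminf_split_initial_segment[OF sd])
  moreover have "(\<Sum>i<Suc k. d i) = d k" using less by (simp add: d_def)
  moreover have "\<bar>\<Sum>i. d (i + Suc k)\<bar> \<le> 1 / (2 * 3 ^ k)"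
  proof -
    have dle: "\<bar>d i\<bar> \<le> 1 / 3 ^ i" for i
      using x[of i] y[of i] by (auto simp: d_def)
    have "(\<lambda>i. (1/3) ^ i :: real) sums (1 / (1 - 1/3))" by (rule geometric_sums) simp
    from sums_mult[OF this, of "1 / 3 ^ Suc k"]
    have g: "(\<lambda>i. 1 / 3 ^ (i + Suc k) :: real) sums (1 / (2 * 3 ^ k))"
      by (simp add: power_divide power_add mult_ac)
    have "norm (\<Sum>i. d (i + Suc k)) \<le> (\<Sum>i. 1 / 3 ^ (i + Suc k))"
    proof (rule norm_suminf_le)
      show "norm (d (i + Suc k)) \<le> 1 / 3 ^ (i + Suc k)" for i using dle[of "i + Suc k"] by simp
      show "summable (\<lambda>i. 1 / 3 ^ (i + Suc k) :: real)" using g by (rule sums_summable)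
    qed
    then show ?thesis using sums_unique[OF g] by simp
  qed
  moreover have "\<bar>d k\<bar> = 1 / 3 ^ k" using x[of k] y[of k] k by (auto simp: d_def)
  ultimately have "1 / 3 ^ k - 1 / (2 * 3 ^ k) \<le> \<bar>(\<Sum>j. x j / 3 ^ j) - (\<Sum>j. y j / 3 ^ j)\<bar>" by linarith
  moreover have "1 / 3 ^ k - 1 / (2 * 3 ^ k) = 1 / (2 * (3::real) ^ k)" by (simp add: field_simps)
  ultimately have "1 / (2 * 3 ^ k) < 1 / (2 * (3::real) ^ N)" using close by linarith
  moreover have "(3::real) ^ k \<le> 3 ^ N" using kj jN by (intro power_increasing) auto
  ultimately show False by (simp add: field_simps)
qed

text \<open>
  A totally bounded set is coded into the line by the ternary digits of membership in countably
  many small balls. The code is not continuous, but its inverse is uniformly continuous.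
\<close>

lemma real_coding:
  fixes K :: "'b::complete_space set"
  assumes K: "compact K" "K \<noteq> {}"
  obtains s :: "'b \<Rightarrow> real" and S and \<phi> :: "real \<Rightarrow> 'b" where "compact S" "S \<subseteq> {0..2}" "s ` K \<subseteq> S" "continuous_on S \<phi>"
    "\<phi> ` S \<subseteq> K" "\<And>a. a \<in> K \<Longrightarrow> \<phi> (s a) = a"
proof -
  have "\<exists>F. finite F \<and> K \<subseteq> (\<Union>c\<in>F. ball c (1 / (real n + 1)))" for n
    using K(1) unfolding compact_eq_totally_bounded by simp
  then obtain F where F: "\<And>n. finite (F n)" "\<And>n. K \<subseteq> (\<Union>c\<in>F n. ball c (1 / (real n + 1)))" by metis
  define \<A> where "\<A> = (\<Union>n. (\<lambda>c. ball c (1 / (real n + 1))) ` F n)"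
  have cA: "countable \<A>" unfolding \<A>_def by (intro countable_UN countable_image) (auto intro: countable_finite F)
  have "F 0 \<noteq> {}" using F(2)[of 0] K(2) by auto
  then have "\<A> \<noteq> {}" by (auto simp: \<A>_def)
  then have rng: "range (from_nat_into \<A>) = \<A>" using cA by (rule range_from_nat_into)
  define A where "A = from_nat_into \<A>"
  define s where "s a = (\<Sum>j. indicator (A j) a / 3 ^ j :: real)" for a
  have geo: "(\<lambda>i. 1 / 3 ^ i :: real) sums (3/2)" using geometric_sums[of "1/3 :: real"] by (simp add: power_divide)
  have ssum: "summable (\<lambda>j. indicator (A j) a / 3 ^ j :: real)" for a
    by (rule summable_comparison_test'[OF sums_summable[OF geo], of 0]) (auto simp: indicator_def)
  have srange: "s a \<in> {0..2}" for a
  proof -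
    have "0 \<le> s a" unfolding s_def by (rule suminf_nonneg[OF ssum]) (auto simp: indicator_def)
    moreover have "s a \<le> (\<Sum>j. 1 / 3 ^ j)" unfolding s_def
      by (rule suminf_le[OF _ ssum sums_summable[OF geo]]) (auto simp: indicator_def)
    ultimately show ?thesis using sums_unique[OF geo] by simp
  qed
  have inv: "\<exists>\<eta>>0. \<forall>a\<in>K. \<forall>b\<in>K. \<bar>s a - s b\<bar> < \<eta> \<longrightarrow> dist a b < e" if e: "0 < e" for e
  proof -
    obtain n where n: "2 / e < real n" using reals_Archimedean2 by blast
    have n': "2 / (real n + 1) < e" using n e by (simp add: field_simps)
    have "\<exists>j. A j = ball c (1 / (real n + 1))" if "c \<in> F n" for c
    proof -
      have "ball c (1 / (real n + 1)) \<in> range A" using rng that by (auto simp: A_def \<A>_def)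
      then show ?thesis by (metis rangeE)
    qed
    then obtain i where i: "\<And>c. c \<in> F n \<Longrightarrow> A (i c) = ball c (1 / (real n + 1))" by metis
    \<comment> \<open>All balls of level \<open>n\<close> have index at most \<open>N\<close>; if
      the codes of \<open>a\<close> and \<open>b\<close> agree on these digits, a ball of level
      \<open>n\<close> that contains \<open>a\<close> contains \<open>b\<close> too.\<close>
    define N where "N = Max (insert 0 (i ` F n))"
    have N: "i c \<le> N" if "c \<in> F n" for c using that F(1) by (simp add: N_def)
    show ?thesis
    proof (intro exI[of _ "1 / (2 * 3 ^ N)"] conjI ballI impI)
      fix a b assume ab: "a \<in> K" "b \<in> K" "\<bar>s a - s b\<bar> < 1 / (2 * 3 ^ N)"
      obtain c where c: "c \<in> F n" "a \<in> ball c (1 / (real n + 1))" using F(2)[of n] ab(1) by blast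
      have "indicator (A (i c)) a = (indicator (A (i c)) b :: real)"
        by (rule ternary_digits_eq[OF _ _ ab(3)[unfolded s_def] N[OF c(1)]]) (auto simp: indicator_def)
      then have "b \<in> ball c (1 / (real n + 1))" using c i[OF c(1)] by (auto simp: indicator_def split: if_splits)
      then have "dist a b < 1 / (real n + 1) + 1 / (real n + 1)"
        using c(2) dist_triangle[of a b c] by (simp add: dist_commute)
      then show "dist a b < e" using n' by simp
    qed simp
  qed
  have inj: "inj_on s K"
  proof (rule inj_onI)
    fix a b assume ab: "a \<in> K" "b \<in> K" "s a = s b"
    have "dist a b < e" if "0 < e" for e using inv[OF that] ab by fastforce
    then have "dist a b \<le> 0" by (meson less_irrefl not_le)
    then show "a = b" by simp
  qed
  define \<psi> where "\<psi> = inv_into K s"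
  have \<psi>: "\<psi> (s a) = a" if "a \<in> K" for a using inv_into_f_f[OF inj that] by (simp add: \<psi>_def)
  have "uniformly_continuous_on (s ` K) \<psi>"
    unfolding uniformly_continuous_on_def
  proof (intro allI impI)
    fix e :: real assume "0 < e"
    from inv[OF this] obtain \<eta> where \<eta>: "\<eta> > 0" "\<And>a b. a \<in> K \<Longrightarrow> b \<in> K \<Longrightarrow> \<bar>s a - s b\<bar> < \<eta> \<Longrightarrow> dist a b < e" by blast
    show "\<exists>d>0. \<forall>t\<in>s ` K. \<forall>t'\<in>s ` K. dist t' t < d \<longrightarrow> dist (\<psi> t') (\<psi> t) < e"
      by (intro exI[of _ \<eta>] conjI \<eta>(1)) (use \<eta>(2) in \<open>auto simp: \<psi> dist_real_def\<close>)
  qed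
  \<comment> \<open>The image of \<open>K\<close> under \<open>s\<close> need not be closed, so the
    inverse is extended to its closure; the values stay in \<open>K\<close> because \<open>K\<close>
    is closed.\<close>
  then obtain \<phi> where \<phi>: "uniformly_continuous_on (closure (s ` K)) \<phi>" "\<And>t. t \<in> s ` K \<Longrightarrow> \<psi> t = \<phi> t"
    by (rule uniformly_continuous_on_extension_on_closure) blast
  have sub: "closure (s ` K) \<subseteq> {0..2}" by (rule closure_minimal) (use srange in auto)
  show thesis
  proof (rule that)
    show "compact (closure (s ` K))"
      using sub by (meson bounded_subset closed_closure compact_Icc compact_eq_bounded_closed)
    show "continuous_on (closure (s ` K)) \<phi>" by (rule uniformly_continuous_imp_continuous[OF \<phi>(1)])
    show "\<phi> ` closure (s ` K) \<subseteq> K"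
    proof (rule image_closure_subset)
      show "\<phi> ` s ` K \<subseteq> K" using \<phi>(2) \<psi> by fastforce
    qed (use K \<phi> in \<open>auto intro: uniformly_continuous_imp_continuous compact_imp_closed\<close>)
    show "\<phi> (s a) = a" if "a \<in> K" for a using \<phi>(2)[of "s a"] \<psi>[OF that] that by simp
  qed (use sub closure_subset[of "s ` K"] in auto)
qed

text \<open>Since only the inverse \<open>\<phi>\<close> of the coding is continuous, a test
  function \<open>h\<close> is transported as its composition with \<open>\<phi>\<close> on
  \<open>S\<close>, extended to the line by Tietze. The limit measure stays on the line; its image
  under \<open>\<phi>\<close> is the weak limit on \<open>K\<close>.\<close>

theorem empirical_measures_weak_limit:
  fixes K :: "'b::complete_space set" and p :: "nat \<Rightarrow> 'b"
  assumes K: "compact K" and p: "\<And>j. p j \<in> K"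
  obtains S :: "real set" and \<phi> :: "real \<Rightarrow> 'b" and \<beta> :: "real measure" and r :: "nat \<Rightarrow> nat"
  where "compact S" "continuous_on S \<phi>" "\<phi> ` S \<subseteq> K" "prob_space \<beta>" "sets \<beta> = sets borel" "AE t in \<beta>. t \<in> S"
    "strict_mono r"
    "\<And>h. continuous_on K h \<Longrightarrow>
      (\<lambda>k. (\<Sum>j\<le>r k. h (p j)) / (real (r k) + 1)) \<longlonglongrightarrow> (LINT t:S|\<beta>. h (\<phi> t) :: real)"
proof -
  have ne: "K \<noteq> {}" using p by blast
  obtain s :: "'b \<Rightarrow> real" and S \<phi> where S: "compact S" "S \<subseteq> {0..2}" "s ` K \<subseteq> S" "continuous_on S \<phi>"
    "\<phi> ` S \<subseteq> K" "\<And>a. a \<in> K \<Longrightarrow> \<phi> (s a) = a"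
    by (rule real_coding[OF K ne]) (rule that; assumption)
  define \<mu> where "\<mu> k = distr (measure_pmf (pmf_of_set {..k})) borel (\<lambda>j. s (p j))" for k :: nat
  have dist: "real_distribution (\<mu> k)" for k
    unfolding \<mu>_def by (rule prob_space.real_distribution_distr) (auto intro: measure_pmf.prob_space_axioms)
  have int: "(LINT t|\<mu> k. f t) = (\<Sum>j\<le>k. f (s (p j))) / (real k + 1)" if "f \<in> borel_measurable borel" for f :: "real \<Rightarrow> real" and k
    unfolding \<mu>_def using that by (subst integral_distr) (auto simp: integral_pmf_of_set add.commute)
  have "tight \<mu>"
    unfolding tight_def
  proof (intro conjI allI impI)
    show "real_distribution (\<mu> n)" for n by (rule dist)
    fix \<epsilon> :: real assume e: "0 < \<epsilon>"
    have "measure (\<mu> n) {-1<..2} = 1" for n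
    proof -
      have "(\<lambda>j. s (p j)) -` {-1<..2} = UNIV"
      proof (intro set_eqI iffI)
        fix j :: nat
        have "s (p j) \<in> {0..2}" using S(2,3) p by blast
        then show "j \<in> (\<lambda>j. s (p j)) -` {-1<..2}" by simp
      qed simp
      then show ?thesis unfolding \<mu>_def by (subst measure_distr) (auto simp: measure_pmf.prob_space)
    qed
    then show "\<exists>a b. a < b \<and> (\<forall>n. 1 - \<epsilon> < measure (\<mu> n) {a<..b})"
      using e by (intro exI[of _ "-1"] exI[of _ 2]) simp
  qed
  from tight_imp_convergent_subsubsequence[OF this strict_mono_id] obtain r \<beta> where
    r: "strict_mono r" and \<beta>: "real_distribution \<beta>" and conv: "weak_conv_m (\<mu> \<circ> r) \<beta>" by (auto simp: id_def o_def)
  interpret \<beta>: real_distribution \<beta> by (rule \<beta>)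
  have dist': "real_distribution ((\<mu> \<circ> r) n)" for n by (simp add: dist)
  have lim: "(\<lambda>k. (\<Sum>j\<le>r k. f (s (p j))) / (real (r k) + 1)) \<longlonglongrightarrow> (LINT t|\<beta>. f t)"
    if f: "continuous_on UNIV f" "\<And>t. \<bar>f t\<bar> \<le> B" for f :: "real \<Rightarrow> real" and B
  proof -
    have "(\<lambda>n. LINT t|(\<mu> \<circ> r) n. f t) \<longlonglongrightarrow> (LINT t|\<beta>. f t)"
      by (rule weak_conv_imp_integral_bdd_continuous_conv[OF dist' \<beta> conv])
        (use f in \<open>auto simp: continuous_on_eq_continuous_at\<close>)
    then show ?thesis using int[OF borel_measurable_continuous_onI[OF f(1)]] by simp
  qed
  have clS: "closed S" and neS: "S \<noteq> {}" using S(1,3) p by (auto intro: compact_imp_closed)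
  have AE: "AE t in \<beta>. t \<in> S"
  proof -
    \<comment> \<open>This bounded continuous function vanishes exactly on \<open>S\<close>, hence
      at all coded points, so its integral under \<open>\<beta>\<close> is 0.\<close>
    define u where "u t = min 1 (infdist t S)" for t
    have u: "continuous_on UNIV u" unfolding u_def by (intro continuous_intros)
    have um [measurable]: "u \<in> borel_measurable borel" using u by (rule borel_measurable_continuous_onI)
    have u0: "0 \<le> u t" "\<bar>u t\<bar> \<le> 1" for t by (auto simp: u_def infdist_nonneg)
    have "u (s (p j)) = 0" for j
    proof -
      have "s (p j) \<in> S" using S(3) p by blast
      then show ?thesis by (simp add: u_def)
    qed
    then have "(LINT t|\<beta>. u t) = 0" using lim[OF u u0(2)] by (simp add: LIMSEQ_const_iff)
    moreover have "integrable \<beta> u"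
      by (rule \<beta>.integrable_const_bound[where B=1]) (use u0 in auto)
    ultimately have "AE t in \<beta>. u t = 0" using integral_nonneg_eq_0_iff_AE[of \<beta> u] u0 by simp
    then show ?thesis
    proof eventually_elim
      case (elim t)
      then have "infdist t S = 0" by (simp add: u_def min_def split: if_splits)
      then show ?case using in_closed_iff_infdist_zero[OF clS neS] by blast
    qed
  qed
  show thesis
  proof (rule that[OF S(1,4,5) \<beta>.prob_space_axioms _ AE r])
    show "sets \<beta> = sets borel" by simp
    fix h :: "'b \<Rightarrow> real" assume h: "continuous_on K h"
    have hc: "continuous_on S (\<lambda>t. h (\<phi> t))" by (rule continuous_on_compose2[OF h S(4,5)])
    have "compact (h ` K)" by (rule compact_continuous_image[OF h K])
    then obtain B where B: "\<And>a. a \<in> K \<Longrightarrow> norm (h a) \<le> B"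
      using compact_imp_bounded bounded_iff by (metis imageI)
    have B0: "0 \<le> B" using B[OF p[of 0]] norm_ge_zero order_trans by blast
    have "closedin (top_of_set UNIV) S" using clS by simp
    moreover have "norm (h (\<phi> t)) \<le> B" if "t \<in> S" for t using that B S(5) by blast
    ultimately obtain H where H: "continuous_on UNIV H" "\<And>t. t \<in> S \<Longrightarrow> H t = h (\<phi> t)" "\<And>t. norm (H t) \<le> B"
      using Tietze[OF hc _ B0, of UNIV] by (metis UNIV_I)
    have "(\<lambda>k. (\<Sum>j\<le>r k. H (s (p j))) / (real (r k) + 1)) \<longlonglongrightarrow> (LINT t|\<beta>. H t)"
      by (rule lim[OF H(1)]) (use H(3) in simp)
    moreover have "H (s (p j)) = h (p j)" for j
    proof -
      have "s (p j) \<in> S" using S(3) p by blast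
      then show ?thesis using H(2) S(6)[OF p] by simp
    qed
    moreover have "(LINT t|\<beta>. H t) = (LINT t:S|\<beta>. h (\<phi> t))"
      unfolding set_lebesgue_integral_def
    proof (rule integral_cong_AE)
      show "H \<in> borel_measurable \<beta>" using borel_measurable_continuous_onI[OF H(1)] by simp
      have "(\<lambda>t. indicat_real S t *\<^sub>R h (\<phi> t)) \<in> borel_measurable borel"
        by (rule borel_measurable_continuous_on_indicator[OF _ hc]) (use clS in auto)
      then show "(\<lambda>t. indicat_real S t *\<^sub>R h (\<phi> t)) \<in> borel_measurable \<beta>" by simp
      show "AE t in \<beta>. H t = indicat_real S t *\<^sub>R h (\<phi> t)" using AE by eventually_elim (simp add: H)
    qed
    ultimately show "(\<lambda>k. (\<Sum>j\<le>r k. h (p j)) / (real (r k) + 1)) \<longlonglongrightarrow> (LINT t:S|\<beta>. h (\<phi> t))" by simp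
  qed
qed

section \<open>Doubling spaces with a Poincare inequality\<close>

lemma ennreal_le_suminf: "F k \<le> (\<Sum>k. F k)" for F :: "nat \<Rightarrow> ennreal"
  using sum_le_suminf[of F "{k}"] by simp

lemma dyadic_interval:
  fixes d r :: real
  assumes "0 < d" "d < r"
  obtains k where "r / 2 ^ Suc k \<le> d" "d < r / 2 ^ k"
proof -
  have "\<exists>k. r / 2 ^ k \<le> d"
  proof -
    obtain k where "r / d < 2 ^ k" using real_arch_pow[of 2 "r / d"] by auto
    then show ?thesis using assms by (intro exI[of _ k]) (simp add: field_simps)
  qed
  then have *: "r / 2 ^ (LEAST k. r / 2 ^ k \<le> d) \<le> d" by (rule LeastI_ex)
  obtain k where k: "(LEAST k. r / 2 ^ k \<le> d) = Suc k"
    using * assms by (cases "LEAST k. r / 2 ^ k \<le> d") auto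
  have "\<not> r / 2 ^ k \<le> d" using not_less_Least[of k "\<lambda>k. r / 2 ^ k \<le> d"] k by simp
  then show thesis using that[of k] * k by simp
qed

section \<open>Doubling measures: compactness of balls and the kernel\<close>

locale doubling_space =
  fixes M :: "'a::complete_space measure" and D :: real
  assumes sets_M [measurable_cong]: "sets M = sets borel"
    and ball_pos: "\<And>(x::'a) r. 0 < r \<Longrightarrow> 0 < emeasure M (ball x r)"
    and ball_finite: "\<And>(x::'a) r. emeasure M (ball x r) < \<infinity>"
    and D_ge: "1 \<le> D"
    and doubling: "\<And>(x::'a) r. 0 < r \<Longrightarrow> emeasure M (ball x (2 * r)) \<le> ennreal D * emeasure M (ball x r)"
begin

abbreviation m :: "'a \<Rightarrow> real \<Rightarrow> real" where "m x r \<equiv> measure M (ball x r)"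

lemma space_M [simp]: "space M = UNIV"
  using sets_eq_imp_space_eq[OF sets_M] by simp

lemma emeasure_ball: "emeasure M (ball x r) = ennreal (m x r)"
  using ball_finite[of x r] by (simp add: emeasure_eq_ennreal_measure)

lemma m_pos: "0 < r \<Longrightarrow> 0 < m x r"
  using ball_pos[of r x] by (simp add: emeasure_ball)

lemma ball_sets [measurable, simp]: "ball x r \<in> sets M"
  by (simp add: sets_M)

lemma m_mono: "ball x r \<subseteq> ball y s \<Longrightarrow> m x r \<le> m y s"
  using ball_finite[of y s] by (intro measure_mono_fmeasurable) (auto simp: fmeasurable_def)

lemma m_doubling:
  assumes "0 < r" shows "m x (2 * r) \<le> D * m x r"
proof -
  have "ennreal (m x (2 * r)) \<le> ennreal (D * m x r)"
    using doubling[OF assms, of x] D_ge by (simp add: emeasure_ball ennreal_mult)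
  moreover have "0 \<le> D * m x r" using D_ge by simp
  ultimately show ?thesis by (subst (asm) ennreal_le_iff) auto
qed

lemma m_doubling_pow:
  assumes "0 < r" shows "m x (2 ^ k * r) \<le> D ^ k * m x r"
proof (induction k)
  case (Suc k)
  have "m x (2 ^ Suc k * r) = m x (2 * (2 ^ k * r))" by (simp add: mult.assoc)
  also have "\<dots> \<le> D * m x (2 ^ k * r)" by (rule m_doubling) (use assms in simp)
  also have "\<dots> \<le> D * (D ^ k * m x r)" using Suc D_ge by (intro mult_left_mono) auto
  finally show ?case by (simp add: mult.assoc)
qed simp

lemma m_compare:
  assumes "0 < s" "dist p q + t \<le> 2 ^ k * s"
  shows "m q t \<le> D ^ k * m p s"
proof -
  have "ball q t \<subseteq> ball p (2 ^ k * s)"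
  proof
    fix z assume "z \<in> ball q t"
    then show "z \<in> ball p (2 ^ k * s)" using dist_triangle[of p z q] assms by simp
  qed
  from m_mono[OF this] m_doubling_pow[OF assms(1), of p k] show ?thesis by linarith
qed

text \<open>The balls of radius \<open>e/2\<close> about an \<open>e\<close>-separated set are
  disjoint and, by doubling, each carries a fixed fraction of the measure of the ball of radius
  \<open>R + e\<close>. So separated sets have bounded cardinality, a largest one is a net, and
  completeness turns total boundedness into compactness.\<close>

lemma compact_cball_doubling: "compact (cball (x::'a) R)"
proof (cases "0 \<le> R")
  case False then show ?thesis by (simp add: not_le)
next
  case R: True
  have "\<exists>k. finite k \<and> cball x R \<subseteq> (\<Union>c\<in>k. ball c e)" if e: "0 < e" for e
  proof -
    define sep where "sep F \<longleftrightarrow> finite F \<and> F \<subseteq> cball x R \<and> (\<forall>a\<in>F. \<forall>b\<in>F. a \<noteq> b \<longrightarrow> e \<le> dist a b)" for F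
    \<comment> \<open>\<open>k\<close> doublings take a ball of radius \<open>e/2\<close> about any
      point of \<open>cball x R\<close> to one that contains \<open>ball x (R + e)\<close>.\<close>
    obtain k where k: "(2 * R + e) / (e/2) < 2 ^ k" using real_arch_pow[of 2] by auto
    have mpos: "0 < m x (R + e)" using R e by (intro m_pos) simp
    have bound: "card F \<le> D ^ k" if F: "sep F" for F
    proof -
      have "card F * (m x (R + e) / D ^ k) = (\<Sum>a\<in>F. m x (R + e) / D ^ k)" by simp
      also have "\<dots> \<le> (\<Sum>a\<in>F. m a (e/2))"
      proof (rule sum_mono)
        fix a assume "a \<in> F"
        then have "dist a x \<le> R" using F by (auto simp: sep_def dist_commute)
        then have "m x (R + e) \<le> D ^ k * m a (e/2)"
          using k e by (intro m_compare) (auto simp: field_simps)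
        then show "m x (R + e) / D ^ k \<le> m a (e/2)" using D_ge by (simp add: field_simps)
      qed
      also have "\<dots> = measure M (\<Union>a\<in>F. ball a (e/2))"
      proof (rule measure_finite_Union[symmetric])
        show "finite F" using F by (simp add: sep_def)
        show "disjoint_family_on (\<lambda>a. ball a (e/2)) F"
          unfolding disjoint_family_on_def
        proof (intro ballI impI)
          fix a b assume ab: "a \<in> F" "b \<in> F" "a \<noteq> b"
          then have "e \<le> dist a b" using F by (simp add: sep_def)
          then show "ball a (e/2) \<inter> ball b (e/2) = {}"
            using dist_triangle_half_r[of _ a e b] by (fastforce simp: dist_commute)
        qed
      qed (use ball_finite in \<open>auto simp: less_top\<close>)
      also have "\<dots> \<le> m x (R + e)"
      proof (rule measure_mono_fmeasurable)
        show "(\<Union>a\<in>F. ball a (e/2)) \<subseteq> ball x (R + e)"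
        proof (intro UN_least subsetI)
          fix a z assume "a \<in> F" "z \<in> ball a (e/2)"
          moreover from this have "dist x a \<le> R" using F by (auto simp: sep_def)
          ultimately show "z \<in> ball x (R + e)"
            using dist_triangle[of x z a] e by simp
        qed
        show "ball x (R + e) \<in> fmeasurable M" using ball_finite by (simp add: fmeasurable_def)
        show "(\<Union>a\<in>F. ball a (e/2)) \<in> sets M" using F by (auto simp: sep_def)
      qed
      finally show ?thesis using mpos D_ge by (simp add: field_simps)
    qed
    have "sep {}" by (simp add: sep_def)
    moreover have "\<forall>F. sep F \<longrightarrow> card F < Suc (nat \<lfloor>D ^ k\<rfloor>)"
      using bound by (auto simp: less_Suc_eq_le intro: le_nat_floor)
    ultimately have "\<exists>F. sep F \<and> (\<forall>G. sep G \<longrightarrow> card G \<le> card F)"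
      by (rule Lattices_Big.ex_has_greatest_nat)
    then obtain F where F: "sep F" "\<And>G. sep G \<Longrightarrow> card G \<le> card F" by blast
    have "cball x R \<subseteq> (\<Union>c\<in>F. ball c e)"
    proof (rule ccontr)
      assume "\<not> ?thesis"
      then obtain z where z0: "z \<in> cball x R" "z \<notin> (\<Union>c\<in>F. ball c e)" by blast
      then have z: "z \<in> cball x R" "\<And>c. c \<in> F \<Longrightarrow> e \<le> dist c z" by force+
      then have "z \<notin> F" using e by force
      moreover have "e \<le> dist z c" if "c \<in> F" for c using z(2)[OF that] by (simp add: dist_commute)
      then have "sep (insert z F)" using F(1) z unfolding sep_def by simp
      ultimately show False using F(2)[of "insert z F"] card_insert_disjoint[of F z] F(1)[unfolded sep_def] by linarith
    qed
    then show ?thesis using F(1) by (auto simp: sep_def)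
  qed
  then show ?thesis
    unfolding compact_eq_totally_bounded by (simp add: complete_eq_closed)
qed

definition K :: "'a \<Rightarrow> 'a \<Rightarrow> real" where
  "K x z = dist x z / m x (dist x z)"

lemma riesz_kernel_eq: "riesz_kernel M x y z = K x z + K y z"
  by (simp add: riesz_kernel_def K_def)

lemma K_nonneg: "0 \<le> K x z"
  by (simp add: K_def)

lemma K_measurable [measurable]: "K x \<in> borel_measurable borel"
proof -
  have "mono (m x)" by (rule monoI, rule m_mono) auto
  then have [measurable]: "m x \<in> borel_measurable borel" by (rule borel_measurable_mono)
  have [measurable]: "(\<lambda>z. dist x z) \<in> borel_measurable borel"
    by (rule borel_measurable_continuous_onI) (intro continuous_intros)
  show ?thesis unfolding K_def[abs_def] by measurable
qed

lemma riesz_kernel_measurable [measurable]: "riesz_kernel M x y \<in> borel_measurable M"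
  unfolding riesz_kernel_eq[abs_def] by measurable

text \<open>On the dyadic shell \<open>r / 2 ^ Suc k \<le> dist x z < r / 2 ^ k\<close> the kernel
  is at most \<open>r / 2 ^ k\<close> over the measure of the smaller ball; doubling makes the shell
  contribute at most \<open>D * r / 2 ^ k\<close>, a geometric series.\<close>

lemma nn_integral_K:
  assumes r: "0 < r"
  shows "(\<integral>\<^sup>+ z \<in> ball x r. ennreal (K x z) \<partial>M) \<le> ennreal (2 * D * r)"
proof -
  have "(\<integral>\<^sup>+ z \<in> ball x r. ennreal (K x z) \<partial>M)
    \<le> (\<integral>\<^sup>+ z. (\<Sum>k. ennreal (r / 2 ^ k / m x (r / 2 ^ Suc k)) * indicator (ball x (r / 2 ^ k)) z) \<partial>M)"
  proof (rule nn_integral_mono)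
    fix z
    show "ennreal (K x z) * indicator (ball x r) z \<le>
      (\<Sum>k. ennreal (r / 2 ^ k / m x (r / 2 ^ Suc k)) * indicator (ball x (r / 2 ^ k)) z)"
    proof (cases "0 < dist x z \<and> dist x z < r")
      case True
      then obtain k where k: "r / 2 ^ Suc k \<le> dist x z" "dist x z < r / 2 ^ k"
        using dyadic_interval by metis
      have "K x z \<le> r / 2 ^ k / m x (r / 2 ^ Suc k)"
        unfolding K_def
        by (rule frac_le) (use k r in \<open>auto intro!: m_pos m_mono simp del: power_Suc\<close>)
      then have "ennreal (K x z) * indicator (ball x r) z
         \<le> ennreal (r / 2 ^ k / m x (r / 2 ^ Suc k)) * indicator (ball x (r / 2 ^ k)) z"
        using True k by (auto intro: ennreal_leI)
      also have "\<dots> \<le> (\<Sum>k. ennreal (r / 2 ^ k / m x (r / 2 ^ Suc k)) * indicator (ball x (r / 2 ^ k)) z)"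
        by (rule ennreal_le_suminf)
      finally show ?thesis .
    next
      case False
      then have "K x z = 0 \<or> z \<notin> ball x r" by (auto simp: K_def)
      then show ?thesis by auto
    qed
  qed
  also have "\<dots> = (\<Sum>k. (\<integral>\<^sup>+ z. ennreal (r / 2 ^ k / m x (r / 2 ^ Suc k)) * indicator (ball x (r / 2 ^ k)) z \<partial>M))"
    by (rule nn_integral_suminf) measurable
  also have "\<dots> \<le> (\<Sum>k. ennreal (D * r * (1/2) ^ k))"
  proof (rule suminf_le)
    fix k
    have "r / 2 ^ k / m x (r / 2 ^ Suc k) * m x (r / 2 ^ k) \<le> r / 2 ^ k / m x (r / 2 ^ Suc k) * (D * m x (r / 2 ^ Suc k))"
      using m_doubling[of "r / 2 ^ Suc k" x] r by (intro mult_left_mono) auto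
    also have "\<dots> = D * r * (1/2) ^ k"
      using m_pos[of "r / 2 ^ Suc k" x] r by (simp add: field_simps power_divide)
    finally show "(\<integral>\<^sup>+ z. ennreal (r / 2 ^ k / m x (r / 2 ^ Suc k)) * indicator (ball x (r / 2 ^ k)) z \<partial>M)
      \<le> ennreal (D * r * (1/2) ^ k)"
      using r by (simp add: nn_integral_cmult_indicator emeasure_ball flip: ennreal_mult del: power_Suc) (auto intro!: ennreal_leI)
  qed (auto intro: summableI)
  also have "\<dots> = ennreal (2 * D * r)"
  proof (rule suminf_ennreal_eq)
    have "(\<lambda>k. (1/2::real) ^ k) sums 2" using geometric_sums[of "1/2::real"] by simp
    from sums_mult[OF this, of "D * r"] show "(\<lambda>k. D * r * (1/2) ^ k) sums (2 * D * r)" by (simp add: algebra_simps)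
  qed (use r D_ge in auto)
  finally show ?thesis .
qed

end

section \<open>Ball averages under the Poincare inequality\<close>

text \<open>The dilation factor is normalized to be at least 1, at the cost of a larger constant,
  and the average of \<open>g\<close> is written as a product, so that the integral of
  \<open>g\<close> is the only factor that may be infinite.\<close>

locale poincare_space = doubling_space M D for M :: "'a::complete_space measure" and D +
  fixes P l :: real
  assumes P_pos: "0 < P" and l_ge: "1 \<le> l"
    and poincare: "\<And>(x::'a) r u g. 0 < r \<Longrightarrow> (\<And>y s. set_integrable M (ball y s) u) \<Longrightarrow> upper_gradient u g \<Longrightarrow>
           ennreal (average_on M (ball x r) (\<lambda>z. \<bar>u z - average_on M (ball x r) u\<bar>))
           \<le> ennreal (P * r / measure M (ball x (l * r))) * (\<integral>\<^sup>+ z \<in> ball x (l * r). ennreal (g z) \<partial>M)"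
begin

definition avg :: "('a \<Rightarrow> real) \<Rightarrow> 'a \<Rightarrow> real \<Rightarrow> real" where
  "avg u x r = average_on M (ball x r) u"

text \<open>The class of the truncated chain costs. Boundedness yields integrability on balls,
  continuity the convergence of averages at every point.\<close>

definition admissible :: "('a \<Rightarrow> real) \<Rightarrow> ('a \<Rightarrow> real) \<Rightarrow> bool" where
  "admissible u g \<longleftrightarrow> continuous_on UNIV u \<and> bounded (range u) \<and> upper_gradient u g"

lemma admissible_measurable:
  assumes "admissible u g" shows "g \<in> borel_measurable M"
proof -
  have "g \<in> borel_measurable borel" using assms by (simp add: admissible_def upper_gradient_def)
  then show ?thesis by simp
qed

lemma integrable_ball:
  fixes u :: "'a \<Rightarrow> real"
  assumes "continuous_on UNIV u" "bounded (range u)"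
  shows "set_integrable M (ball x r) u"
proof -
  obtain B where B: "\<And>z. norm (u z) \<le> B" using assms(2) by (auto simp: bounded_iff)
  have "u \<in> borel_measurable borel" using assms(1) by (rule borel_measurable_continuous_onI)
  then have [measurable]: "u \<in> borel_measurable M" by simp
  show ?thesis unfolding set_integrable_def
    by (rule integrableI_bounded_set_indicator[where B=B]) (use B ball_finite in auto)
qed

lemma LINT_ball_const: "(LINT z:ball p s|M. (c::real)) = m p s * c"
  using ball_finite[of p s] by (subst set_integral_const) auto

lemma avg_diff_le:
  assumes u: "continuous_on UNIV u" "bounded (range u)" and s: "0 < s" and sub: "ball p s \<subseteq> ball q t"
  shows "\<bar>avg u p s - c\<bar> \<le> (LINT z:ball q t|M. \<bar>u z - c\<bar>) / m p s"
proof -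
  have mp: "0 < m p s" by (rule m_pos[OF s])
  have const: "set_integrable M (ball p s) (\<lambda>_. c)"
    by (rule integrable_ball) auto
  have int: "set_integrable M (ball y r) (\<lambda>z. \<bar>u z - c\<bar>)" for y r
  proof (rule integrable_ball)
    show "continuous_on UNIV (\<lambda>z. \<bar>u z - c\<bar>)" using u(1) by (intro continuous_intros)
    obtain B where B: "\<And>z. norm (u z) \<le> B" using u(2) by (auto simp: bounded_iff)
    have "norm \<bar>u z - c\<bar> \<le> B + \<bar>c\<bar>" for z using B[of z] by simp
    then show "bounded (range (\<lambda>z. \<bar>u z - c\<bar>))" by (auto simp: bounded_iff)
  qed
  have "avg u p s - c = ((LINT z:ball p s|M. u z) - (LINT z:ball p s|M. c)) / m p s"
    using mp by (simp add: avg_def average_on_def LINT_ball_const field_simps)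
  also have "\<dots> = (LINT z:ball p s|M. u z - c) / m p s"
    using integrable_ball[OF u] const by (subst set_integral_diff) auto
  finally have "\<bar>avg u p s - c\<bar> = \<bar>LINT z:ball p s|M. u z - c\<bar> / m p s"
    using mp by simp
  also have "\<dots> \<le> (LINT z:ball p s|M. \<bar>u z - c\<bar>) / m p s"
    using mp set_integral_norm_bound[of M "ball p s" "\<lambda>z. u z - c"] integrable_ball[OF u] const
    by (intro divide_right_mono) auto
  also have "\<dots> \<le> (LINT z:ball q t|M. \<bar>u z - c\<bar>) / m p s"
  proof (rule divide_right_mono)
    show "(LINT z:ball p s|M. \<bar>u z - c\<bar>) \<le> (LINT z:ball q t|M. \<bar>u z - c\<bar>)"
      unfolding set_lebesgue_integral_def
    proof (rule integral_mono)
      show "integrable M (\<lambda>z. indicat_real (ball p s) z *\<^sub>R \<bar>u z - c\<bar>)"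
        "integrable M (\<lambda>z. indicat_real (ball q t) z *\<^sub>R \<bar>u z - c\<bar>)"
        using int by (auto simp: set_integrable_def)
      show "indicat_real (ball p s) z *\<^sub>R \<bar>u z - c\<bar> \<le> indicat_real (ball q t) z *\<^sub>R \<bar>u z - c\<bar>" for z
        using sub by (auto simp: indicator_def)
    qed
  qed (use mp in simp)
  finally show ?thesis .
qed

lemma avg_close:
  assumes u: "continuous_on UNIV u" "bounded (range u)" and s: "0 < s"
    and near: "\<And>z. z \<in> ball p s \<Longrightarrow> \<bar>u z - c\<bar> \<le> e"
  shows "\<bar>avg u p s - c\<bar> \<le> e"
proof -
  have mp: "0 < m p s" by (rule m_pos[OF s])
  have "\<bar>avg u p s - c\<bar> \<le> (LINT z:ball p s|M. \<bar>u z - c\<bar>) / m p s"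
    by (rule avg_diff_le[OF u s]) simp
  also have "(LINT z:ball p s|M. \<bar>u z - c\<bar>) \<le> (LINT z:ball p s|M. e)"
  proof (rule set_integral_mono)
    show "set_integrable M (ball p s) (\<lambda>_. e)" by (rule integrable_ball) auto
    show "set_integrable M (ball p s) (\<lambda>z. \<bar>u z - c\<bar>)"
    proof (rule set_integrable_abs, rule set_integral_diff)
      show "set_integrable M (ball p s) (\<lambda>_. c)" by (rule integrable_ball) auto
    qed (rule integrable_ball[OF u])
  qed (rule near)
  then have "(LINT z:ball p s|M. \<bar>u z - c\<bar>) / m p s \<le> (LINT z:ball p s|M. e) / m p s"
    using mp by (intro divide_right_mono) auto
  also have "\<dots> = e"
    using mp by (simp add: LINT_ball_const)
  finally show ?thesis .
qed

lemma avg_tendsto: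
  assumes u: "continuous_on UNIV u" "bounded (range u)"
    and s: "\<And>i. 0 < s i" and lim: "(\<lambda>i. dist z (p i) + s i) \<longlonglongrightarrow> 0"
  shows "(\<lambda>i. avg u (p i) (s i)) \<longlonglongrightarrow> u z"
proof (rule metric_LIMSEQ_I)
  fix e :: real assume e: "0 < e"
  obtain d where d: "d > 0" "\<And>w. dist w z < d \<Longrightarrow> dist (u w) (u z) < e/2"
    using u(1) e unfolding continuous_on_iff by (metis UNIV_I half_gt_zero)
  have "\<forall>\<^sub>F i in sequentially. dist z (p i) + s i < d" using lim d(1) by (rule order_tendstoD)
  then have "\<forall>\<^sub>F i in sequentially. dist (avg u (p i) (s i)) (u z) < e"
  proof eventually_elim
    case (elim i)
    have "\<bar>avg u (p i) (s i) - u z\<bar> \<le> e/2"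
    proof (rule avg_close[OF u s])
      fix w assume "w \<in> ball (p i) (s i)"
      then have "dist w z < d" using elim dist_triangle[of w z "p i"] by (simp add: dist_commute)
      then show "\<bar>u w - u z\<bar> \<le> e/2" using d(2)[of w] by (simp add: dist_real_def)
    qed
    then show ?case using e by (simp add: dist_real_def)
  qed
  then show "\<exists>no. \<forall>i\<ge>no. dist (avg u (p i) (s i)) (u z) < e" by (simp add: eventually_sequentially)
qed

text \<open>The difference is at most the mean over the small ball of the deviation from the large
  average, and \<open>A\<close> bounds the loss in enlarging the ball of integration.\<close>

lemma avg_nested:
  assumes adm: "admissible u g" and s: "0 < s" and sub: "ball p s \<subseteq> ball q t"
    and A: "m q t \<le> A * m p s"
  shows "ennreal \<bar>avg u p s - avg u q t\<bar>
    \<le> ennreal (A * P * t / m q (l * t)) * (\<integral>\<^sup>+ z \<in> ball q (l * t). ennreal (g z) \<partial>M)"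
proof -
  have u: "continuous_on UNIV u" "bounded (range u)" and g: "upper_gradient u g"
    using adm by (auto simp: admissible_def)
  have "ball p s \<noteq> {}" using s by auto
  then have t: "0 < t" using sub ball_empty[of t q] by (cases "t \<le> 0") auto
  have mp: "0 < m p s" and mq: "0 < m q t" by (auto intro: m_pos s t)
  have A0: "0 \<le> A" using A mp mq by (smt (verit) mult_nonneg_nonneg mult_less_0_iff)
  let ?c = "avg u q t"
  have I0: "0 \<le> (LINT z:ball q t|M. \<bar>u z - ?c\<bar>)"
    unfolding set_lebesgue_integral_def by (intro integral_nonneg_AE AE_I2) (simp add: indicator_def)
  have "\<bar>avg u p s - ?c\<bar> \<le> (LINT z:ball q t|M. \<bar>u z - ?c\<bar>) / m p s"
    by (rule avg_diff_le[OF u s sub])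
  also have "\<dots> \<le> (LINT z:ball q t|M. \<bar>u z - ?c\<bar>) * (A / m q t)"
    using mult_right_mono[OF A I0] mp mq by (simp add: field_simps)
  also have "\<dots> = A * average_on M (ball q t) (\<lambda>z. \<bar>u z - average_on M (ball q t) u\<bar>)"
    by (simp add: average_on_def avg_def)
  finally have "ennreal \<bar>avg u p s - ?c\<bar> \<le> ennreal (A * average_on M (ball q t) (\<lambda>z. \<bar>u z - average_on M (ball q t) u\<bar>))"
    by (rule ennreal_leI)
  also have "\<dots> = ennreal A * ennreal (average_on M (ball q t) (\<lambda>z. \<bar>u z - average_on M (ball q t) u\<bar>))"
    by (rule ennreal_mult'[OF A0])
  also have "\<dots> \<le> ennreal A * (ennreal (P * t / m q (l * t)) * (\<integral>\<^sup>+ z \<in> ball q (l * t). ennreal (g z) \<partial>M))"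
    by (intro mult_left_mono poincare[OF t _ g] integrable_ball u) simp
  also have "\<dots> = ennreal (A * P * t / m q (l * t)) * (\<integral>\<^sup>+ z \<in> ball q (l * t). ennreal (g z) \<partial>M)"
    using A0 by (simp add: ennreal_mult' mult.assoc flip: times_divide_eq_right)
  finally show ?thesis .
qed

lemma avg_nested_dist:
  assumes adm: "admissible u g" and s: "0 < s" "dist p q + s \<le> t" "dist p q + t \<le> 2 ^ k * s"
  shows "ennreal \<bar>avg u p s - avg u q t\<bar>
    \<le> ennreal (D ^ k * P * t / m q (l * t)) * (\<integral>\<^sup>+ z \<in> ball q (l * t). ennreal (g z) \<partial>M)"
proof (rule avg_nested[OF adm s(1)])
  show "ball p s \<subseteq> ball q t"
  proof
    fix z assume "z \<in> ball p s"
    then show "z \<in> ball q t" using s(2) dist_triangle[of q z p] by (simp add: dist_commute)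
  qed
  show "m q t \<le> D ^ k * m p s" by (rule m_compare[OF s(1,3)])
qed

subsection \<open>Quasiconvexity\<close>

lemma avg_nested_const:
  assumes adm: "admissible u (\<lambda>_. 1)" and s: "0 < s" "dist p q + s \<le> t" "dist p q + t \<le> 2 ^ k * s"
  shows "\<bar>avg u p s - avg u q t\<bar> \<le> D ^ k * P * t"
proof -
  have t: "0 < t" using s(1,2) zero_le_dist[of p q] by linarith
  have mq: "0 < m q (l * t)" using l_ge t by (intro m_pos) simp
  have "ennreal \<bar>avg u p s - avg u q t\<bar>
    \<le> ennreal (D ^ k * P * t / m q (l * t)) * (\<integral>\<^sup>+ z \<in> ball q (l * t). ennreal 1 \<partial>M)"
    by (rule avg_nested_dist[OF adm s])
  also have "(\<integral>\<^sup>+ z \<in> ball q (l * t). ennreal 1 \<partial>M) = ennreal (m q (l * t))"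
    by (simp add: emeasure_ball)
  also have "ennreal (D ^ k * P * t / m q (l * t)) * ennreal (m q (l * t)) = ennreal (D ^ k * P * t)"
    using mq D_ge P_pos t by (simp flip: ennreal_mult)
  finally show ?thesis using D_ge P_pos t by (subst (asm) ennreal_le_iff) auto
qed

text \<open>Telescoping costs \<open>2 * D * P * d\<close> at \<open>x\<close> and twice that at
  \<open>y\<close>, where the radius is \<open>2 * d\<close>; comparing the two balls costs
  \<open>2 * D ^ 2 * P * d\<close>. The total is at most \<open>8 * D ^ 2 * P * d\<close>, and the
  summand 1 makes the bound strict.\<close>

definition Q :: real where "Q = 8 * D ^ 2 * P + 1"

text \<open>For a constant upper gradient the averages over successive concentric balls differ by at
  most a multiple of the radius, so the telescoping series is geometric.\<close>

lemma avg_telescope_const: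
  assumes adm: "admissible u (\<lambda>_. 1)" and r: "0 < r"
  shows "\<bar>avg u z r - u z\<bar> \<le> 2 * D * P * r"
proof -
  have u: "continuous_on UNIV u" "bounded (range u)" using adm by (auto simp: admissible_def)
  have part: "\<bar>avg u z r - avg u z (r / 2 ^ i)\<bar> \<le> 2 * D * P * r * (1 - (1/2) ^ i)" for i
  proof (induction i)
    case (Suc i)
    have "\<bar>avg u z (r / 2 ^ Suc i) - avg u z (r / 2 ^ i)\<bar> \<le> D ^ 1 * P * (r / 2 ^ i)"
      by (rule avg_nested_const[OF adm]) (use r in \<open>auto simp: field_simps\<close>)
    then have "\<bar>avg u z r - avg u z (r / 2 ^ Suc i)\<bar> \<le> 2 * D * P * r * (1 - (1/2) ^ i) + D * P * (r / 2 ^ i)"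
      using Suc by simp
    also have "\<dots> = 2 * D * P * r * (1 - (1/2) ^ Suc i)"
      by (simp add: field_simps power_divide)
    finally show ?case .
  qed simp
  have le: "\<bar>avg u z r - avg u z (r / 2 ^ i)\<bar> \<le> 2 * D * P * r" for i
  proof -
    have "2 * D * P * r * (1 - (1/2) ^ i) \<le> 2 * D * P * r * 1"
      using D_ge P_pos r by (intro mult_left_mono) auto
    then show ?thesis using part[of i] by linarith
  qed
  have "(\<lambda>i. r * (1/2) ^ i) \<longlonglongrightarrow> r * 0" by (intro tendsto_intros) auto
  then have "(\<lambda>i. dist z z + r / 2 ^ i) \<longlonglongrightarrow> 0" by (simp add: power_divide)
  then have "(\<lambda>i. avg u z (r / 2 ^ i)) \<longlonglongrightarrow> u z"
    by (intro avg_tendsto[OF u]) (use r in auto)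
  then have "(\<lambda>i. \<bar>avg u z r - avg u z (r / 2 ^ i)\<bar>) \<longlonglongrightarrow> \<bar>avg u z r - u z\<bar>" by (intro tendsto_intros)
  then show ?thesis by (rule LIMSEQ_le_const2) (use le in auto)
qed

lemma chain_cost_admissible:
  assumes "continuous_on UNIV \<rho>" "\<And>z. 0 \<le> \<rho> z" "\<And>z. \<rho> z \<le> B" "0 < \<delta>" "0 \<le> N"
  shows "admissible (chain_cost \<rho> \<delta> N x) \<rho>"
  unfolding admissible_def
proof (intro conjI)
  show "continuous_on UNIV (chain_cost \<rho> \<delta> N x)" by (rule continuous_chain_cost) (use assms in auto)
  show "upper_gradient (chain_cost \<rho> \<delta> N x) \<rho>" by (rule upper_gradient_chain_cost) (use assms in auto)
  have "norm (chain_cost \<rho> \<delta> N x z) \<le> N" for z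
    using chain_cost_nonneg[of \<rho> B \<delta> N x z] chain_cost_le[of \<rho> B \<delta> N x z] assms by simp
  then show "bounded (range (chain_cost \<rho> \<delta> N x))" by (auto simp: bounded_iff)
qed

lemma quasiconvex:
  obtains T f where "0 \<le> T" "T \<le> Q * dist x y" "1-lipschitz_on UNIV f" "f 0 = x" "f T = (y::'a)"
proof (cases "x = y")
  case True
  have "1-lipschitz_on UNIV (\<lambda>_::real. x)" by (rule lipschitz_onI) auto
  then show thesis using that[of 0 "\<lambda>_. x"] True by simp
next
  case False
  define d where "d = dist x y"
  have d: "0 < d" using False by (simp add: d_def)
  have Qd: "8 * D ^ 2 * P * d < Q * d" using d by (simp add: Q_def algebra_simps)
  have DP: "D * P * d \<le> D ^ 2 * P * d" "0 < D * P * d"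
    using D_ge P_pos d by (auto simp: power2_eq_square)
  have chains: "\<exists>k\<in>chain_costs (\<lambda>_. 1) \<delta> x y. k \<le> Q * d" if \<delta>: "0 < \<delta>" for \<delta>
  proof -
    \<comment> \<open>Truncation is at the target bound itself, so a smaller value at
      \<open>y\<close> must come from a chain; with weight 1 its cost is its length.\<close>
    let ?u = "chain_cost (\<lambda>_. 1) \<delta> (Q * d) x"
    have Q0: "0 \<le> Q * d" using Qd DP by linarith
    have adm: "admissible ?u (\<lambda>_. 1)"
      by (rule chain_cost_admissible[where B=1]) (use \<delta> Q0 in auto)
    have "\<bar>avg ?u x d - avg ?u y (2 * d)\<bar> \<le> D ^ 2 * P * (2 * d)"
      by (rule avg_nested_const[OF adm]) (use d in \<open>auto simp: d_def\<close>)
    moreover have "\<bar>avg ?u x d - ?u x\<bar> \<le> 2 * D * P * d" "\<bar>avg ?u y (2 * d) - ?u y\<bar> \<le> 2 * D * P * (2 * d)"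
      using avg_telescope_const[OF adm, of d x] avg_telescope_const[OF adm, of "2 * d" y] d by simp_all
    moreover have "?u x = 0" by (rule chain_cost_start[where B=1]) (use \<delta> Q0 in auto)
    ultimately have "?u y \<le> 8 * D ^ 2 * P * d" using DP by simp
    then have "?u y < Q * d" using Qd by linarith
    from chain_cost_less_imp_chain[OF this] show ?thesis by (auto intro: less_imp_le)
  qed
  obtain T f where "0 \<le> T" "T \<le> Q * d / 1" "1-lipschitz_on UNIV f" "\<And>t. t \<le> 0 \<Longrightarrow> f t = x"
    "\<And>t. T \<le> t \<Longrightarrow> f t = y"
    by (rule chain_limit[where c=1 and \<rho>="\<lambda>_. 1" and K="Q * d", OF compact_cball_doubling _ _ _ chains]) auto
  then show thesis using that[of T f] by (simp add: d_def)
qed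

end

lemma ennreal_abs_triangle:
  fixes a b c :: real
  shows "ennreal \<bar>a - c\<bar> \<le> ennreal \<bar>a - b\<bar> + ennreal \<bar>b - c\<bar>"
proof -
  have "ennreal \<bar>a - c\<bar> \<le> ennreal (\<bar>a - b\<bar> + \<bar>b - c\<bar>)" by (rule ennreal_leI) simp
  then show ?thesis by (simp add: ennreal_plus)
qed

lemma ennreal_abs_telescope:
  fixes a :: "nat \<Rightarrow> real"
  assumes "\<And>j. j < n \<Longrightarrow> ennreal \<bar>a j - a (Suc j)\<bar> \<le> c j"
  shows "ennreal \<bar>a 0 - a n\<bar> \<le> (\<Sum>j<n. c j)"
  using assms
proof (induction n)
  case (Suc n)
  have "ennreal \<bar>a 0 - a (Suc n)\<bar> \<le> ennreal \<bar>a 0 - a n\<bar> + ennreal \<bar>a n - a (Suc n)\<bar>"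
    by (rule ennreal_abs_triangle)
  also have "\<dots> \<le> (\<Sum>j<n. c j) + c n" using Suc by (intro add_mono) auto
  finally show ?case by simp
qed simp

context poincare_space
begin

subsection \<open>Pointwise estimate\<close>

lemma Q_ge: "1 \<le> Q"
  using D_ge P_pos by (simp add: Q_def)

text \<open>\<open>kH\<close> doublings enlarge a ball of radius \<open>r/8\<close> to radius \<open>(3 + 2Q) r\<close>.\<close>

definition kH :: nat where "kH = (LEAST k. 8 * (3 + 2 * Q) \<le> 2 ^ k)"

lemma kH: "8 * (3 + 2 * Q) \<le> 2 ^ kH"
proof -
  obtain k where "8 * (3 + 2 * Q) < 2 ^ k" using real_arch_pow[of 2] by auto
  then have "8 * (3 + 2 * Q) \<le> 2 ^ k" by simp
  then show ?thesis unfolding kH_def by (rule LeastI)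
qed

text \<open>Balls of radius between \<open>\<kappa> * r\<close> and
  \<open>2 * (\<kappa> * r)\<close>, dilated by \<open>l\<close>, have radius between
  \<open>r / 8\<close> and \<open>r / 4\<close>: large enough to compare with the scale
  \<open>r\<close>, small enough to stay away from a pole at distance \<open>r / 2\<close>. A path
  of length \<open>Q * r\<close> is covered by \<open>nsteps\<close> steps of length
  \<open>\<kappa> * r\<close>. In \<open>CH\<close>, 4 comes from
  \<open>r / 4 \<le> dist x z\<close> and \<open>D ^ kH\<close> from comparing balls about
  \<open>x\<close> with balls on the path. \<open>C2\<close> counts two comparisons for each step
  and one for the final halving of the radius.\<close>

definition \<kappa> :: real where "\<kappa> = 1 / (8 * l)"
definition nsteps :: nat where "nsteps = nat \<lceil>8 * l * Q\<rceil>"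
definition CH :: real where "CH = 4 * D ^ kH"
definition C2 :: real where "C2 = (4 * real nsteps + 2) * (D ^ 2 * P * \<kappa> * CH)"

lemma \<kappa>_pos: "0 < \<kappa>" and l\<kappa>: "l * \<kappa> = 1 / 8"
  using l_ge by (auto simp: \<kappa>_def)

lemma nsteps: "0 < nsteps" "Q \<le> \<kappa> * real nsteps"
proof -
  have "8 * l * Q \<le> real nsteps" unfolding nsteps_def by linarith
  moreover have "1 \<le> l * Q" using mult_mono[OF l_ge Q_ge] l_ge by simp
  ultimately show "Q \<le> \<kappa> * real nsteps" "0 < nsteps"
    using l_ge by (auto simp: \<kappa>_def field_simps intro: gr0I)
qed

lemma C_nonneg: "0 \<le> CH" "0 \<le> C2" "0 \<le> D ^ 2 * P * \<kappa> * CH"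
  using D_ge P_pos \<kappa>_pos by (auto simp: CH_def C2_def intro!: mult_nonneg_nonneg)

text \<open>Paths of length \<open>Q * r\<close> from a point at distance \<open>r\<close> reach
  distance at most \<open>(1 + Q) * r\<close>, and the dilated balls add at most
  \<open>r / 4\<close>. On the inner side the paths stop at distance \<open>r / 2\<close>, which
  leaves \<open>r / 4\<close>.\<close>

definition annulus :: "'a \<Rightarrow> real \<Rightarrow> 'a set" where
  "annulus x r = {z. r / 4 \<le> dist x z \<and> dist x z < (2 + Q) * r}"

definition GK :: "('a \<Rightarrow> real) \<Rightarrow> 'a \<Rightarrow> 'a set \<Rightarrow> ennreal" where
  "GK g x S = (\<integral>\<^sup>+ z \<in> S. ennreal (g z * K x z) \<partial>M)"

lemma annulus_measurable [measurable]: "annulus x r \<in> sets M"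
proof -
  have "annulus x r = ball x ((2 + Q) * r) - ball x (r / 4)"
    by (auto simp: annulus_def not_less)
  then show ?thesis by auto
qed

lemma ball_in_annulus:
  assumes "r / 2 \<le> dist x q" "dist x q \<le> (1 + Q) * r" "s \<le> r / 4" "0 < r"
  shows "ball q s \<subseteq> annulus x r"
proof
  fix z assume "z \<in> ball q s"
  then show "z \<in> annulus x r"
    using assms dist_triangle[of x z q] dist_triangle[of x q z]
    by (auto simp: annulus_def algebra_simps dist_commute)
qed

text \<open>All points of the ball have distance from \<open>x\<close> comparable to
  \<open>r\<close>, so \<open>r / m q s\<close> is at most \<open>CH\<close> times the kernel on the
  whole ball. This turns the averages of the Poincare inequality into kernel integrals over the
  annulus.\<close>

lemma average_le_GK:
  assumes gm [measurable]: "g \<in> borel_measurable M" and g: "\<And>z. 0 \<le> g z"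
    and q: "r / 2 \<le> dist x q" "dist x q \<le> (1 + Q) * r" and s: "r / 8 \<le> s" "s \<le> r / 4" and r: "0 < r"
    and c: "0 \<le> c"
  shows "ennreal (c * r / m q s) * (\<integral>\<^sup>+ z \<in> ball q s. ennreal (g z) \<partial>M) \<le> ennreal (c * CH) * GK g x (annulus x r)"
proof -
  have s0: "0 < s" using s r by simp
  have ms: "0 < m q s" by (rule m_pos[OF s0])
  have pt: "r / m q s \<le> CH * K x z" if z: "z \<in> ball q s" for z
  proof -
    have za: "r / 4 \<le> dist x z" "dist x z < (2 + Q) * r"
      using ball_in_annulus[OF q s(2) r] z by (auto simp: annulus_def)
    have "dist q x + dist x z \<le> (3 + 2 * Q) * r"
      using za q by (simp add: dist_commute algebra_simps)
    also have "\<dots> \<le> 2 ^ kH / 8 * r" using kH r by (intro mult_right_mono) auto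
    also have "\<dots> \<le> 2 ^ kH * s"
    proof -
      have "2 ^ kH * (r / 8) \<le> 2 ^ kH * s" using s by (intro mult_left_mono) auto
      then show ?thesis by simp
    qed
    finally have "m x (dist x z) \<le> D ^ kH * m q s" by (intro m_compare[OF s0])
    moreover have "0 < dist x z" using za r by linarith
    then have mx: "0 < m x (dist x z)" by (rule m_pos)
    ultimately have "r / m q s \<le> r * D ^ kH / m x (dist x z)"
      using ms r D_ge by (simp add: field_simps)
    also have "\<dots> \<le> (4 * dist x z) * D ^ kH / m x (dist x z)"
      using za mx D_ge by (intro divide_right_mono mult_right_mono) auto
    finally show ?thesis by (simp add: CH_def K_def mult.commute mult.left_commute)
  qed
  have "ennreal (c * r / m q s) * (\<integral>\<^sup>+ z \<in> ball q s. ennreal (g z) \<partial>M) = ennreal c * (ennreal (r / m q s) * (\<integral>\<^sup>+ z \<in> ball q s. ennreal (g z) \<partial>M))"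
    using c by (simp add: ennreal_mult' mult.assoc flip: times_divide_eq_right)
  also have "\<dots> \<le> ennreal c * (ennreal CH * GK g x (annulus x r))"
  proof (rule mult_left_mono)
    have "ennreal (r / m q s) * (\<integral>\<^sup>+ z \<in> ball q s. ennreal (g z) \<partial>M) = (\<integral>\<^sup>+ z. ennreal (r / m q s) * (ennreal (g z) * indicator (ball q s) z) \<partial>M)"
      by (rule nn_integral_cmult[symmetric]) measurable
    also have "\<dots> \<le> (\<integral>\<^sup>+ z. ennreal CH * (ennreal (g z * K x z) * indicator (annulus x r) z) \<partial>M)"
    proof (rule nn_integral_mono)
      fix z
      show "ennreal (r / m q s) * (ennreal (g z) * indicator (ball q s) z) \<le> ennreal CH * (ennreal (g z * K x z) * indicator (annulus x r) z)"
      proof (cases "z \<in> ball q s")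
        case True
        have "r / m q s * g z \<le> CH * (g z * K x z)"
          using mult_right_mono[OF pt[OF True] g[of z]] by (simp only: mult_ac)
        then have "ennreal (r / m q s * g z) \<le> ennreal (CH * (g z * K x z))" by (rule ennreal_leI)
        then have "ennreal (r / m q s) * ennreal (g z) \<le> ennreal CH * ennreal (g z * K x z)"
          by (simp only: ennreal_mult''[OF g[of z]] ennreal_mult'[OF C_nonneg(1)])
        moreover have "z \<in> annulus x r" using True ball_in_annulus[OF q s(2) r] by blast
        ultimately show ?thesis using True by simp
      qed simp
    qed
    also have "\<dots> = ennreal CH * GK g x (annulus x r)"
      unfolding GK_def by (rule nn_integral_cmult) measurable
    finally show "ennreal (r / m q s) * (\<integral>\<^sup>+ z \<in> ball q s. ennreal (g z) \<partial>M) \<le> ennreal CH * GK g x (annulus x r)" .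
  qed simp
  also have "\<dots> = ennreal (c * CH) * GK g x (annulus x r)"
    using c by (simp add: ennreal_mult' mult.assoc)
  finally show ?thesis .
qed


lemma admissible_nonneg: "admissible u g \<Longrightarrow> 0 \<le> g z"
  by (simp add: admissible_def upper_gradient_def)

lemma avg_nested_annulus:
  assumes adm: "admissible u g" and s: "0 < s" "dist p q + s \<le> t" "dist p q + t \<le> 2 ^ k * s" and k: "k \<le> 2"
    and q: "r / 2 \<le> dist x q" "dist x q \<le> (1 + Q) * r" and t: "\<kappa> * r \<le> t" "t \<le> 2 * (\<kappa> * r)" and r: "0 < r"
  shows "ennreal \<bar>avg u p s - avg u q t\<bar> \<le> ennreal (2 * (D ^ 2 * P * \<kappa> * CH)) * GK g x (annulus x r)"
proof -
  have lt: "r / 8 \<le> l * t" "l * t \<le> r / 4"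
  proof -
    have "l * (\<kappa> * r) \<le> l * t" "l * t \<le> l * (2 * (\<kappa> * r))" using t l_ge by (auto intro!: mult_left_mono)
    moreover have "l * (\<kappa> * r) = r / 8" "l * (2 * (\<kappa> * r)) = r / 4"
      using l\<kappa> by (simp_all add: mult.assoc[symmetric] mult.commute[of l 2] mult.left_commute)
    ultimately show "r / 8 \<le> l * t" "l * t \<le> r / 4" by simp_all
  qed
  have mq: "0 < m q (l * t)" by (rule m_pos) (use lt r in simp)
  have "ennreal \<bar>avg u p s - avg u q t\<bar> \<le> ennreal (D ^ k * P * t / m q (l * t)) * (\<integral>\<^sup>+ z \<in> ball q (l * t). ennreal (g z) \<partial>M)"
    by (rule avg_nested_dist[OF adm s])
  also have "\<dots> \<le> ennreal (2 * D ^ 2 * P * \<kappa> * r / m q (l * t)) * (\<integral>\<^sup>+ z \<in> ball q (l * t). ennreal (g z) \<partial>M)"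
  proof (intro mult_right_mono ennreal_leI divide_right_mono)
    have "D ^ k * P * t \<le> D ^ 2 * P * (2 * (\<kappa> * r))"
      using D_ge P_pos t k \<kappa>_pos r by (intro mult_mono power_increasing) auto
    then show "D ^ k * P * t \<le> 2 * D ^ 2 * P * \<kappa> * r" by (simp add: mult_ac)
  qed (use mq in auto)
  also have "\<dots> \<le> ennreal (2 * D ^ 2 * P * \<kappa> * CH) * GK g x (annulus x r)"
    by (rule average_le_GK[OF admissible_measurable[OF adm] admissible_nonneg[OF adm] q lt r])
      (use D_ge P_pos \<kappa>_pos in auto)
  finally show ?thesis by (simp add: mult.assoc)
qed

text \<open>A quasiconvex path from \<open>p\<close> to \<open>x\<close> is stopped at the first
  time its distance from \<open>x\<close> is \<open>r / 2\<close>. This time exists because the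
  level set is compact; a smaller distance before it would force an earlier crossing.\<close>

lemma path_to_half_distance:
  assumes r: "dist x p = r" "0 < r"
  obtains f :: "real \<Rightarrow> 'a" and T where "0 \<le> T" "T \<le> Q * r" "1-lipschitz_on UNIV f" "f 0 = p" "dist x (f T) = r / 2"
    "\<And>t. t \<in> {0..T} \<Longrightarrow> r / 2 \<le> dist x (f t)" "\<And>t. t \<in> {0..T} \<Longrightarrow> dist x (f t) \<le> (1 + Q) * r"
proof -
  obtain T0 f where f: "0 \<le> T0" "T0 \<le> Q * dist p x" "1-lipschitz_on UNIV f" "f 0 = p" "f T0 = x"
    using quasiconvex[of p x] by blast
  have cont: "continuous_on S (\<lambda>t. dist x (f t))" for S
    by (intro continuous_intros lipschitz_on_continuous_on[OF lipschitz_on_subset[OF f(3)]]) auto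
  define S where "S = {t \<in> {0..T0}. dist x (f t) = r / 2}"
  have "closed S"
    unfolding S_def using continuous_closed_preimage_constant[OF cont[of "{0..T0}"], of "r/2"] by simp
  moreover have "S = {0..T0} \<inter> S" by (auto simp: S_def)
  ultimately have "compact S" by (metis compact_Icc compact_Int_closed)
  moreover have ivt: "\<exists>t\<ge>0. t \<le> t1 \<and> dist x (f t) = r / 2" if "0 \<le> t1" "dist x (f t1) \<le> r / 2" for t1
    by (rule IVT2'[OF that(2) _ that(1) cont]) (use f r in auto)
  have "S \<noteq> {}" using ivt[of T0] f r by (auto simp: S_def)
  ultimately obtain T where T: "T \<in> S" "\<And>t. t \<in> S \<Longrightarrow> T \<le> t"
    using compact_attains_inf[of S] by blast
  have T0: "0 \<le> T" "T \<le> T0" "dist x (f T) = r / 2" using T(1) by (auto simp: S_def)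
  have Qr: "T \<le> Q * r" using T0(2) f(2) r by (simp add: dist_commute)
  show thesis
  proof (rule that[OF T0(1) Qr f(3,4) T0(3)])
    fix t assume t: "t \<in> {0..T}"
    show "r / 2 \<le> dist x (f t)"
    proof (rule ccontr)
      assume n: "\<not> r / 2 \<le> dist x (f t)"
      then obtain t' where t': "t' \<ge> 0" "t' \<le> t" "dist x (f t') = r / 2" using ivt[of t] t by auto
      then have "T \<le> t'" using T(2)[of t'] t T0 by (simp add: S_def)
      then have "t' = t" using t' t by simp
      then show False using t' n by simp
    qed
    have "dist (f 0) (f t) \<le> t" using lipschitz_onD[OF f(3), of 0 t] t by (simp add: dist_real_def)
    then show "dist x (f t) \<le> (1 + Q) * r"
      using dist_triangle[of x "f t" p] f(4) r Qr t by (simp add: algebra_simps)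
  qed
qed

text \<open>
  Walking from \<open>p\<close> towards \<open>x\<close> until the distance is halved keeps the balls away from \<open>x\<close>.
  Concentric balls around \<open>x\<close> would lose a logarithm against the kernel.
\<close>

lemma annulus_step:
  assumes adm: "admissible u g" and r: "dist x p = r" "0 < r"
  shows "\<exists>p'. dist x p' = r / 2 \<and>
    ennreal \<bar>avg u p (\<kappa> * r) - avg u p' (\<kappa> * (r / 2))\<bar> \<le> ennreal C2 * GK g x (annulus x r)"
proof -
  obtain f T where f: "0 \<le> T" "T \<le> Q * r" "1-lipschitz_on UNIV f" "f 0 = p" "dist x (f T) = r / 2"
    "\<And>t. t \<in> {0..T} \<Longrightarrow> r / 2 \<le> dist x (f t)" "\<And>t. t \<in> {0..T} \<Longrightarrow> dist x (f t) \<le> (1 + Q) * r"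
    using path_to_half_distance[OF r] by metis
  let ?n = nsteps let ?E = "D ^ 2 * P * \<kappa> * CH" let ?G = "GK g x (annulus x r)"
  define q where "q j = f (real j * T / ?n)" for j
  have n0: "0 < real ?n" using nsteps(1) by simp
  have tj: "real j * T / ?n \<in> {0..T}" if "j \<le> ?n" for j
    using that f(1) n0 mult_right_mono[of "real j" "real ?n" T] by (auto simp: field_simps)
  have q: "r / 2 \<le> dist x (q j)" "dist x (q j) \<le> (1 + Q) * r" if "j \<le> ?n" for j
    using f(6,7)[OF tj[OF that]] by (auto simp: q_def)
  have q0: "q 0 = p" "q ?n = f T" using f(4) n0 by (auto simp: q_def)
  have qstep: "dist (q (Suc j)) (q j) \<le> \<kappa> * r" for j
  proof -
    have "dist (q (Suc j)) (q j) \<le> \<bar>real (Suc j) * T / ?n - real j * T / ?n\<bar>"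
      using lipschitz_onD[OF f(3), of "real (Suc j) * T / ?n" "real j * T / ?n"] by (simp add: q_def dist_real_def)
    also have "\<dots> = T / ?n" using f(1) n0 by (simp add: field_simps)
    also have "\<dots> \<le> Q * r / ?n" using f(2) n0 by (intro divide_right_mono) auto
    also have "\<dots> \<le> \<kappa> * real ?n * r / ?n" using nsteps(2) n0 r by (intro divide_right_mono mult_right_mono) auto
    finally show ?thesis using n0 by simp
  qed
  have \<kappa>r: "0 < \<kappa> * r" using \<kappa>_pos r by simp
  \<comment> \<open>Neighbouring balls of radius \<open>\<kappa> * r\<close> are not nested, but
    both lie in the ball of twice that radius about \<open>q j\<close>.\<close>
  have big: "ennreal \<bar>avg u p1 (\<kappa> * r) - avg u (q j) (2 * (\<kappa> * r))\<bar> \<le> ennreal (2 * ?E) * ?G"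
    if "j \<le> ?n" "dist p1 (q j) \<le> \<kappa> * r" for j p1
  proof (rule avg_nested_annulus[OF adm \<kappa>r, where k=2])
    have "2 ^ 2 * (\<kappa> * r) = 4 * (\<kappa> * r)" by simp
    then show "dist p1 (q j) + \<kappa> * r \<le> 2 * (\<kappa> * r)" "dist p1 (q j) + 2 * (\<kappa> * r) \<le> 2 ^ 2 * (\<kappa> * r)"
      using that(2) \<kappa>r by linarith+
    show "r / 2 \<le> dist x (q j)" "dist x (q j) \<le> (1 + Q) * r" by (rule q[OF that(1)])+
    show "0 < r" by (rule r(2))
    show "\<kappa> * r \<le> 2 * (\<kappa> * r)" using \<kappa>r by linarith
  qed simp_all
  have step: "ennreal \<bar>avg u (q j) (\<kappa> * r) - avg u (q (Suc j)) (\<kappa> * r)\<bar> \<le> ennreal (4 * ?E) * ?G" if "j < ?n" for j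
  proof -
    have "ennreal \<bar>avg u (q j) (\<kappa> * r) - avg u (q (Suc j)) (\<kappa> * r)\<bar>
      \<le> ennreal \<bar>avg u (q j) (\<kappa> * r) - avg u (q j) (2 * (\<kappa> * r))\<bar> + ennreal \<bar>avg u (q j) (2 * (\<kappa> * r)) - avg u (q (Suc j)) (\<kappa> * r)\<bar>"
      by (rule ennreal_abs_triangle)
    also have "\<dots> \<le> ennreal (2 * ?E) * ?G + ennreal (2 * ?E) * ?G"
      using big[of j "q j"] big[of j "q (Suc j)"] that qstep[of j] \<kappa>r
      by (intro add_mono) (auto simp: abs_minus_commute)
    also have "\<dots> = ennreal (4 * ?E) * ?G"
      using C_nonneg(3) by (simp flip: distrib_right ennreal_plus)
    finally show ?thesis .
  qed
  have A: "ennreal \<bar>avg u (q 0) (\<kappa> * r) - avg u (q ?n) (\<kappa> * r)\<bar> \<le> (\<Sum>j<?n. ennreal (4 * ?E) * ?G)"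
    by (rule ennreal_abs_telescope) (rule step)
  also have "\<dots> = ennreal (4 * real ?n * ?E) * ?G"
    using C_nonneg(3) by (simp add: ennreal_of_nat_eq_real_of_nat mult.assoc[symmetric] flip: ennreal_mult') (simp add: mult_ac)
  finally have A: "ennreal \<bar>avg u p (\<kappa> * r) - avg u (f T) (\<kappa> * r)\<bar> \<le> ennreal (4 * real ?n * ?E) * ?G"
    by (simp add: q0)
  have B: "ennreal \<bar>avg u (f T) (\<kappa> * r) - avg u (f T) (\<kappa> * (r / 2))\<bar> \<le> ennreal (2 * ?E) * ?G"
  proof -
    have "ennreal \<bar>avg u (f T) (\<kappa> * (r / 2)) - avg u (f T) (\<kappa> * r)\<bar> \<le> ennreal (2 * ?E) * ?G"
      proof (rule avg_nested_annulus[OF adm, where k=1])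
      show "r / 2 \<le> dist x (f T)" "dist x (f T) \<le> (1 + Q) * r" using q[of ?n] q0(2) by simp_all
    qed (use r(2) \<kappa>r \<kappa>_pos in simp_all)
    then show ?thesis by (simp add: abs_minus_commute)
  qed
  have "ennreal \<bar>avg u p (\<kappa> * r) - avg u (f T) (\<kappa> * (r / 2))\<bar> \<le> ennreal (4 * real ?n * ?E) * ?G + ennreal (2 * ?E) * ?G"
    by (rule order_trans[OF ennreal_abs_triangle add_mono[OF A B]])
  also have "\<dots> = ennreal C2 * ?G"
    using C_nonneg(3) by (simp add: C2_def distrib_right ennreal_plus mult.assoc)
  finally show ?thesis using f(5) by blast
qed

text \<open>Two annuli that share \<open>z\<close> have scales within a factor
  \<open>4 * (2 + Q)\<close>, hence indices less than \<open>kH\<close> apart. Bounded overlap lets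
  the sum over all scales be absorbed into one kernel integral, independently of the number of
  scales.\<close>

lemma annulus_overlap:
  assumes r: "0 < r"
  shows "(\<Sum>i<n. indicator (annulus x (r / 2 ^ i)) z :: ennreal) \<le> of_nat kH * indicator (ball x ((2 + Q) * r)) z"
proof -
  define J where "J = {i\<in>{..<n}. z \<in> annulus x (r / 2 ^ i)}"
  have eq: "(\<Sum>i<n. indicator (annulus x (r / 2 ^ i)) z :: ennreal) = of_nat (card J)"
    by (simp add: J_def indicator_def sum.If_cases Int_def)
  show ?thesis
  proof (cases "J = {}")
    case True then show ?thesis by (simp add: eq)
  next
    case False
    define i0 where "i0 = Min J"
    have fin: "finite J" by (simp add: J_def)
    have i0: "i0 \<in> J" "\<And>i. i \<in> J \<Longrightarrow> i0 \<le> i" using False fin by (auto simp: i0_def)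
    have "J \<subseteq> {i0..<i0 + kH}"
    proof
      fix i assume i: "i \<in> J"
      have "r / 2 ^ i0 / 4 \<le> dist x z" "dist x z < (2 + Q) * (r / 2 ^ i)"
        using i i0(1) by (auto simp: J_def annulus_def)
      then have "r / 2 ^ i0 / 4 < (2 + Q) * (r / 2 ^ i)" by linarith
      then have "r * 2 ^ i < r * (4 * (2 + Q) * 2 ^ i0)" by (simp add: field_simps)
      then have "2 ^ i < 4 * (2 + Q) * 2 ^ i0" using r by simp
      also have "\<dots> \<le> 2 ^ kH * 2 ^ i0" using kH Q_ge by (intro mult_right_mono) auto
      also have "\<dots> = (2::real) ^ (kH + i0)" by (simp add: power_add)
      finally have "i < kH + i0" by simp
      then show "i \<in> {i0..<i0 + kH}" using i0(2)[OF i] by simp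
    qed
    then have "card J \<le> kH" using card_mono[of "{i0..<i0 + kH}" J] by simp
    moreover have "z \<in> ball x ((2 + Q) * r)"
    proof -
      have "dist x z < (2 + Q) * (r / 2 ^ i0)" using i0(1) by (auto simp: J_def annulus_def)
      also have "\<dots> \<le> (2 + Q) * (r / 1)" using r Q_ge by (intro mult_left_mono divide_left_mono) auto
      finally show ?thesis by simp
    qed
    ultimately show ?thesis by (simp add: eq)
  qed
qed

definition C3 :: real where "C3 = C2 * real kH"

text \<open>Iterating \<open>annulus_step\<close> gives points at distances \<open>r / 2 ^ i\<close>
  from \<open>x\<close> with radii shrinking at the same rate, so the averages tend to
  \<open>u x\<close>, while the annuli have bounded overlap.\<close>

lemma point_estimate:
  assumes adm: "admissible u g" and p: "x \<noteq> p"
  shows "ennreal \<bar>avg u p (\<kappa> * dist x p) - u x\<bar> \<le> ennreal C3 * GK g x (ball x ((2 + Q) * dist x p))"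
proof -
  have u: "continuous_on UNIV u" "bounded (range u)" using adm by (auto simp: admissible_def)
  have [measurable]: "g \<in> borel_measurable M" by (rule admissible_measurable[OF adm])
  define r where "r = dist x p"
  have r: "0 < r" using p by (simp add: r_def)
  define nx where "nx = (\<lambda>p. SOME p'. dist x p' = dist x p / 2 \<and>
    ennreal \<bar>avg u p (\<kappa> * dist x p) - avg u p' (\<kappa> * (dist x p / 2))\<bar> \<le> ennreal C2 * GK g x (annulus x (dist x p)))"
  have nxt: "dist x (nx p) = dist x p / 2 \<and>
    ennreal \<bar>avg u p (\<kappa> * dist x p) - avg u (nx p) (\<kappa> * (dist x p / 2))\<bar> \<le> ennreal C2 * GK g x (annulus x (dist x p))"
    if "0 < dist x p" for p
    unfolding nx_def by (rule someI_ex) (rule annulus_step[OF adm refl that])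
  define pp where "pp i = (nx ^^ i) p" for i
  have pS: "pp (Suc i) = nx (pp i)" and p0: "pp 0 = p" for i by (auto simp: pp_def)
  have dpp: "dist x (pp i) = r / 2 ^ i" for i
  proof (induction i)
    case (Suc i)
    then show ?case using nxt[of "pp i"] r by (simp add: pS)
  qed (simp add: p0 r_def)
  have step: "ennreal \<bar>avg u (pp i) (\<kappa> * (r / 2 ^ i)) - avg u (pp (Suc i)) (\<kappa> * (r / 2 ^ Suc i))\<bar> \<le> ennreal C2 * GK g x (annulus x (r / 2 ^ i))" for i
    using nxt[of "pp i"] r by (simp add: dpp pS mult.commute)
  \<comment> \<open>The limit is taken among real numbers, under a finite bound \<open>b\<close>; an
    infinite right-hand side leaves nothing to prove.\<close>
  have bound: "\<bar>avg u p (\<kappa> * r) - avg u (pp i) (\<kappa> * (r / 2 ^ i))\<bar> \<le> b"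
    if b: "ennreal C3 * GK g x (ball x ((2 + Q) * r)) \<le> ennreal b" "0 \<le> b" for b i
  proof -
    have "ennreal \<bar>avg u (pp 0) (\<kappa> * (r / 2 ^ 0)) - avg u (pp i) (\<kappa> * (r / 2 ^ i))\<bar> \<le> (\<Sum>j<i. ennreal C2 * GK g x (annulus x (r / 2 ^ j)))"
      by (rule ennreal_abs_telescope) (rule step)
    also have "\<dots> = ennreal C2 * (\<integral>\<^sup>+ z. (\<Sum>j<i. ennreal (g z * K x z) * indicator (annulus x (r / 2 ^ j)) z) \<partial>M)"
      unfolding GK_def by (subst nn_integral_sum) (auto simp: sum_distrib_left)
    also have "\<dots> \<le> ennreal C2 * (\<integral>\<^sup>+ z. of_nat kH * (ennreal (g z * K x z) * indicator (ball x ((2 + Q) * r)) z) \<partial>M)"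
    proof (intro mult_left_mono nn_integral_mono)
      fix z
      show "(\<Sum>j<i. ennreal (g z * K x z) * indicator (annulus x (r / 2 ^ j)) z) \<le> of_nat kH * (ennreal (g z * K x z) * indicator (ball x ((2 + Q) * r)) z)"
        using mult_left_mono[OF annulus_overlap[OF r, where n=i and x=x and z=z], of "ennreal (g z * K x z)"]
        by (simp add: sum_distrib_left mult_ac)
    qed simp
    also have "\<dots> = ennreal C2 * (of_nat kH * GK g x (ball x ((2 + Q) * r)))"
      unfolding GK_def by (subst nn_integral_cmult) auto
    also have "\<dots> = ennreal C3 * GK g x (ball x ((2 + Q) * r))"
      using C_nonneg(2) by (simp add: C3_def ennreal_mult' mult.assoc ennreal_of_nat_eq_real_of_nat)
    also have "\<dots> \<le> ennreal b" by (rule b(1))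
    finally show ?thesis using b(2) by (simp add: p0)
  qed
  have "(\<lambda>i. (1 + \<kappa>) * (r * (1/2) ^ i)) \<longlonglongrightarrow> (1 + \<kappa>) * (r * 0)" by (intro tendsto_intros) auto
  then have "(\<lambda>i. dist x (pp i) + \<kappa> * (r / 2 ^ i)) \<longlonglongrightarrow> 0"
    by (simp add: dpp power_divide distrib_right add_divide_distrib)
  then have "(\<lambda>i. avg u (pp i) (\<kappa> * (r / 2 ^ i))) \<longlonglongrightarrow> u x"
    by (intro avg_tendsto[OF u]) (use r \<kappa>_pos in auto)
  then have lim: "(\<lambda>i. \<bar>avg u p (\<kappa> * r) - avg u (pp i) (\<kappa> * (r / 2 ^ i))\<bar>) \<longlonglongrightarrow> \<bar>avg u p (\<kappa> * r) - u x\<bar>"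
    by (intro tendsto_intros)
  show ?thesis
  proof (cases "ennreal C3 * GK g x (ball x ((2 + Q) * r))")
    case (real b)
    have "\<bar>avg u p (\<kappa> * r) - u x\<bar> \<le> b"
      by (rule LIMSEQ_le_const2[OF lim]) (use bound[of b] real in auto)
    then show ?thesis using real by (simp add: r_def[symmetric] ennreal_leI)
  qed (simp add: r_def)
qed

text \<open>The intermediate point lies within \<open>3 / 2 * d\<close> of \<open>x\<close> and at
  distance \<open>d / 2\<close> from \<open>y\<close>, so balls of radius
  \<open>(2 + Q) * (3 / 2 * d)\<close> about the poles have to fit into the double ball.
  \<open>C4\<close> adds two pointwise estimates and one change of radius.\<close>

definition C0 :: real where "C0 = 2 * (2 + Q)"
definition C4 :: real where "C4 = 2 * C3 + 2 * (D ^ 2 * P * \<kappa> * CH)"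

lemma C34_nonneg: "0 \<le> C3" "0 \<le> C4"
  using C_nonneg by (auto simp: C3_def C4_def)

text \<open>A point at distance \<open>d / 2\<close> from \<open>y\<close> is at distance comparable
  to \<open>d\<close> from both poles. The pointwise estimate is applied from each pole, and the two
  resulting balls about this point differ in radius by a bounded factor.\<close>

theorem two_point_estimate:
  assumes adm: "admissible u g" and xy: "x \<noteq> y"
  shows "ennreal \<bar>u x - u y\<bar> \<le> ennreal C4 * (\<integral>\<^sup>+ z \<in> double_ball C0 x y. ennreal (g z * riesz_kernel M x y z) \<partial>M)"
proof -
  have [measurable]: "g \<in> borel_measurable M" by (rule admissible_measurable[OF adm])
  have g0: "0 \<le> g z" for z by (rule admissible_nonneg[OF adm])
  define d where "d = dist x y"
  have d: "0 < d" using xy by (simp add: d_def)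
  let ?I = "\<integral>\<^sup>+ z \<in> double_ball C0 x y. ennreal (g z * riesz_kernel M x y z) \<partial>M"
  have "dist y x = d" by (simp add: d_def dist_commute)
  then obtain p where p: "dist y p = d / 2"
    by (rule path_to_half_distance[OF _ d])
  define r where "r = dist x p"
  have r: "d / 2 \<le> r" "r \<le> 3 / 2 * d"
    using p dist_triangle[of x y p] dist_triangle[of x p y] by (simp_all add: r_def d_def dist_commute)
  have xp: "x \<noteq> p" "y \<noteq> p" using r p d by (auto simp: r_def)
  have G: "GK g w S \<le> ?I" if "S \<subseteq> double_ball C0 x y" "w = x \<or> w = y" for w S
    unfolding GK_def
  proof (rule nn_integral_mono)
    fix z
    have "g z * K w z \<le> g z * riesz_kernel M x y z"
      using that(2) K_nonneg[of x z] K_nonneg[of y z] g0[of z] by (intro mult_left_mono) (auto simp: riesz_kernel_eq)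
    then show "ennreal (g z * K w z) * indicator S z \<le> ennreal (g z * riesz_kernel M x y z) * indicator (double_ball C0 x y) z"
      using that(1) by (auto simp: indicator_def intro: ennreal_leI)
  qed
  have ball_sub: "ball w s \<subseteq> double_ball C0 x y" if "s \<le> (2 + Q) * (3 / 2 * d)" "w = x \<or> w = y" for w s
  proof -
    have "(2 + Q) * (3 / 2 * d) \<le> C0 * d" using Q_ge d by (simp add: C0_def)
    then have "s \<le> C0 * d" using that by linarith
    then show ?thesis using that(2) by (auto simp: double_ball_def d_def)
  qed
  have r1: "(2 + Q) * r \<le> (2 + Q) * (3 / 2 * d)" "(2 + Q) * (d / 2) \<le> (2 + Q) * (3 / 2 * d)"
    using r d Q_ge by (auto intro!: mult_left_mono)
  have A: "ennreal \<bar>u x - avg u p (\<kappa> * r)\<bar> \<le> ennreal C3 * ?I"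
  proof -
    have "ennreal \<bar>u x - avg u p (\<kappa> * r)\<bar> \<le> ennreal C3 * GK g x (ball x ((2 + Q) * r))"
      using point_estimate[OF adm xp(1)] by (simp add: r_def abs_minus_commute)
    also have "\<dots> \<le> ennreal C3 * ?I" by (intro mult_left_mono G ball_sub r1) auto
    finally show ?thesis .
  qed
  have B: "ennreal \<bar>avg u p (\<kappa> * (d / 2)) - u y\<bar> \<le> ennreal C3 * ?I"
  proof -
    have "ennreal \<bar>avg u p (\<kappa> * (d / 2)) - u y\<bar> \<le> ennreal C3 * GK g y (ball y ((2 + Q) * (d / 2)))"
      using point_estimate[OF adm xp(2)] by (simp add: p)
    also have "\<dots> \<le> ennreal C3 * ?I" by (intro mult_left_mono G ball_sub r1) auto
    finally show ?thesis .
  qed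
  let ?E = "D ^ 2 * P * \<kappa> * CH"
  have C: "ennreal \<bar>avg u p (\<kappa> * r) - avg u p (\<kappa> * (d / 2))\<bar> \<le> ennreal (2 * ?E) * ?I"
  proof -
    have r0: "0 < r" using r d by linarith
    have \<kappa>d: "\<kappa> * (d / 2) \<le> \<kappa> * r" "\<kappa> * r \<le> \<kappa> * (4 * (d / 2))"
      using r \<kappa>_pos d by (auto intro!: mult_left_mono simp del: mult_le_cancel_left)
    have "ennreal \<bar>avg u p (\<kappa> * (d / 2)) - avg u p (\<kappa> * r)\<bar> \<le> ennreal (2 * ?E) * GK g x (annulus x r)"
    proof (rule avg_nested_annulus[OF adm, where k=2])
      show "dist x p \<le> (1 + Q) * r" using Q_ge r0 by (simp add: r_def[symmetric])
    qed (use \<kappa>d \<kappa>_pos d r0 in \<open>auto simp: r_def[symmetric]\<close>)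
    also have "\<dots> \<le> ennreal (2 * ?E) * ?I"
    proof (intro mult_left_mono G)
      have "annulus x r \<subseteq> ball x ((2 + Q) * r)" by (auto simp: annulus_def)
      also have "\<dots> \<subseteq> double_ball C0 x y" by (intro ball_sub r1) auto
      finally show "annulus x r \<subseteq> double_ball C0 x y" .
    qed auto
    finally show ?thesis by (simp add: abs_minus_commute)
  qed
  have "ennreal \<bar>u x - u y\<bar> \<le> ennreal C3 * ?I + (ennreal (2 * ?E) * ?I + ennreal C3 * ?I)"
    by (rule order_trans[OF ennreal_abs_triangle add_mono[OF A order_trans[OF ennreal_abs_triangle add_mono[OF C B]]]])
  also have "\<dots> = ennreal C4 * ?I"
  proof -
    have "ennreal C4 = ennreal C3 + (ennreal (2 * ?E) + ennreal C3)"
      using C34_nonneg(1) C_nonneg(3) by (simp add: C4_def flip: ennreal_plus)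
    then show ?thesis by (simp only: distrib_right)
  qed
  finally show ?thesis .
qed

subsection \<open>Curves of small weighted length\<close>

lemma Q_C0: "0 < C0"
  using Q_ge by (simp add: C0_def)

lemma double_ball_measurable [measurable]: "double_ball C x y \<in> sets M"
  by (simp add: double_ball_def)

text \<open>The double ball lies in the ball of radius \<open>(C + 1) * d\<close> about either pole,
  so the two terms of the kernel can be integrated separately.\<close>

lemma nn_integral_riesz:
  assumes "x \<noteq> y" "0 < C"
  shows "(\<integral>\<^sup>+ z \<in> double_ball C x y. ennreal (riesz_kernel M x y z) \<partial>M) \<le> ennreal (4 * D * (C + 1) * dist x y)"
proof -
  define d where "d = dist x y"
  have d: "0 < d" using assms by (simp add: d_def)
  let ?r = "(C + 1) * d"
  have r: "0 < ?r" using d assms by simp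
  have "double_ball C x y \<subseteq> ball x ?r" "double_ball C x y \<subseteq> ball y ?r"
  proof -
    show "double_ball C x y \<subseteq> ball x ?r"
    proof
      fix z assume "z \<in> double_ball C x y"
      then show "z \<in> ball x ?r"
        using dist_triangle[of x z y] d by (auto simp: double_ball_def d_def[symmetric] algebra_simps)
    qed
    show "double_ball C x y \<subseteq> ball y ?r"
    proof
      fix z assume "z \<in> double_ball C x y"
      then have "dist y z < C * d \<or> dist x z < C * d" by (auto simp: double_ball_def d_def)
      moreover have "dist y z \<le> d + dist x z"
        using dist_triangle[of y z x] by (simp add: d_def dist_commute)
      ultimately have "dist y z < C * d + d" using d by linarith
      then show "z \<in> ball y ?r" by (simp add: algebra_simps)
    qed
  qed
  then have "(\<integral>\<^sup>+ z \<in> double_ball C x y. ennreal (riesz_kernel M x y z) \<partial>M)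
    \<le> (\<integral>\<^sup>+ z. ennreal (K x z) * indicator (ball x ?r) z + ennreal (K y z) * indicator (ball y ?r) z \<partial>M)"
    by (intro nn_integral_mono) (auto simp: indicator_def riesz_kernel_eq K_nonneg simp flip: ennreal_plus)
  also have "\<dots> = (\<integral>\<^sup>+ z \<in> ball x ?r. ennreal (K x z) \<partial>M) + (\<integral>\<^sup>+ z \<in> ball y ?r. ennreal (K y z) \<partial>M)"
    by (rule nn_integral_add) measurable
  also have "\<dots> \<le> ennreal (2 * D * ?r) + ennreal (2 * D * ?r)"
    by (intro add_mono nn_integral_K r)
  also have "\<dots> = ennreal (4 * D * (C + 1) * d)"
  proof -
    have "0 \<le> 2 * D * ?r" using D_ge d assms(2) by (intro mult_nonneg_nonneg) auto
    then have "ennreal (2 * D * ?r) + ennreal (2 * D * ?r) = ennreal (2 * D * ?r + 2 * D * ?r)"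
      by (simp only: ennreal_plus)
    then show ?thesis by (simp add: mult_ac)
  qed
  finally show ?thesis by (simp add: d_def)
qed

text \<open>The kernel integral of \<open>\<rho> = g + a\<close> is at most
  \<open>(1 + 4 * D * (C0 + 1)) * a * d\<close>, because that of \<open>g\<close> is at most
  \<open>a * d\<close>; the final summand 1 makes the bound strict.\<close>

definition C5 :: real where "C5 = C4 * (1 + 4 * D * (C0 + 1)) + 1"

lemma C5_ge: "1 \<le> C5"
  using C34_nonneg D_ge Q_C0 by (simp add: C5_def)

theorem curve_small_weighted_length:
  assumes xy: "x \<noteq> y" and g: "continuous_on UNIV g" "\<And>z. 0 \<le> g z" "\<And>z. g z \<le> B" and \<eta>: "0 < \<eta>"
  defines "I \<equiv> enn2real (\<integral>\<^sup>+ z \<in> double_ball C0 x y. ennreal (g z * riesz_kernel M x y z) \<partial>M)"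
  obtains T f where "0 \<le> T" "T \<le> C5 * dist x y" "1-lipschitz_on UNIV f" "\<And>t. t \<le> 0 \<Longrightarrow> f t = x"
    "\<And>t. T \<le> t \<Longrightarrow> f t = y" "integral {0..T} (\<lambda>t. g (f t)) \<le> C5 * (I + \<eta> * dist x y)"
proof -
  define d where "d = dist x y"
  have d: "0 < d" using xy by (simp add: d_def)
  have B: "0 \<le> B" using g(2,3) order_trans by blast
  have R0: "0 \<le> riesz_kernel M x y z" for z by (simp add: riesz_kernel_eq K_nonneg)
  have gm: "g \<in> borel_measurable borel" by (rule borel_measurable_continuous_onI[OF g(1)])
  then have [measurable]: "g \<in> borel_measurable M" by simp
  let ?R = "\<integral>\<^sup>+ z \<in> double_ball C0 x y. ennreal (riesz_kernel M x y z) \<partial>M"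
  let ?J = "\<integral>\<^sup>+ z \<in> double_ball C0 x y. ennreal (g z * riesz_kernel M x y z) \<partial>M"
  let ?S = "4 * D * (C0 + 1)"
  have R: "?R \<le> ennreal (?S * d)"
    unfolding d_def by (rule nn_integral_riesz[OF xy Q_C0])
  have S0: "0 \<le> ?S" using D_ge Q_C0 by simp
  have "?J \<le> (\<integral>\<^sup>+ z. ennreal B * (ennreal (riesz_kernel M x y z) * indicator (double_ball C0 x y) z) \<partial>M)"
  proof (rule nn_integral_mono)
    fix z
    have "ennreal (g z * riesz_kernel M x y z) \<le> ennreal (B * riesz_kernel M x y z)"
      using g(3) R0 by (intro ennreal_leI mult_right_mono) auto
    then show "ennreal (g z * riesz_kernel M x y z) * indicator (double_ball C0 x y) z
      \<le> ennreal B * (ennreal (riesz_kernel M x y z) * indicator (double_ball C0 x y) z)"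
      by (auto simp: indicator_def ennreal_mult'[OF B])
  qed
  also have "\<dots> = ennreal B * ?R" by (rule nn_integral_cmult) measurable
  also have "\<dots> \<le> ennreal B * ennreal (?S * d)" by (intro mult_left_mono R) simp
  also have "\<dots> < \<infinity>" by (simp add: ennreal_mult_less_top)
  finally have I: "?J = ennreal I" by (simp add: I_def)
  have I0: "0 \<le> I" by (simp add: I_def)
  \<comment> \<open>The cost bound \<open>C5 * (a * d)\<close> is then
    \<open>C5 * (I + \<eta> * d)\<close>, and dividing it by the lower bound \<open>a\<close> of
    \<rho> bounds the length by \<open>C5 * d\<close>. The summand \<open>\<eta>\<close> keeps
    \<open>a\<close> positive when \<open>I = 0\<close>.\<close>
  define a where "a = I / d + \<eta>"
  have a: "0 < a" "I \<le> a * d" using I0 d \<eta> by (auto simp: a_def field_simps intro: add_nonneg_pos)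
  define \<rho> where "\<rho> z = g z + a" for z
  have \<rho>: "continuous_on UNIV \<rho>" "\<And>z. 0 \<le> \<rho> z" "\<And>z. \<rho> z \<le> B + a" "\<And>z. a \<le> \<rho> z"
    using g a by (auto simp: \<rho>_def intro!: continuous_intros add_nonneg_nonneg)
  have J\<rho>: "(\<integral>\<^sup>+ z \<in> double_ball C0 x y. ennreal (\<rho> z * riesz_kernel M x y z) \<partial>M) \<le> ennreal ((1 + ?S) * a * d)"
  proof -
    have "(\<integral>\<^sup>+ z \<in> double_ball C0 x y. ennreal (\<rho> z * riesz_kernel M x y z) \<partial>M)
      = (\<integral>\<^sup>+ z. ennreal (g z * riesz_kernel M x y z) * indicator (double_ball C0 x y) z
          + ennreal a * (ennreal (riesz_kernel M x y z) * indicator (double_ball C0 x y) z) \<partial>M)"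
      using g(2) R0 a by (intro nn_integral_cong)
        (auto simp: \<rho>_def indicator_def distrib_right ennreal_plus ennreal_mult')
    also have "\<dots> = ?J + ennreal a * ?R"
      by (subst nn_integral_add) (auto simp: nn_integral_cmult)
    also have "\<dots> \<le> ennreal (a * d) + ennreal a * ennreal (?S * d)"
      using a by (intro add_mono mult_left_mono R) (auto simp: I intro: ennreal_leI)
    also have "\<dots> = ennreal ((1 + ?S) * a * d)"
    proof -
      have "ennreal a * ennreal (?S * d) = ennreal (a * (?S * d))" using a by (simp add: ennreal_mult')
      then have "ennreal (a * d) + ennreal a * ennreal (?S * d) = ennreal (a * d + a * (?S * d))"
        using a d S0 by (simp add: ennreal_plus)
      also have "a * d + a * (?S * d) = (1 + ?S) * a * d" by (simp add: algebra_simps)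
      finally show ?thesis .
    qed
    finally show ?thesis .
  qed
  define k where "k = C5 * (a * d)"
  have kpos: "C4 * ((1 + ?S) * a * d) < k" using a d by (simp add: k_def C5_def algebra_simps)
  have k0: "0 \<le> k" using C5_ge a d by (simp add: k_def)
  have chains: "\<exists>c\<in>chain_costs \<rho> \<delta> x y. c \<le> k" if \<delta>: "0 < \<delta>" for \<delta>
  proof -
    let ?u = "chain_cost \<rho> \<delta> k x"
    have adm: "admissible ?u \<rho>" by (rule chain_cost_admissible[OF \<rho>(1-3) \<delta> k0])
    have "ennreal \<bar>?u x - ?u y\<bar> \<le> ennreal C4 * ennreal ((1 + ?S) * a * d)"
      by (rule order_trans[OF two_point_estimate[OF adm xy] mult_left_mono[OF J\<rho>]]) simp
    also have "\<dots> = ennreal (C4 * ((1 + ?S) * a * d))"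
      by (rule ennreal_mult'[symmetric, OF C34_nonneg(2)])
    finally have "\<bar>?u x - ?u y\<bar> \<le> C4 * ((1 + ?S) * a * d)"
      using C34_nonneg S0 a d by (subst (asm) ennreal_le_iff) (auto intro!: mult_nonneg_nonneg)
    moreover have "?u x = 0" by (rule chain_cost_start[OF \<rho>(2,3) \<delta> k0])
    ultimately have "?u y < k" using kpos by simp
    from chain_cost_less_imp_chain[OF this] show ?thesis by (auto intro: less_imp_le)
  qed
  obtain T f where f: "0 \<le> T" "T \<le> k / a" "1-lipschitz_on UNIV f" "\<And>t. t \<le> 0 \<Longrightarrow> f t = x"
    "\<And>t. T \<le> t \<Longrightarrow> f t = y" "integral {0..T} (\<lambda>t. \<rho> (f t)) \<le> k"
    by (rule chain_limit[OF compact_cball_doubling \<rho>(1) a(1) \<rho>(4) chains], assumption) (rule that; assumption)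
  have int: "(\<lambda>t. h (f t)) integrable_on {0..T}" if "continuous_on UNIV h" for h :: "'a \<Rightarrow> real"
    using continuous_on_compose2[OF that lipschitz_on_continuous_on[OF lipschitz_on_subset[OF f(3)]], of "{0..T}"]
    by (intro integrable_continuous_real) auto
  have "integral {0..T} (\<lambda>t. g (f t)) \<le> integral {0..T} (\<lambda>t. \<rho> (f t))"
    by (rule integral_le[OF int[OF g(1)] int[OF \<rho>(1)]]) (use a in \<open>simp add: \<rho>_def\<close>)
  also have "\<dots> \<le> k" by (rule f(6))
  also have "k = C5 * (I + \<eta> * d)" using d by (simp add: k_def a_def distrib_right)
  finally show thesis using that[OF f(1) _ f(3-5)] f(2) a by (simp add: k_def d_def)
qed

end

section \<open>Compactness of a space of curves\<close>

text \<open>A curve on \<open>{0..T}\<close> is stored as \<open>T\<close> and its extension by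
  constants to the whole line. For complete \<open>'a\<close> such pairs live in a complete metric
  space with the supremum distance on the functions, as \<open>real_coding\<close> requires.\<close>

definition curve_pairs :: "real \<Rightarrow> 'a::metric_space \<Rightarrow> 'a \<Rightarrow> (real \<times> (real \<Rightarrow>\<^sub>C 'a)) set" where
  "curve_pairs S x y = {(T, f). 0 \<le> T \<and> T \<le> S \<and> 1-lipschitz_on UNIV (apply_bcontfun f) \<and>
     (\<forall>t\<le>0. apply_bcontfun f t = x) \<and> (\<forall>t\<ge>T. apply_bcontfun f t = y)}"

lemma curve_pairsD:
  assumes "(T, f) \<in> curve_pairs S x y"
  shows "0 \<le> T" "T \<le> S" "1-lipschitz_on UNIV (apply_bcontfun f)"
    "\<And>t. t \<le> 0 \<Longrightarrow> apply_bcontfun f t = x" "\<And>t. T \<le> t \<Longrightarrow> apply_bcontfun f t = y"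
  using assms by (auto simp: curve_pairs_def)

lemma curve_pairs_range:
  assumes "(T, f) \<in> curve_pairs S x y"
  shows "apply_bcontfun f t \<in> cball x S"
proof -
  note c = curve_pairsD[OF assms]
  define t' where "t' = max 0 (min t T)"
  have "apply_bcontfun f t = apply_bcontfun f t'"
    using c(1) c(4)[of t] c(4)[of 0] c(5)[of t] c(5)[of T] by (auto simp: t'_def min_def max_def)
  moreover have "dist (apply_bcontfun f 0) (apply_bcontfun f t') \<le> t'"
    using lipschitz_onD[OF c(3), of 0 t'] by (simp add: t'_def dist_real_def)
  moreover have "t' \<le> S" using c(1,2) by (simp add: t'_def)
  ultimately show ?thesis using c(4)[of 0] by simp
qed

lemma compact_curve_pairs:
  fixes x y :: "'a::metric_space"
  assumes proper: "\<And>r. compact (cball x r)"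
  shows "compact (curve_pairs S x y)"
  unfolding compact_eq_seq_compact_metric seq_compact_def
proof (intro allI impI)
  fix p :: "nat \<Rightarrow> real \<times> (real \<Rightarrow>\<^sub>C 'a)" assume p: "\<forall>n. p n \<in> curve_pairs S x y"
  define T f where "T n = fst (p n)" and "f n = snd (p n)" for n
  have Tf: "(T n, f n) \<in> curve_pairs S x y" for n using p by (simp add: T_def f_def)
  note c = curve_pairsD[OF Tf]
  have "T n \<in> {0..S}" for n using c(1,2) by simp
  then obtain T0 r1 where r1: "T0 \<in> {0..S}" "strict_mono r1" "(T \<circ> r1) \<longlonglongrightarrow> T0"
    using compact_imp_seq_compact[OF compact_Icc[of 0 S]] unfolding seq_compact_def by metis
  obtain r2 g where r2: "strict_mono (r2::nat\<Rightarrow>nat)" "\<And>t. (\<lambda>n. apply_bcontfun (f (r1 (r2 n))) t) \<longlonglongrightarrow> g t"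
      and gY: "\<And>t. g t \<in> cball x S" and g: "1-lipschitz_on UNIV g"
  proof (rule Arzela_Ascoli_almost_lipschitz[of "cball x S" "\<lambda>k. apply_bcontfun (f (r1 k))" "\<lambda>k. 0"])
    show "apply_bcontfun (f (r1 n)) t \<in> cball x S" for n t by (rule curve_pairs_range[OF Tf])
    show "dist (apply_bcontfun (f (r1 n)) s) (apply_bcontfun (f (r1 n)) t) \<le> \<bar>s - t\<bar> + 0" for n s t
      using lipschitz_onD[OF c(3), of s t] by (simp add: dist_real_def)
  qed (use proper in auto)
  define r where "r = r1 \<circ> r2"
  have rmono: "strict_mono r" unfolding r_def by (rule strict_mono_o[OF r1(2) r2(1)])
  have conv: "(\<lambda>n. apply_bcontfun (f (r n)) t) \<longlonglongrightarrow> g t" for t using r2 by (simp add: r_def)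
  have Tconv: "(\<lambda>n. T (r n)) \<longlonglongrightarrow> T0"
    using LIMSEQ_subseq_LIMSEQ[OF r1(3) r2(1)] by (simp add: o_def r_def)
  have gx: "g t = x" if "t \<le> 0" for t
    using LIMSEQ_unique[OF conv[of t]] c(4)[OF that] by simp
  have gy: "g t = y" if "T0 < t" for t
  proof -
    have "\<forall>\<^sub>F n in sequentially. T (r n) < t" using Tconv that by (rule order_tendstoD)
    then have "\<forall>\<^sub>F n in sequentially. apply_bcontfun (f (r n)) t = y" by eventually_elim (simp add: c(5))
    then have "(\<lambda>n. apply_bcontfun (f (r n)) t) \<longlonglongrightarrow> y" by (rule tendsto_eventually)
    then show ?thesis using LIMSEQ_unique[OF conv[of t]] by blast
  qed
  have gy': "g t = y" if "T0 \<le> t" for t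
  proof -
    have "dist (g t) y \<le> 0"
    proof (rule field_le_epsilon)
      fix e :: real assume "0 < e"
      then show "dist (g t) y \<le> 0 + e"
        using lipschitz_onD[OF g, of t "t + e"] gy[of "t + e"] that by (simp add: dist_real_def)
    qed
    then show ?thesis by simp
  qed
  have "bounded (range g)" by (rule bounded_subset[OF bounded_cball[of x S]]) (use gY in auto)
  then have "g \<in> bcontfun"
    unfolding bcontfun_def using lipschitz_on_continuous_on[OF g] by auto
  then obtain G where G: "g = apply_bcontfun G" by (rule bcontfunE)
  have "(\<lambda>n. f (r n)) \<longlonglongrightarrow> G"
  proof (rule metric_LIMSEQ_I)
    fix e :: real assume e: "0 < e"
    have "compact {0..S}" by simp
    \<comment> \<open>Pointwise convergence on a finite net of \<open>{0..S}\<close> is uniform up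
      to \<open>e\<close>, since all functions are 1-Lipschitz and constant on both sides of this
      interval.\<close>
    then obtain k where k: "finite k" "{0..S} \<subseteq> (\<Union>q\<in>k. ball q (e/6))"
      unfolding compact_eq_totally_bounded using e by (meson divide_pos_pos zero_less_numeral)
    have "\<forall>\<^sub>F n in sequentially. \<forall>q\<in>k. dist (apply_bcontfun (f (r n)) q) (g q) < e/6"
      using k(1) e by (intro eventually_ball_finite ballI tendstoD[OF conv]) auto
    then have "\<forall>\<^sub>F n in sequentially. dist (f (r n)) G < e"
    proof eventually_elim
      case (elim n)
      have near: "dist (apply_bcontfun (f (r n)) t) (g t) \<le> e/2" for t
      proof -
        define t' where "t' = max 0 (min t S)"
        have S0: "0 \<le> S" using c(1,2) order_trans by blast
        have ft: "apply_bcontfun (f (r n)) t = apply_bcontfun (f (r n)) t'"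
        proof (cases "t \<le> 0")
          case True then show ?thesis using c(4)[of t] c(4)[of 0] S0 by (simp add: t'_def)
        next
          case False
          then show ?thesis using c(5)[of "r n" t] c(5)[of "r n" S] c(2)[of "r n"] S0 by (cases "t \<le> S") (auto simp: t'_def)
        qed
        have gt: "g t = g t'"
        proof (cases "t \<le> 0")
          case True then show ?thesis using gx[of t] gx[of 0] S0 by (simp add: t'_def)
        next
          case False
          then show ?thesis using gy'[of t] gy'[of S] r1(1) S0 by (cases "t \<le> S") (auto simp: t'_def)
        qed
        have "t' \<in> {0..S}" using S0 by (simp add: t'_def)
        then obtain q where q: "q \<in> k" "dist q t' < e/6" using k(2) by (auto simp: subset_iff)
        have "dist (apply_bcontfun (f (r n)) t') (apply_bcontfun (f (r n)) q) \<le> e/6" "dist (g q) (g t') \<le> e/6"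
          using lipschitz_onD[OF c(3), of t' q "r n"] lipschitz_onD[OF g, of q t'] q(2)
          by (simp_all add: dist_commute)
        moreover have "dist (apply_bcontfun (f (r n)) q) (g q) < e/6" using elim q(1) by blast
        ultimately show ?thesis
          unfolding ft gt
          using dist_triangle[of "apply_bcontfun (f (r n)) t'" "g t'" "apply_bcontfun (f (r n)) q"]
            dist_triangle[of "apply_bcontfun (f (r n)) q" "g t'" "g q"] by linarith
      qed
      have "dist (f (r n)) G \<le> e/2" by (rule dist_bound) (use near G in simp)
      then show ?case using e by simp
    qed
    then show "\<exists>no. \<forall>n\<ge>no. dist (f (r n)) G < e" by (simp add: eventually_sequentially)
  qed
  then have "(\<lambda>n. (T (r n), f (r n))) \<longlonglongrightarrow> (T0, G)" using Tconv by (intro tendsto_Pair)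
  then have "(p \<circ> r) \<longlonglongrightarrow> (T0, G)" by (simp add: T_def f_def o_def)
  moreover have "(T0, G) \<in> curve_pairs S x y"
    using r1(1) g gx gy' by (auto simp: curve_pairs_def G)
  ultimately show "\<exists>l\<in>curve_pairs S x y. \<exists>r. strict_mono r \<and> (p \<circ> r) \<longlonglongrightarrow> l" using rmono by blast
qed

section \<open>Line integrals in parameter time\<close>

definition line_integral :: "('a::metric_space \<Rightarrow> real) \<Rightarrow> real \<times> (real \<Rightarrow>\<^sub>C 'a) \<Rightarrow> real" where
  "line_integral h p = integral {0..fst p} (\<lambda>t. h (apply_bcontfun (snd p) t))"

lemma integrable_comp_bcontfun:
  fixes h :: "'a::metric_space \<Rightarrow> real" and f :: "real \<Rightarrow>\<^sub>C 'a"
  assumes "continuous_on UNIV h"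
  shows "(\<lambda>t. h (apply_bcontfun f t)) integrable_on {a..b}"
  by (rule integrable_continuous_real, rule continuous_on_compose2[OF assms]) auto

text \<open>Beyond \<open>fst p\<close> the extension rests at \<open>y\<close>, so the integral can
  be taken over a domain that does not depend on \<open>p\<close>. Continuity in \<open>p\<close>
  becomes visible in this form.\<close>

lemma line_integral_eq:
  fixes h :: "'a::metric_space \<Rightarrow> real"
  assumes h: "continuous_on UNIV h" and p: "p \<in> curve_pairs S x y"
  shows "line_integral h p = integral {0..S} (\<lambda>t. h (apply_bcontfun (snd p) t)) - (S - fst p) * h y"
proof -
  obtain T f where pf: "p = (T, f)" by (cases p)
  note c = curve_pairsD[OF p[unfolded pf]]
  have "integral {0..T} (\<lambda>t. h (apply_bcontfun f t)) + integral {T..S} (\<lambda>t. h (apply_bcontfun f t)) = integral {0..S} (\<lambda>t. h (apply_bcontfun f t))"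
    by (rule Henstock_Kurzweil_Integration.integral_combine[OF c(1,2) integrable_comp_bcontfun[OF h]])
  moreover have "integral {T..S} (\<lambda>t. h (apply_bcontfun f t)) = integral {T..S} (\<lambda>t. h y)"
    by (rule Henstock_Kurzweil_Integration.integral_cong) (use c(5) in auto)
  ultimately show ?thesis using c(2) by (simp add: line_integral_def pf)
qed

lemma continuous_line_integral:
  fixes h :: "'a::metric_space \<Rightarrow> real"
  assumes h: "L-lipschitz_on UNIV h"
  shows "continuous_on (curve_pairs S x y) (line_integral h)"
proof (cases "0 \<le> S")
  case False
  then have "curve_pairs S x y = {}" by (auto simp: curve_pairs_def)
  then show ?thesis by simp
next
  case S: True
  have hc: "continuous_on UNIV h" by (rule lipschitz_on_continuous_on[OF h])
  have "(L * S)-lipschitz_on UNIV (\<lambda>f. integral {0..S} (\<lambda>t. h (apply_bcontfun f t)))"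
  proof (rule lipschitz_onI)
    fix f g :: "real \<Rightarrow>\<^sub>C 'a"
    have "dist (integral {0..S} (\<lambda>t. h (apply_bcontfun f t))) (integral {0..S} (\<lambda>t. h (apply_bcontfun g t)))
      = norm (integral {0..S} (\<lambda>t. h (apply_bcontfun f t) - h (apply_bcontfun g t)))"
      by (simp add: dist_norm Henstock_Kurzweil_Integration.integral_diff integrable_comp_bcontfun[OF hc])
    also have "\<dots> \<le> (L * dist f g) * (S - 0)"
    proof (rule integral_bound[OF S])
      show "continuous_on {0..S} (\<lambda>t. h (apply_bcontfun f t) - h (apply_bcontfun g t))"
        by (intro continuous_intros continuous_on_compose2[OF hc]) auto
      fix t
      have "norm (h (apply_bcontfun f t) - h (apply_bcontfun g t)) \<le> L * dist (apply_bcontfun f t) (apply_bcontfun g t)"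
        using lipschitz_onD[OF h, of "apply_bcontfun f t" "apply_bcontfun g t"] by (simp add: dist_real_def)
      also have "\<dots> \<le> L * dist f g" using lipschitz_on_nonneg[OF h] by (intro mult_left_mono dist_bounded)
      finally show "norm (h (apply_bcontfun f t) - h (apply_bcontfun g t)) \<le> L * dist f g" .
    qed
    finally show "dist (integral {0..S} (\<lambda>t. h (apply_bcontfun f t))) (integral {0..S} (\<lambda>t. h (apply_bcontfun g t))) \<le> L * S * dist f g"
      by (simp add: mult_ac)
  qed (use S lipschitz_on_nonneg[OF h] in auto)
  then have c: "continuous_on UNIV (\<lambda>f. integral {0..S} (\<lambda>t. h (apply_bcontfun f t)))"
    by (rule lipschitz_on_continuous_on)
  have "continuous_on (curve_pairs S x y) (\<lambda>p. integral {0..S} (\<lambda>t. h (apply_bcontfun (snd p) t)) - (S - fst p) * h y)"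
    by (intro continuous_intros continuous_on_compose2[OF c]) auto
  then show ?thesis
    by (rule continuous_on_eq) (simp add: line_integral_eq[OF hc])
qed

lemma line_integral_nonneg:
  fixes h :: "'a::metric_space \<Rightarrow> real"
  assumes "continuous_on UNIV h" "\<And>z. 0 \<le> h z"
  shows "0 \<le> line_integral h p"
  unfolding line_integral_def
  by (rule Henstock_Kurzweil_Integration.integral_nonneg[OF integrable_comp_bcontfun[OF assms(1)]]) (use assms in auto)

lemma line_integral_le:
  fixes h :: "'a::metric_space \<Rightarrow> real"
  assumes "continuous_on UNIV h" "\<And>z. h z \<le> 1" "p \<in> curve_pairs S x y"
  shows "line_integral h p \<le> S"
proof -
  obtain T f where pf: "p = (T, f)" by (cases p)
  note c = curve_pairsD[OF assms(3)[unfolded pf]]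
  have "line_integral h p \<le> integral {0..T} (\<lambda>t. 1)"
    unfolding line_integral_def pf fst_conv snd_conv
    by (rule integral_le[OF integrable_comp_bcontfun[OF assms(1)]]) (use assms(2) in \<open>auto intro: integrable_const_ivl\<close>)
  then show ?thesis using c by simp
qed

lemma line_integral_sum:
  fixes h :: "nat \<Rightarrow> 'a::metric_space \<Rightarrow> real"
  assumes "\<And>i. continuous_on UNIV (h i)"
  shows "line_integral (\<lambda>z. \<Sum>i<n. w i * h i z) p = (\<Sum>i<n. w i * line_integral (h i) p)"
  unfolding line_integral_def
  by (subst Henstock_Kurzweil_Integration.integral_sum)
    (auto intro!: integrable_comp_bcontfun continuous_intros assms)

section \<open>Approachability\<close>

text \<open>Controls the test that enters the potential at time \<open>k + 1\<close>: its excess is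
  at most \<open>(k + 1) * b\<close> and its weight is \<open>1 / 2 ^ k\<close>.\<close>

lemma Suc_square_le: "(real k + 1)\<^sup>2 \<le> 4 * 2 ^ k"
proof (induction k)
  case (Suc k)
  consider "k = 0" | "k = 1" | "k \<ge> 2" by linarith
  then show ?case
  proof cases
    case 3
    then have "(real k + 2)\<^sup>2 \<le> 2 * (real k + 1)\<^sup>2"
    proof -
      have "2 * 2 \<le> real k * real k" using 3 by (intro mult_mono) auto
      then show ?thesis by (simp add: power2_eq_square algebra_simps)
    qed
    then show ?thesis using Suc by (simp add: algebra_simps)
  qed (auto simp: power2_eq_square)
qed simp

text \<open>
  Blackwell's strategy: the next point is chosen against the test that weights the \<open>i\<close>-th one
  by the positive part of its accumulated excess.
\<close>

theorem approachability:
  fixes F :: "nat \<Rightarrow> 'p \<Rightarrow> real" and \<Lambda> :: "nat \<Rightarrow> real"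
  assumes bound: "\<And>i p. p \<in> K \<Longrightarrow> \<bar>F i p - \<Lambda> i\<bar> \<le> b"
    and choice: "\<And>n w. (\<And>i. 0 \<le> w i) \<Longrightarrow> \<exists>p\<in>K. (\<Sum>i<n. w i * F i p) \<le> (\<Sum>i<n. w i * \<Lambda> i) + 1"
  obtains p :: "nat \<Rightarrow> 'p" and c :: real where "\<And>n. p n \<in> K" "0 \<le> c"
    "\<And>i n. i < n \<Longrightarrow> (\<Sum>j<n. F i (p j)) / real n \<le> \<Lambda> i + sqrt (2 ^ i * c / real n)"
proof -
  define pos where "pos v = max 0 v" for v :: real
  define good where "good U n q \<longleftrightarrow> q \<in> K \<and>
    (\<Sum>i<n. pos (U i) / 2 ^ i * F i q) \<le> (\<Sum>i<n. pos (U i) / 2 ^ i * \<Lambda> i) + 1" for U n q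
  define pick where "pick U n = (SOME q. good U n q)" for U n
  have pick: "good U n (pick U n)" for U n
  proof -
    have "\<exists>q\<in>K. (\<Sum>i<n. pos (U i) / 2 ^ i * F i q) \<le> (\<Sum>i<n. pos (U i) / 2 ^ i * \<Lambda> i) + 1"
      by (rule choice) (simp add: pos_def)
    then have "\<exists>q. good U n q" by (auto simp: good_def)
    then show ?thesis unfolding pick_def by (rule someI_ex)
  qed
  define U where "U = rec_nat (\<lambda>i. 0) (\<lambda>n U i. U i + (F i (pick U n) - \<Lambda> i))"
  define p where "p n = pick (U n) n" for n
  have U0: "U 0 i = 0" and US: "U (Suc n) i = U n i + (F i (p n) - \<Lambda> i)" for n i
    by (auto simp: U_def p_def)
  have pK: "p n \<in> K" for n using pick[of "U n" n] by (simp add: p_def good_def)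
  have psum: "(\<Sum>i<n. pos (U n i) / 2 ^ i * (F i (p n) - \<Lambda> i)) \<le> 1" for n
    using pick[of "U n" n] by (simp add: p_def good_def right_diff_distrib sum_subtractf)
  have Ueq: "U n i = (\<Sum>j<n. F i (p j)) - real n * \<Lambda> i" for n i
    by (induction n) (auto simp: U0 US algebra_simps)
  have b0: "0 \<le> b" using bound[OF pK, of 0 0] by linarith
  have Ubound: "\<bar>U n i\<bar> \<le> real n * b" for n i
  proof (induction n)
    case (Suc n)
    then show ?case using bound[OF pK[of n], of i] by (simp add: US algebra_simps)
  qed (simp add: U0)
  define \<Psi> where "\<Psi> n = (\<Sum>i<n. (pos (U n i))\<^sup>2 / 2 ^ i)" for n
  define c where "c = 2 + 6 * b\<^sup>2"
  have pos2: "(pos (u + a))\<^sup>2 \<le> (pos u)\<^sup>2 + 2 * pos u * a + a\<^sup>2" for u a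
  proof -
    have "pos (u + a) \<le> \<bar>pos u + a\<bar>" "0 \<le> pos (u + a)" by (auto simp: pos_def)
    then have "(pos (u + a))\<^sup>2 \<le> \<bar>pos u + a\<bar>\<^sup>2" by (intro power_mono)
    then show ?thesis by (simp add: power2_sum algebra_simps)
  qed
  have \<Psi>S: "\<Psi> (Suc n) \<le> \<Psi> n + c" for n
  proof -
    let ?a = "\<lambda>i. F i (p n) - \<Lambda> i"
    have a2: "(?a i)\<^sup>2 \<le> b\<^sup>2" for i
      using power_mono[OF bound[OF pK[of n], of i], of 2] by simp
    have "(\<Sum>i<n. (pos (U (Suc n) i))\<^sup>2 / 2 ^ i)
      \<le> (\<Sum>i<n. (pos (U n i))\<^sup>2 / 2 ^ i + 2 * (pos (U n i) / 2 ^ i * ?a i) + b\<^sup>2 * (1/2) ^ i)"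
    proof (rule sum_mono)
      fix i
      have "(pos (U (Suc n) i))\<^sup>2 / 2 ^ i \<le> ((pos (U n i))\<^sup>2 + 2 * pos (U n i) * ?a i + b\<^sup>2) / 2 ^ i"
        using pos2[of "U n i" "?a i"] a2[of i] by (intro divide_right_mono) (auto simp: US)
      then show "(pos (U (Suc n) i))\<^sup>2 / 2 ^ i \<le> (pos (U n i))\<^sup>2 / 2 ^ i + 2 * (pos (U n i) / 2 ^ i * ?a i) + b\<^sup>2 * (1/2) ^ i"
        by (simp add: add_divide_distrib power_divide)
    qed
    also have "\<dots> = \<Psi> n + 2 * (\<Sum>i<n. pos (U n i) / 2 ^ i * ?a i) + b\<^sup>2 * (\<Sum>i<n. (1/2) ^ i)"
      by (simp add: \<Psi>_def sum.distrib sum_distrib_left)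
    also have "\<dots> \<le> \<Psi> n + 2 * 1 + b\<^sup>2 * 2"
    proof -
      have "(\<Sum>i<n. (1/2 :: real) ^ i) \<le> 2" by (simp add: geometric_sum)
      then show ?thesis using psum[of n] by (intro add_mono mult_left_mono) auto
    qed
    finally have 1: "(\<Sum>i<n. (pos (U (Suc n) i))\<^sup>2 / 2 ^ i) \<le> \<Psi> n + 2 + 2 * b\<^sup>2" by simp
    have "(pos (U (Suc n) n))\<^sup>2 \<le> (real (Suc n) * b)\<^sup>2"
      using Ubound[of "Suc n" n] b0 by (intro power_mono) (auto simp: pos_def)
    also have "\<dots> = (real n + 1)\<^sup>2 * b\<^sup>2" by (simp add: power_mult_distrib add.commute)
    also have "\<dots> \<le> (4 * 2 ^ n) * b\<^sup>2" by (intro mult_right_mono Suc_square_le) auto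
    finally have "(pos (U (Suc n) n))\<^sup>2 / 2 ^ n \<le> 4 * b\<^sup>2" by (simp add: field_simps)
    then show ?thesis using 1 by (simp add: \<Psi>_def c_def)
  qed
  have \<Psi>: "\<Psi> n \<le> real n * c" for n
  proof (induction n)
    case (Suc n) then show ?case using \<Psi>S[of n] by (simp add: algebra_simps)
  qed (simp add: \<Psi>_def)
  show thesis
  proof (rule that[OF pK])
    show "0 \<le> c" by (simp add: c_def)
    fix i n :: nat assume i: "i < n"
    have n0: "0 < real n" using i by simp
    have "(pos (U n i))\<^sup>2 / 2 ^ i \<le> \<Psi> n"
      unfolding \<Psi>_def by (rule member_le_sum) (use i in auto)
    also have "\<dots> \<le> real n * c" by (rule \<Psi>)
    finally have "(pos (U n i))\<^sup>2 \<le> 2 ^ i * (real n * c)" by (simp add: field_simps)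
    then have "(pos (U n i) / real n)\<^sup>2 \<le> 2 ^ i * c / real n"
      using n0 by (simp add: power_divide power2_eq_square[of "real n"] field_simps)
    then have "pos (U n i) / real n \<le> sqrt (2 ^ i * c / real n)" by (rule real_le_rsqrt)
    moreover have "U n i / real n \<le> pos (U n i) / real n" using n0 by (intro divide_right_mono) (auto simp: pos_def)
    moreover have "U n i / real n = (\<Sum>j<n. F i (p j)) / real n - \<Lambda> i" using n0 by (simp add: Ueq diff_divide_distrib)
    ultimately show "(\<Sum>j<n. F i (p j)) / real n \<le> \<Lambda> i + sqrt (2 ^ i * c / real n)" by linarith
  qed
qed

section \<open>Random curves\<close>

text \<open>For positive \<open>n\<close> and nonempty \<open>F\<close>, a cutoff equal to 1 within
  \<open>1 / n\<close> of \<open>F\<close> and to 0 beyond \<open>2 / n\<close>. With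
  \<open>F\<close> ranging over the finite subsets of a countable set there are only countably many,
  yet they suffice to approximate compact sets.\<close>

definition test_fun :: "'a::metric_space set \<Rightarrow> nat \<Rightarrow> 'a \<Rightarrow> real" where
  "test_fun F n z = max 0 (min 1 (2 - real n * infdist z F))"

lemma test_fun_bounds: "0 \<le> test_fun F n z" "test_fun F n z \<le> 1"
  by (auto simp: test_fun_def)

lemma test_fun_lipschitz: "(real n)-lipschitz_on UNIV (test_fun F n)"
proof (rule lipschitz_onI)
  fix z w :: 'a
  have "\<bar>infdist z F - infdist w F\<bar> \<le> dist z w"
    using infdist_triangle[of z F w] infdist_triangle[of w F z] by (simp add: dist_commute)
  then have "real n * \<bar>infdist z F - infdist w F\<bar> \<le> real n * dist z w" by (intro mult_left_mono) auto
  moreover have "\<bar>real n * infdist z F - real n * infdist w F\<bar> = real n * \<bar>infdist z F - infdist w F\<bar>"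
    by (simp add: abs_mult flip: right_diff_distrib)
  ultimately show "dist (test_fun F n z) (test_fun F n w) \<le> real n * dist z w"
    unfolding test_fun_def dist_real_def by linarith
qed simp

lemma test_fun_continuous: "continuous_on UNIV (test_fun F n)"
  by (rule lipschitz_on_continuous_on[OF test_fun_lipschitz])

lemma test_fun_eq_1:
  assumes "c \<in> F" "dist z c \<le> 1 / real n" "0 < n"
  shows "test_fun F n z = 1"
proof -
  have "infdist z F \<le> 1 / real n" using infdist_le2[OF assms(1,2)] .
  then have "real n * infdist z F \<le> 1" using assms(3) by (simp add: field_simps)
  then show ?thesis by (simp add: test_fun_def)
qed

lemma test_fun_support:
  assumes "F \<noteq> {}" "\<And>c. c \<in> F \<Longrightarrow> \<exists>w\<in>Z. dist c w \<le> 1 / real n" "0 < n" "0 < test_fun F n z"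
  shows "infdist z Z < 3 / real n"
proof -
  have "real n * infdist z F < 2" using assms(4) by (auto simp: test_fun_def max_def min_def split: if_splits)
  then have lt: "infdist z F < 2 / real n" using assms(3) by (simp add: field_simps)
  have "\<exists>c\<in>F. dist z c < 2 / real n"
  proof (rule ccontr)
    assume "\<not> ?thesis"
    then have "2 / real n \<le> infdist z F"
      using assms(1) by (auto simp: infdist_def not_less intro!: cINF_greatest)
    then show False using lt by simp
  qed
  then obtain c where c: "c \<in> F" "dist z c < 2 / real n" by blast
  obtain w where w: "w \<in> Z" "dist c w \<le> 1 / real n" using assms(2)[OF c(1)] by blast
  have "infdist z Z \<le> dist z w" by (rule infdist_le[OF w(1)])
  also have "\<dots> \<le> dist z c + dist c w" by (rule dist_triangle)
  also have "\<dots> < 2 / real n + 1 / real n" using c(2) w(2) by linarith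
  finally show ?thesis by (simp add: add_divide_distrib[symmetric])
qed

text \<open>The neighbourhoods decrease to the closed set \<open>Z\<close>, and a finite measure is
  continuous from above. This is how bounds from test functions are sharpened to bounds for
  sets.\<close>

lemma le_emeasure_of_neighbourhoods:
  fixes \<Lambda> :: "'a::metric_space measure"
  assumes sets_\<Lambda>: "sets \<Lambda> = sets borel" and fin: "emeasure \<Lambda> UNIV < \<infinity>"
    and Z: "compact Z" "Z \<noteq> {}" "Z \<subseteq> A" and A: "A \<in> sets borel"
    and le: "\<And>n. c \<le> emeasure \<Lambda> {z. infdist z Z < 3 / real (Suc n)}"
  shows "c \<le> emeasure \<Lambda> A"
proof -
  define N where "N n = {z. infdist z Z < 3 / real (Suc n)}" for n
  have "open (N n)" for n
    unfolding N_def by (intro open_Collect_less continuous_intros)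
  then have N: "range N \<subseteq> sets \<Lambda>" by (auto simp: sets_\<Lambda>)
  have "decseq N"
  proof (rule decseq_SucI, rule subsetI)
    fix n z assume "z \<in> N (Suc n)"
    moreover have "3 / real (Suc (Suc n)) \<le> 3 / real (Suc n)" by (intro divide_left_mono) auto
    ultimately show "z \<in> N n" by (simp add: N_def del: of_nat_Suc)
  qed
  then have lim: "(\<lambda>n. emeasure \<Lambda> (N n)) \<longlonglongrightarrow> emeasure \<Lambda> (\<Inter>n. N n)"
  proof (rule Lim_emeasure_decseq[OF N])
    show "emeasure \<Lambda> (N n) \<noteq> \<infinity>" for n
      using emeasure_mono[of "N n" UNIV \<Lambda>] fin sets_\<Lambda> by (auto simp: top_unique less_top)
  qed
  have "(\<Inter>n. N n) \<subseteq> Z"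
  proof
    fix z assume z: "z \<in> (\<Inter>n. N n)"
    have "infdist z Z \<le> 0"
    proof (rule LIMSEQ_le_const)
      have "(\<lambda>n. 3 * inverse (real (Suc n))) \<longlonglongrightarrow> 3 * 0" by (intro tendsto_mult tendsto_const LIMSEQ_inverse_real_of_nat)
      then show "(\<lambda>n. 3 / real (Suc n)) \<longlonglongrightarrow> 0" by (simp add: divide_inverse)
      show "\<exists>N. \<forall>n\<ge>N. infdist z Z \<le> 3 / real (Suc n)" using z by (auto simp: N_def intro: less_imp_le simp del: of_nat_Suc)
    qed
    then have "infdist z Z = 0" using infdist_nonneg[of z Z] by simp
    then show "z \<in> Z" using in_closed_iff_infdist_zero[OF compact_imp_closed[OF Z(1)] Z(2)] by blast
  qed
  then have "emeasure \<Lambda> (\<Inter>n. N n) \<le> emeasure \<Lambda> A"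
    using Z(3) A by (intro emeasure_mono) (auto simp: sets_\<Lambda>)
  moreover have "c \<le> emeasure \<Lambda> (\<Inter>n. N n)"
    by (rule LIMSEQ_le_const[OF lim]) (use le in \<open>auto simp: N_def\<close>)
  ultimately show ?thesis by (rule order_trans[rotated])
qed

text \<open>The supremum distance handles the change of the function uniformly in the argument,
  which leaves the continuity of one fixed function.\<close>

lemma continuous_apply_bcontfun_pair:
  fixes f :: "'c::metric_space \<Rightarrow> real \<Rightarrow>\<^sub>C 'a::metric_space"
  assumes "continuous_on P f" "continuous_on P t"
  shows "continuous_on P (\<lambda>p. apply_bcontfun (f p) (t p))"
  unfolding continuous_on_def
proof
  fix p assume p: "p \<in> P"
  let ?F = "at p within P"
  have f: "(f \<longlongrightarrow> f p) ?F" and t: "(t \<longlongrightarrow> t p) ?F" using assms p by (auto simp: continuous_on_def)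
  have t': "((\<lambda>q. apply_bcontfun (f p) (t q)) \<longlongrightarrow> apply_bcontfun (f p) (t p)) ?F"
    by (rule continuous_on_tendsto_compose[OF continuous_on_apply_bcontfun[of UNIV "f p"] t]) auto
  have lim: "((\<lambda>q. dist (f q) (f p) + dist (apply_bcontfun (f p) (t q)) (apply_bcontfun (f p) (t p))) \<longlongrightarrow> 0 + 0) ?F"
    using f t' by (intro tendsto_add) (auto simp: tendsto_dist_iff[symmetric])
  have le: "dist (apply_bcontfun (f q) (t q)) (apply_bcontfun (f p) (t p))
    \<le> dist (f q) (f p) + dist (apply_bcontfun (f p) (t q)) (apply_bcontfun (f p) (t p))" for q
    using dist_triangle[of "apply_bcontfun (f q) (t q)" "apply_bcontfun (f p) (t p)" "apply_bcontfun (f p) (t q)"]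
      dist_bounded[of "f q" "t q" "f p"] by linarith
  have "((\<lambda>q. dist (apply_bcontfun (f q) (t q)) (apply_bcontfun (f p) (t p))) \<longlongrightarrow> 0) ?F"
    by (rule tendsto_sandwich[OF _ _ tendsto_const lim[simplified]]) (use le in auto)
  then show "((\<lambda>q. apply_bcontfun (f q) (t q)) \<longlongrightarrow> apply_bcontfun (f p) (t p)) ?F"
    by (subst tendsto_dist_iff)
qed

context

  \<comment> \<open>Occupation measure of a random curve\<close>
  fixes x y :: "'a::metric_space" and S :: real and Sr :: "real set" and \<phi> :: "real \<Rightarrow> real \<times> (real \<Rightarrow>\<^sub>C 'a)"
    and \<beta> :: "real measure"
  assumes Sr: "compact Sr" and cont: "continuous_on Sr \<phi>" and rng: "\<phi> ` Sr \<subseteq> curve_pairs S x y"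
    and prob: "prob_space \<beta>" and sets_\<beta> [measurable_cong]: "sets \<beta> = sets borel"
begin

definition occupation_region :: "(real \<times> real) set" where
  "occupation_region = {(s, t). s \<in> Sr \<and> 0 \<le> t \<and> t \<le> fst (\<phi> s)}"

definition eval_point :: "real \<times> real \<Rightarrow> 'a" where
  "eval_point p = apply_bcontfun (snd (\<phi> (fst p))) (snd p)"

lemma curve_mem: "s \<in> Sr \<Longrightarrow> (fst (\<phi> s), snd (\<phi> s)) \<in> curve_pairs S x y"
  using rng by auto

lemma compact_occupation_region: "compact occupation_region"
proof -
  have sub: "occupation_region = (Sr \<times> {0..S}) \<inter> {p \<in> Sr \<times> {0..S}. snd p \<le> fst (\<phi> (fst p))}"
    using curve_pairsD(2)[OF curve_mem] by (force simp: occupation_region_def)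
  have "continuous_on (Sr \<times> {0..S}) (\<lambda>p. \<phi> (fst p))"
    by (rule continuous_on_compose2[OF cont]) (auto intro: continuous_intros)
  then have "continuous_on (Sr \<times> {0..S}) (\<lambda>p. fst (\<phi> (fst p)))"
    by (rule continuous_on_fst)
  then have "closed {p \<in> Sr \<times> {0..S}. snd p \<le> fst (\<phi> (fst p))}"
    by (rule continuous_on_closed_Collect_le[OF continuous_on_snd[OF continuous_on_id]])
      (intro closed_Times compact_imp_closed[OF Sr] closed_atLeastAtMost)
  then show ?thesis unfolding sub by (intro compact_Int_closed compact_Times Sr) auto
qed

lemma continuous_eval_point: "continuous_on occupation_region eval_point"
proof -
  have "continuous_on occupation_region (\<lambda>p. \<phi> (fst p))"
    by (rule continuous_on_compose2[OF cont]) (auto simp: occupation_region_def intro: continuous_intros)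
  then show ?thesis
    unfolding eval_point_def[abs_def]
    by (intro continuous_apply_bcontfun_pair continuous_on_snd continuous_on_id)
qed

lemma occupation_region_borel [measurable]: "occupation_region \<in> sets borel"
  using compact_occupation_region by (simp add: compact_imp_closed borel_closed)

lemma sets_product: "sets (\<beta> \<Otimes>\<^sub>M lborel) = sets (borel :: (real \<times> real) measure)"
  using sets_pair_measure_cong[OF sets_\<beta> sets_lborel] by (simp only: borel_prod)

lemma eval_point_preimage:
  assumes "A \<in> sets borel"
  shows "occupation_region \<inter> eval_point -` A \<in> sets borel"
proof -
  have "eval_point \<in> borel_measurable (restrict_space borel occupation_region)"
    by (rule borel_measurable_continuous_on_restrict[OF continuous_eval_point])
  from measurable_sets[OF this assms] show ?thesis
    by (simp add: space_restrict_space sets_restrict_space_iff Int_commute)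
qed

text \<open>Its image under \<open>eval_point\<close> gives the mean time that the random curve
  spends in a set. The measure itself is kept on the plane, where finite Borel measures are inner
  regular; compact subsets of the region have compact images under
  \<open>eval_point\<close>.\<close>

definition occupation :: "(real \<times> real) measure" where
  "occupation = density (\<beta> \<Otimes>\<^sub>M lborel) (indicator occupation_region)"

lemma sets_occupation: "sets occupation = sets borel"
  unfolding occupation_def sets_density by (rule sets_product)

lemma emeasure_occupation:
  assumes B: "B \<in> sets borel"
  shows "emeasure occupation B = (\<integral>\<^sup>+ s \<in> Sr. (\<integral>\<^sup>+ t \<in> {0..fst (\<phi> s)}. indicator B (s, t) \<partial>lborel) \<partial>\<beta>)"
proof -
  have m: "(\<lambda>p. indicator occupation_region p * indicator B p :: ennreal) \<in> borel_measurable (\<beta> \<Otimes>\<^sub>M lborel)"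
    unfolding measurable_cong_sets[OF sets_product refl]
    using B by measurable
  have "emeasure occupation B = (\<integral>\<^sup>+ p. indicator occupation_region p * indicator B p \<partial>(\<beta> \<Otimes>\<^sub>M lborel))"
    unfolding occupation_def
  proof (rule emeasure_density)
    show "(indicator occupation_region :: _ \<Rightarrow> ennreal) \<in> borel_measurable (\<beta> \<Otimes>\<^sub>M lborel)"
      unfolding measurable_cong_sets[OF sets_product refl] by measurable
    show "B \<in> sets (\<beta> \<Otimes>\<^sub>M lborel)" unfolding sets_product by (rule B)
  qed
  also have "\<dots> = (\<integral>\<^sup>+ s. (\<integral>\<^sup>+ t. indicator occupation_region (s, t) * indicator B (s, t) \<partial>lborel) \<partial>\<beta>)"
    by (rule lborel.nn_integral_fst[OF m, symmetric])
  also have "\<dots> = (\<integral>\<^sup>+ s \<in> Sr. (\<integral>\<^sup>+ t \<in> {0..fst (\<phi> s)}. indicator B (s, t) \<partial>lborel) \<partial>\<beta>)"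
  proof (rule nn_integral_cong)
    fix s
    show "(\<integral>\<^sup>+ t. indicator occupation_region (s, t) * indicator B (s, t) \<partial>lborel)
      = (\<integral>\<^sup>+ t \<in> {0..fst (\<phi> s)}. indicator B (s, t) \<partial>lborel) * indicator Sr s"
      by (cases "s \<in> Sr") (auto simp: occupation_region_def indicator_def intro!: nn_integral_cong)
  qed
  finally show ?thesis .
qed

lemma occupation_finite: "emeasure occupation (space occupation) \<noteq> \<infinity>"
proof -
  interpret prob_space \<beta> by (rule prob)
  have "emeasure occupation UNIV = (\<integral>\<^sup>+ s \<in> Sr. (\<integral>\<^sup>+ t \<in> {0..fst (\<phi> s)}. indicator UNIV (s, t) \<partial>lborel) \<partial>\<beta>)"
    by (rule emeasure_occupation) simp
  also have "\<dots> \<le> (\<integral>\<^sup>+ s. ennreal S \<partial>\<beta>)"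
  proof (rule nn_integral_mono)
    fix s
    show "(\<integral>\<^sup>+ t \<in> {0..fst (\<phi> s)}. indicator UNIV (s, t) \<partial>lborel) * indicator Sr s \<le> ennreal S"
      using curve_pairsD(1,2)[OF curve_mem, of s] by (cases "s \<in> Sr") (auto intro: ennreal_leI)
  qed
  also have "\<dots> = ennreal S" by (simp add: emeasure_space_1)
  finally show ?thesis
    using sets_eq_imp_space_eq[OF sets_occupation] by (auto simp: top_unique)
qed

lemma nn_integral_line_integral:
  assumes h: "L-lipschitz_on UNIV h" and h0: "\<And>z. 0 \<le> h z" and h1: "\<And>z. h z \<le> 1"
  shows "(\<integral>\<^sup>+ s \<in> Sr. (\<integral>\<^sup>+ t \<in> {0..fst (\<phi> s)}. ennreal (h (eval_point (s, t))) \<partial>lborel) \<partial>\<beta>)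
    = ennreal (LINT s:Sr|\<beta>. line_integral h (\<phi> s))"
proof -
  interpret prob_space \<beta> by (rule prob)
  have hc: "continuous_on UNIV h" by (rule lipschitz_on_continuous_on[OF h])
  have "continuous_on Sr (\<lambda>s. line_integral h (\<phi> s))"
    by (rule continuous_on_compose2[OF continuous_line_integral[OF h] cont rng])
  then have "(\<lambda>s. indicat_real Sr s *\<^sub>R line_integral h (\<phi> s)) \<in> borel_measurable borel"
    by (intro borel_measurable_continuous_on_indicator borel_closed compact_imp_closed[OF Sr])
  then have m: "(\<lambda>s. indicat_real Sr s *\<^sub>R line_integral h (\<phi> s)) \<in> borel_measurable \<beta>" by simp
  have b: "0 \<le> indicat_real Sr s *\<^sub>R line_integral h (\<phi> s)" "indicat_real Sr s *\<^sub>R line_integral h (\<phi> s) \<le> \<bar>S\<bar>" for s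
  proof -
    show "0 \<le> indicat_real Sr s *\<^sub>R line_integral h (\<phi> s)"
      using line_integral_nonneg[OF hc h0] by (simp add: indicator_def)
    show "indicat_real Sr s *\<^sub>R line_integral h (\<phi> s) \<le> \<bar>S\<bar>"
      using line_integral_le[OF hc h1, of "\<phi> s" S x y] rng by (auto simp: indicator_def image_subset_iff)
  qed
  have "(\<integral>\<^sup>+ s \<in> Sr. (\<integral>\<^sup>+ t \<in> {0..fst (\<phi> s)}. ennreal (h (eval_point (s, t))) \<partial>lborel) \<partial>\<beta>)
    = (\<integral>\<^sup>+ s. ennreal (indicat_real Sr s *\<^sub>R line_integral h (\<phi> s)) \<partial>\<beta>)"
  proof (rule nn_integral_cong)
    fix s
    have "continuous_on {0..fst (\<phi> s)} (\<lambda>t. h (apply_bcontfun (snd (\<phi> s)) t))"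
      by (rule continuous_on_compose2[OF hc]) auto
    from nn_integral_Icc_eq_integral[OF this h0]
    show "(\<integral>\<^sup>+ t \<in> {0..fst (\<phi> s)}. ennreal (h (eval_point (s, t))) \<partial>lborel) * indicator Sr s
      = ennreal (indicat_real Sr s *\<^sub>R line_integral h (\<phi> s))"
      by (auto simp: eval_point_def line_integral_def indicator_def)
  qed
  also have "\<dots> = ennreal (LINT s:Sr|\<beta>. line_integral h (\<phi> s))"
    unfolding set_lebesgue_integral_def
    by (rule nn_integral_eq_integral) (use b m in \<open>auto intro!: integrable_const_bound[where B="\<bar>S\<bar>"]\<close>)
  finally show ?thesis .
qed

text \<open>By inner regularity it is enough to treat a compact \<open>K\<close> in the preimage of
  \<open>A\<close>. Its image \<open>Z\<close> is compact in \<open>A\<close>; a test function that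
  is 1 on \<open>Z\<close> and lives near \<open>Z\<close> bounds the mass of \<open>K\<close>, and
  the neighbourhoods shrink to \<open>Z\<close>. One test function for each \<open>Z\<close> and
  \<open>n\<close> suffices, so countably many inequalities control all Borel sets.\<close>

theorem occupation_le:
  fixes \<Lambda> :: "'a measure"
  assumes sets_\<Lambda>: "sets \<Lambda> = sets borel" and fin: "emeasure \<Lambda> UNIV < \<infinity>"
    and test: "\<And>Z n. compact Z \<Longrightarrow> Z \<noteq> {} \<Longrightarrow> Z \<subseteq> cball x S \<Longrightarrow> 0 < n \<Longrightarrow> \<exists>F. (\<forall>z\<in>Z. test_fun F n z = 1) \<and>
      ennreal (LINT s:Sr|\<beta>. line_integral (test_fun F n) (\<phi> s)) \<le> emeasure \<Lambda> {z. infdist z Z < 3 / real n}"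
    and A: "A \<in> sets borel"
  shows "(\<integral>\<^sup>+ s \<in> Sr. (\<integral>\<^sup>+ t \<in> {0..fst (\<phi> s)}. indicator A (apply_bcontfun (snd (\<phi> s)) t) \<partial>lborel) \<partial>\<beta>) \<le> emeasure \<Lambda> A"
proof -
  let ?B = "occupation_region \<inter> eval_point -` A"
  have B: "?B \<in> sets borel" by (rule eval_point_preimage[OF A])
  have "(\<integral>\<^sup>+ s \<in> Sr. (\<integral>\<^sup>+ t \<in> {0..fst (\<phi> s)}. indicator A (apply_bcontfun (snd (\<phi> s)) t) \<partial>lborel) \<partial>\<beta>)
    = (\<integral>\<^sup>+ s \<in> Sr. (\<integral>\<^sup>+ t \<in> {0..fst (\<phi> s)}. indicator ?B (s, t) \<partial>lborel) \<partial>\<beta>)"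
  proof (rule nn_integral_cong)
    fix s
    show "(\<integral>\<^sup>+ t \<in> {0..fst (\<phi> s)}. indicator A (apply_bcontfun (snd (\<phi> s)) t) \<partial>lborel) * indicator Sr s
      = (\<integral>\<^sup>+ t \<in> {0..fst (\<phi> s)}. indicator ?B (s, t) \<partial>lborel) * indicator Sr s"
      by (cases "s \<in> Sr") (auto simp: occupation_region_def eval_point_def indicator_def intro!: nn_integral_cong)
  qed
  also have "\<dots> = emeasure occupation ?B" by (rule emeasure_occupation[OF B, symmetric])
  also have "\<dots> = (SUP K\<in>{K. K \<subseteq> ?B \<and> compact K}. emeasure occupation K)"
    by (rule inner_regular[OF sets_occupation occupation_finite B])
  also have "\<dots> \<le> emeasure \<Lambda> A"
  proof (rule SUP_least, clarify)
    fix K assume K: "K \<subseteq> ?B" "compact K"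
    have KB: "K \<in> sets borel" using K(2) by (simp add: compact_imp_closed borel_closed)
    define Z where "Z = eval_point ` K"
    show "emeasure occupation K \<le> emeasure \<Lambda> A"
    proof (cases "K = {}")
      case False
      have Z: "compact Z" "Z \<noteq> {}" "Z \<subseteq> A"
        using K False by (auto simp: Z_def intro!: compact_continuous_image continuous_on_subset[OF continuous_eval_point])
      have ZY: "Z \<subseteq> cball x S"
      proof
        fix z assume "z \<in> Z"
        then obtain s t where "(s, t) \<in> occupation_region" "z = eval_point (s, t)" using K by (auto simp: Z_def)
        then show "z \<in> cball x S" using curve_pairs_range[OF curve_mem] by (auto simp: eval_point_def occupation_region_def)
      qed
      have le: "emeasure occupation K \<le> emeasure \<Lambda> {z. infdist z Z < 3 / real (Suc n)}" for n
      proof -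
        obtain F where F: "\<And>z. z \<in> Z \<Longrightarrow> test_fun F (Suc n) z = 1"
          "ennreal (LINT s:Sr|\<beta>. line_integral (test_fun F (Suc n)) (\<phi> s)) \<le> emeasure \<Lambda> {z. infdist z Z < 3 / real (Suc n)}"
          using test[OF Z(1,2) ZY, of "Suc n"] by auto
        have "emeasure occupation K = (\<integral>\<^sup>+ s \<in> Sr. (\<integral>\<^sup>+ t \<in> {0..fst (\<phi> s)}. indicator K (s, t) \<partial>lborel) \<partial>\<beta>)"
          by (rule emeasure_occupation[OF KB])
        also have "\<dots> \<le> (\<integral>\<^sup>+ s \<in> Sr. (\<integral>\<^sup>+ t \<in> {0..fst (\<phi> s)}. ennreal (test_fun F (Suc n) (eval_point (s, t))) \<partial>lborel) \<partial>\<beta>)"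
        proof (intro nn_integral_mono mult_right_mono)
          fix s t :: real
          show "indicator K (s, t) \<le> ennreal (test_fun F (Suc n) (eval_point (s, t)))"
            using F(1)[of "eval_point (s, t)"] by (auto simp: indicator_def Z_def)
        qed auto
        also have "\<dots> = ennreal (LINT s:Sr|\<beta>. line_integral (test_fun F (Suc n)) (\<phi> s))"
          by (rule nn_integral_line_integral[OF test_fun_lipschitz test_fun_bounds])
        finally show ?thesis using F(2) by (rule order_trans)
      qed
      show ?thesis by (rule le_emeasure_of_neighbourhoods[OF sets_\<Lambda> fin Z A le])
    qed simp
  qed
  finally show ?thesis .
qed

end

section \<open>Random curves bounded by the kernel\<close>

context poincare_space
begin

definition kernel_integral :: "'a \<Rightarrow> 'a \<Rightarrow> ('a \<Rightarrow> real) \<Rightarrow> ennreal" where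
  "kernel_integral x y g = (\<integral>\<^sup>+ z \<in> double_ball C0 x y. ennreal (g z * riesz_kernel M x y z) \<partial>M)"

lemma riesz_kernel_nonneg: "0 \<le> riesz_kernel M x y z"
  by (simp add: riesz_kernel_eq K_nonneg)

lemma kernel_integral_le:
  assumes "x \<noteq> y" "\<And>z. g z \<le> 1"
  shows "kernel_integral x y g \<le> ennreal (4 * D * (C0 + 1) * dist x y)"
proof -
  have "kernel_integral x y g \<le> (\<integral>\<^sup>+ z \<in> double_ball C0 x y. ennreal (riesz_kernel M x y z) \<partial>M)"
    unfolding kernel_integral_def
  proof (intro nn_integral_mono mult_right_mono ennreal_leI)
    show "g z * riesz_kernel M x y z \<le> riesz_kernel M x y z" for z
      using mult_right_mono[OF assms(2)[of z] riesz_kernel_nonneg[of x y z]] by simp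
  qed simp
  also have "\<dots> \<le> ennreal (4 * D * (C0 + 1) * dist x y)" by (rule nn_integral_riesz[OF assms(1) Q_C0])
  finally show ?thesis .
qed

lemma kernel_integral_finite:
  assumes "x \<noteq> y" "\<And>z. g z \<le> 1"
  shows "kernel_integral x y g = ennreal (enn2real (kernel_integral x y g))"
proof -
  have "kernel_integral x y g < top"
    using kernel_integral_le[of x y g, OF assms] by (rule le_less_trans) simp
  then show ?thesis by simp
qed

lemma kernel_integral_sum:
  assumes "\<And>i. h i \<in> borel_measurable M" "\<And>i z. 0 \<le> h i z" "\<And>i. 0 \<le> w i"
  shows "kernel_integral x y (\<lambda>z. \<Sum>i<n. w i * h i z) = (\<Sum>i<n. ennreal (w i) * kernel_integral x y (h i))"
proof -
  note [measurable] = assms(1)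
  have "kernel_integral x y (\<lambda>z. \<Sum>i<n. w i * h i z)
    = (\<integral>\<^sup>+ z. (\<Sum>i<n. ennreal (w i) * (ennreal (h i z * riesz_kernel M x y z) * indicator (double_ball C0 x y) z)) \<partial>M)"
    unfolding kernel_integral_def
  proof (rule nn_integral_cong)
    fix z
    have "ennreal ((\<Sum>i<n. w i * h i z) * riesz_kernel M x y z) = ennreal (\<Sum>i<n. w i * (h i z * riesz_kernel M x y z))"
      by (simp add: sum_distrib_right mult.assoc)
    also have "\<dots> = (\<Sum>i<n. ennreal (w i) * ennreal (h i z * riesz_kernel M x y z))"
      using assms(2,3) riesz_kernel_nonneg by (subst sum_ennreal[symmetric]) (auto simp: ennreal_mult')
    finally show "ennreal ((\<Sum>i<n. w i * h i z) * riesz_kernel M x y z) * indicator (double_ball C0 x y) z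
      = (\<Sum>i<n. ennreal (w i) * (ennreal (h i z * riesz_kernel M x y z) * indicator (double_ball C0 x y) z))"
      by (simp add: sum_distrib_right mult.assoc)
  qed
  also have "\<dots> = (\<Sum>i<n. ennreal (w i) * kernel_integral x y (h i))"
    unfolding kernel_integral_def by (subst nn_integral_sum) (auto simp: nn_integral_cmult)
  finally show ?thesis .
qed

text \<open>The existence of a good curve is applied to the single function \<open>g\<close> that
  combines the tests; line integral and kernel integral are both linear in it.\<close>

lemma curve_for_weights:
  fixes h :: "nat \<Rightarrow> 'a \<Rightarrow> real"
  assumes xy: "x \<noteq> y" and h: "\<And>i. continuous_on UNIV (h i)" "\<And>i z. 0 \<le> h i z" "\<And>i z. h i z \<le> 1"
    and w: "\<And>i. 0 \<le> w i"
  shows "\<exists>p\<in>curve_pairs (C5 * dist x y) x y. (\<Sum>i<n. w i * line_integral (h i) p)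
    \<le> (\<Sum>i<n. w i * (C5 * enn2real (kernel_integral x y (h i)))) + 1"
proof -
  define g where "g z = (\<Sum>i<n. w i * h i z)" for z
  define d where "d = dist x y"
  have d: "0 < d" using xy by (simp add: d_def)
  have C5: "0 < C5" using C5_ge by simp
  have g: "continuous_on UNIV g" "\<And>z. 0 \<le> g z" "\<And>z. g z \<le> (\<Sum>i<n. w i)"
  proof -
    show "continuous_on UNIV g" unfolding g_def by (intro continuous_intros h)
    show "0 \<le> g z" for z unfolding g_def by (intro sum_nonneg mult_nonneg_nonneg w h)
    show "g z \<le> (\<Sum>i<n. w i)" for z unfolding g_def
      by (intro sum_mono) (use mult_left_mono[OF h(3) w] in auto)
  qed
  \<comment> \<open>With this \<open>\<eta>\<close> the error \<open>C5 * (\<eta> * d)\<close>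
    equals 1, the slack that \<open>approachability\<close> permits.\<close>
  have \<eta>: "0 < 1 / (C5 * d)" using C5 d by simp
  obtain T f where f: "0 \<le> T" "T \<le> C5 * dist x y" "1-lipschitz_on UNIV f" "\<And>t. t \<le> 0 \<Longrightarrow> f t = x"
    "\<And>t. T \<le> t \<Longrightarrow> f t = y"
    "integral {0..T} (\<lambda>t. g (f t)) \<le> C5 * (enn2real (kernel_integral x y g) + 1 / (C5 * d) * dist x y)"
    by (rule curve_small_weighted_length[OF xy g \<eta>, folded kernel_integral_def]) (rule that; assumption)
  have "f \<in> bcontfun"
  proof -
    have "f t \<in> cball x T" for t
    proof -
      define t' where "t' = max 0 (min t T)"
      have "f t = f t'" using f(1) f(4)[of t] f(4)[of 0] f(5)[of t] f(5)[of T] by (auto simp: t'_def min_def max_def)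
      moreover have "dist (f 0) (f t') \<le> t'" using lipschitz_onD[OF f(3), of 0 t'] by (simp add: t'_def dist_real_def)
      moreover have "t' \<le> T" using f(1) by (simp add: t'_def)
      ultimately show ?thesis using f(4)[of 0] by simp
    qed
    then have "bounded (range f)" by (intro bounded_subset[OF bounded_cball[of x T]]) auto
    then show ?thesis using lipschitz_on_continuous_on[OF f(3)] by (simp add: bcontfun_def)
  qed
  then obtain G where G: "f = apply_bcontfun G" by (rule bcontfunE)
  have mem: "(T, G) \<in> curve_pairs (C5 * dist x y) x y" using f by (auto simp: curve_pairs_def G)
  have hm: "h i \<in> borel_measurable M" for i using borel_measurable_continuous_onI[OF h(1)] by simp
  have fin: "kernel_integral x y (h i) = ennreal (enn2real (kernel_integral x y (h i)))" for i
    by (rule kernel_integral_finite[OF xy h(3)])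
  have "kernel_integral x y g = (\<Sum>i<n. ennreal (w i) * kernel_integral x y (h i))"
    unfolding g_def by (rule kernel_integral_sum[OF hm h(2) w])
  also have "\<dots> = (\<Sum>i<n. ennreal (w i * enn2real (kernel_integral x y (h i))))"
    by (subst fin) (simp add: ennreal_mult' w)
  also have "\<dots> = ennreal (\<Sum>i<n. w i * enn2real (kernel_integral x y (h i)))"
    by (rule sum_ennreal) (simp add: w)
  finally have kg: "enn2real (kernel_integral x y g) = (\<Sum>i<n. w i * enn2real (kernel_integral x y (h i)))"
    by (simp add: sum_nonneg w)
  have "(\<Sum>i<n. w i * line_integral (h i) (T, G)) = line_integral g (T, G)"
    unfolding g_def by (rule line_integral_sum[OF h(1), symmetric])
  also have "\<dots> \<le> C5 * (enn2real (kernel_integral x y g) + 1 / (C5 * d) * dist x y)"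
    using f(6) by (simp add: line_integral_def G)
  also have "\<dots> = C5 * enn2real (kernel_integral x y g) + 1" using C5 d by (simp add: d_def[symmetric] distrib_left)
  also have "C5 * enn2real (kernel_integral x y g) = (\<Sum>i<n. w i * (C5 * enn2real (kernel_integral x y (h i))))"
    by (simp add: kg sum_distrib_left mult_ac)
  finally show ?thesis using mem by blast
qed

theorem random_curves_tests:
  fixes h :: "nat \<Rightarrow> 'a \<Rightarrow> real"
  assumes xy: "x \<noteq> y" and h: "\<And>i. \<exists>L. L-lipschitz_on UNIV (h i)" "\<And>i z. 0 \<le> h i z" "\<And>i z. h i z \<le> 1"
  obtains Sr :: "real set" and \<phi> and \<beta> :: "real measure" where
    "compact Sr" "continuous_on Sr \<phi>" "\<phi> ` Sr \<subseteq> curve_pairs (C5 * dist x y) x y"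
    "prob_space \<beta>" "sets \<beta> = sets borel" "AE s in \<beta>. s \<in> Sr"
    "\<And>i. (LINT s:Sr|\<beta>. line_integral (h i) (\<phi> s)) \<le> C5 * enn2real (kernel_integral x y (h i))"
proof -
  define S where "S = C5 * dist x y"
  have C5: "0 < C5" using C5_ge by simp
  have S: "0 \<le> S" using C5 by (simp add: S_def)
  have hc: "continuous_on UNIV (h i)" for i using h(1) lipschitz_on_continuous_on by blast
  let ?\<Lambda> = "\<lambda>i. C5 * enn2real (kernel_integral x y (h i))"
  let ?c = "4 * D * (C0 + 1) * dist x y"
  have c: "0 \<le> ?c" using D_ge Q_C0 by simp
  have bound: "\<bar>line_integral (h i) p - ?\<Lambda> i\<bar> \<le> S + C5 * ?c" if "p \<in> curve_pairs S x y" for i p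
  proof -
    have "0 \<le> line_integral (h i) p" by (rule line_integral_nonneg[OF hc h(2)])
    moreover have "line_integral (h i) p \<le> S" by (rule line_integral_le[OF hc h(3) that])
    moreover have "enn2real (kernel_integral x y (h i)) \<le> ?c"
      using enn2real_mono[OF kernel_integral_le[of x y "h i", OF xy h(3)]] c by simp
    then have "?\<Lambda> i \<le> C5 * ?c" using C5 by (intro mult_left_mono) auto
    moreover have "0 \<le> ?\<Lambda> i" using C5 by simp
    moreover have "0 \<le> C5 * ?c" using C5 c by simp
    ultimately show ?thesis using S by linarith
  qed
  obtain p c where p: "\<And>n. p n \<in> curve_pairs S x y" "0 \<le> c"
    "\<And>i n. i < n \<Longrightarrow> (\<Sum>j<n. line_integral (h i) (p j)) / real n \<le> ?\<Lambda> i + sqrt (2 ^ i * c / real n)"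
  proof (rule approachability[where F="\<lambda>i. line_integral (h i)" and \<Lambda>="?\<Lambda>" and K="curve_pairs S x y", OF bound])
    show "\<exists>p\<in>curve_pairs S x y. (\<Sum>i<n. w i * line_integral (h i) p) \<le> (\<Sum>i<n. w i * ?\<Lambda> i) + 1"
      if "\<And>i. 0 \<le> w i" for n w unfolding S_def by (rule curve_for_weights[OF xy hc h(2,3) that])
  qed (assumption, (rule that; assumption))
  obtain Sr :: "real set" and \<phi> \<beta> r where *: "compact Sr" "continuous_on Sr \<phi>" "\<phi> ` Sr \<subseteq> curve_pairs S x y"
    "prob_space \<beta>" "sets \<beta> = sets borel" "AE s in \<beta>. s \<in> Sr" "strict_mono r"
    "\<And>h. continuous_on (curve_pairs S x y) h \<Longrightarrow>
      (\<lambda>k. (\<Sum>j\<le>r k. h (p j)) / (real (r k) + 1)) \<longlonglongrightarrow> (LINT t:Sr|\<beta>. h (\<phi> t) :: real)"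
    by (rule empirical_measures_weak_limit[of "curve_pairs S x y" p, OF compact_curve_pairs[OF compact_cball_doubling] p(1)]) (rule that; assumption)
  show thesis
  proof (rule that[OF *(1,2) *(3)[unfolded S_def] *(4-6)])
    fix i
    obtain L where "L-lipschitz_on UNIV (h i)" using h(1) by blast
    then have lim: "(\<lambda>k. (\<Sum>j\<le>r k. line_integral (h i) (p j)) / (real (r k) + 1)) \<longlonglongrightarrow> (LINT s:Sr|\<beta>. line_integral (h i) (\<phi> s))"
      by (intro *(8) continuous_line_integral)
    have "(\<lambda>k. sqrt (2 ^ i * c * inverse (real (Suc (r k))))) \<longlonglongrightarrow> sqrt (2 ^ i * c * 0)"
      using LIMSEQ_subseq_LIMSEQ[OF LIMSEQ_inverse_real_of_nat *(7)]
      by (intro tendsto_real_sqrt tendsto_mult tendsto_const) (simp add: o_def)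
    then have "(\<lambda>k. ?\<Lambda> i + sqrt (2 ^ i * c / real (Suc (r k)))) \<longlonglongrightarrow> ?\<Lambda> i + 0"
      by (intro tendsto_add tendsto_const) (simp add: divide_inverse)
    then have lim2: "(\<lambda>k. ?\<Lambda> i + sqrt (2 ^ i * c / real (Suc (r k)))) \<longlonglongrightarrow> ?\<Lambda> i" by simp
    show "(LINT s:Sr|\<beta>. line_integral (h i) (\<phi> s)) \<le> ?\<Lambda> i"
    \<comment> \<open>Test \<open>i\<close> is under control only once more than \<open>i\<close>
      curves have been chosen, and \<open>k \<le> r k\<close>.\<close>
    proof (rule LIMSEQ_le[OF lim lim2], intro exI[of _ i] allI impI)
      fix k assume "i \<le> k"
      then have "i < Suc (r k)" using seq_suble[OF *(7), of k] by simp
      from p(3)[OF this] show "(\<Sum>j\<le>r k. line_integral (h i) (p j)) / (real (r k) + 1) \<le> ?\<Lambda> i + sqrt (2 ^ i * c / real (Suc (r k)))"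
        by (simp add: lessThan_Suc_atMost add.commute)
    qed
  qed
qed

theorem random_curves:
  assumes xy: "x \<noteq> y"
  obtains Sr :: "real set" and \<phi> and \<beta> :: "real measure" where
    "compact Sr" "continuous_on Sr \<phi>" "\<phi> ` Sr \<subseteq> curve_pairs (C5 * dist x y) x y"
    "prob_space \<beta>" "sets \<beta> = sets borel" "AE s in \<beta>. s \<in> Sr"
    "\<And>A. A \<in> sets borel \<Longrightarrow>
      (\<integral>\<^sup>+ s \<in> Sr. (\<integral>\<^sup>+ t \<in> {0..fst (\<phi> s)}. indicator A (apply_bcontfun (snd (\<phi> s)) t) \<partial>lborel) \<partial>\<beta>)
      \<le> ennreal C5 * (\<integral>\<^sup>+ z \<in> double_ball C0 x y \<inter> A. ennreal (riesz_kernel M x y z) \<partial>M)"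
proof -
  define S where "S = C5 * dist x y"
  have C5: "0 < C5" using C5_ge by simp
  have "\<exists>k. finite k \<and> cball x S \<subseteq> (\<Union>c\<in>k. ball c (1 / (real n + 1)))" for n :: nat
    using compact_cball_doubling[of x S] unfolding compact_eq_totally_bounded by simp
  then obtain net where net: "\<And>n. finite (net n)" "\<And>n. cball x S \<subseteq> (\<Union>c\<in>net n. ball c (1 / (real n + 1)))" by metis
  define E where "E = (\<Union>n. net n)"
  have cE: "countable E" unfolding E_def by (intro countable_UN) (auto intro: countable_finite net)
  \<comment> \<open>Finite sets of net points together with a scale: countably many test functions,
    enumerated by \<open>e\<close>.\<close>
  define \<T> where "\<T> = {F. finite F \<and> F \<subseteq> E} \<times> (UNIV :: nat set)"
  have "countable \<T>" unfolding \<T>_def by (intro countable_SIGMA countable_Collect_finite_subset cE) auto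
  moreover have "\<T> \<noteq> {}" by (auto simp: \<T>_def)
  ultimately have range_e: "range (from_nat_into \<T>) = \<T>" by (rule range_from_nat_into[rotated])
  define e where "e = from_nat_into \<T>"
  define h where "h i = test_fun (fst (e i)) (snd (e i))" for i
  have h: "\<exists>L. L-lipschitz_on UNIV (h i)" "0 \<le> h i z" "h i z \<le> 1" for i z
    unfolding h_def by (auto intro: test_fun_lipschitz test_fun_bounds)
  obtain Sr :: "real set" and \<phi> \<beta> where *: "compact Sr" "continuous_on Sr \<phi>" "\<phi> ` Sr \<subseteq> curve_pairs S x y"
    "prob_space \<beta>" "sets \<beta> = sets borel" "AE s in \<beta>. s \<in> Sr"
    "\<And>i. (LINT s:Sr|\<beta>. line_integral (h i) (\<phi> s)) \<le> C5 * enn2real (kernel_integral x y (h i))"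
    by (rule random_curves_tests[of x y h, OF xy h, folded S_def]) (rule that; assumption)
  \<comment> \<open>The right-hand side as a finite Borel measure, so that continuity from above
    applies to it.\<close>
  define \<Lambda> where "\<Lambda> = density M (\<lambda>z. ennreal C5 * (ennreal (riesz_kernel M x y z) * indicator (double_ball C0 x y) z))"
  have em: "emeasure \<Lambda> A = ennreal C5 * (\<integral>\<^sup>+ z \<in> double_ball C0 x y \<inter> A. ennreal (riesz_kernel M x y z) \<partial>M)"
    if A: "A \<in> sets borel" for A
  proof -
    have [measurable]: "A \<in> sets M" using A by (simp add: sets_M)
    have "emeasure \<Lambda> A = (\<integral>\<^sup>+ z. ennreal C5 * (ennreal (riesz_kernel M x y z) * indicator (double_ball C0 x y \<inter> A) z) \<partial>M)"
      unfolding \<Lambda>_def by (subst emeasure_density) (auto simp: indicator_inter_arith mult.assoc)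
    then show ?thesis by (simp add: nn_integral_cmult)
  qed
  have "emeasure \<Lambda> UNIV \<le> ennreal C5 * ennreal (4 * D * (C0 + 1) * dist x y)"
    using nn_integral_riesz[OF xy Q_C0] by (subst em) (auto intro: mult_left_mono)
  then have fin: "emeasure \<Lambda> UNIV < \<infinity>"
    by (rule le_less_trans) (simp add: ennreal_mult_less_top)
  have sets\<Lambda>: "sets \<Lambda> = sets borel" by (simp add: \<Lambda>_def sets_M)
  have test: "\<exists>F. (\<forall>z\<in>Z. test_fun F n z = 1) \<and>
      ennreal (LINT s:Sr|\<beta>. line_integral (test_fun F n) (\<phi> s)) \<le> emeasure \<Lambda> {z. infdist z Z < 3 / real n}"
    if Z: "compact Z" "Z \<noteq> {}" "Z \<subseteq> cball x S" and n: "0 < n" for Z n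
  proof -
    \<comment> \<open>Every point of \<open>Z\<close> is within \<open>1 / n\<close> of these net
      points, so the cutoff is 1 on \<open>Z\<close>; they lie within \<open>1 / n\<close> of
      \<open>Z\<close> themselves, so the cutoff vanishes outside the
      \<open>3 / n\<close>-neighbourhood.\<close>
    define F where "F = {c \<in> net n. \<exists>w\<in>Z. dist c w \<le> 1 / real n}"
    have rn: "1 / (real n + 1) \<le> 1 / real n" using n by (intro divide_left_mono) auto
    have cover: "\<exists>c\<in>F. dist z c \<le> 1 / real n" if z: "z \<in> Z" for z
    proof -
      obtain c where c: "c \<in> net n" "z \<in> ball c (1 / (real n + 1))" using net(2)[of n] Z(3) z by blast
      then have "dist c z \<le> 1 / real n" using rn by simp
      then show ?thesis using c(1) z by (auto simp: F_def dist_commute)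
    qed
    have Fne: "F \<noteq> {}" using Z(2) cover by blast
    have "(F, n) \<in> \<T>" using net(1)[of n] by (auto simp: \<T>_def E_def F_def)
    then obtain i where i: "e i = (F, n)" using range_e unfolding e_def by (metis rangeE)
    have "\<forall>z\<in>Z. test_fun F n z = 1" using cover test_fun_eq_1[OF _ _ n] by blast
    moreover have "ennreal (LINT s:Sr|\<beta>. line_integral (test_fun F n) (\<phi> s)) \<le> emeasure \<Lambda> {z. infdist z Z < 3 / real n}"
    proof -
      have hi: "h i = test_fun F n" by (simp add: h_def i)
      have finK: "kernel_integral x y (h i) = ennreal (enn2real (kernel_integral x y (h i)))"
        by (rule kernel_integral_finite[OF xy h(3)])
      have "ennreal (LINT s:Sr|\<beta>. line_integral (test_fun F n) (\<phi> s)) \<le> ennreal (C5 * enn2real (kernel_integral x y (h i)))"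
        using *(7)[of i] by (intro ennreal_leI) (simp add: hi)
      also have "\<dots> = ennreal C5 * kernel_integral x y (h i)"
        using C5 finK by (simp add: ennreal_mult')
      also have "\<dots> \<le> ennreal C5 * (\<integral>\<^sup>+ z \<in> double_ball C0 x y \<inter> {z. infdist z Z < 3 / real n}. ennreal (riesz_kernel M x y z) \<partial>M)"
        unfolding kernel_integral_def
      proof (intro mult_left_mono nn_integral_mono)
        fix z
        show "ennreal (h i z * riesz_kernel M x y z) * indicator (double_ball C0 x y) z
          \<le> ennreal (riesz_kernel M x y z) * indicator (double_ball C0 x y \<inter> {z. infdist z Z < 3 / real n}) z"
        proof (cases "h i z = 0")
          case False
          then have "0 < test_fun F n z" using h(2)[of i z] by (simp add: hi)
          then have "infdist z Z < 3 / real n"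
            by (intro test_fun_support[OF Fne _ n]) (auto simp: F_def)
          moreover have "h i z * riesz_kernel M x y z \<le> riesz_kernel M x y z"
            using mult_right_mono[OF h(3)[of i z] riesz_kernel_nonneg[of x y z]] by simp
          ultimately show ?thesis by (auto simp: indicator_def intro: ennreal_leI)
        qed simp
      qed simp
      also have "\<dots> = emeasure \<Lambda> {z. infdist z Z < 3 / real n}"
        by (rule em[symmetric]) (intro borel_open open_Collect_less continuous_intros)
      finally show ?thesis .
    qed
    ultimately show ?thesis by blast
  qed
  show thesis
  proof (rule that[OF *(1,2) *(3)[unfolded S_def] *(4-6)])
    fix A :: "'a set" assume A: "A \<in> sets borel"
    show "(\<integral>\<^sup>+ s \<in> Sr. (\<integral>\<^sup>+ t \<in> {0..fst (\<phi> s)}. indicator A (apply_bcontfun (snd (\<phi> s)) t) \<partial>lborel) \<partial>\<beta>)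
      \<le> ennreal C5 * (\<integral>\<^sup>+ z \<in> double_ball C0 x y \<inter> A. ennreal (riesz_kernel M x y z) \<partial>M)"
      unfolding em[OF A, symmetric]
      by (rule occupation_le[OF *(1-5) sets\<Lambda> fin test A])
  qed
qed

end

section \<open>Path integrals of one-Lipschitz curves\<close>

text \<open>\<open>\<sigma>\<close> grows no faster than its argument, so its speed is at most 1.
  The growth bound is applied to the integral of \<open>g\<close> up to \<open>\<sigma> t\<close>,
  which avoids differentiating \<open>\<sigma>\<close>.\<close>

lemma integral_monotone_substitution:
  fixes g \<sigma> :: "real \<Rightarrow> real"
  assumes T: "0 \<le> T" and g: "continuous_on UNIV g" "\<And>s. 0 \<le> g s"
    and \<sigma>: "\<sigma> 0 = 0" "\<And>s t. 0 \<le> s \<Longrightarrow> s \<le> t \<Longrightarrow> t \<le> T \<Longrightarrow> \<sigma> s \<le> \<sigma> t"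
      "\<And>s t. 0 \<le> s \<Longrightarrow> s \<le> t \<Longrightarrow> t \<le> T \<Longrightarrow> \<sigma> t - \<sigma> s \<le> t - s"
  shows "integral {0..\<sigma> T} g \<le> integral {0..T} (\<lambda>t. g (\<sigma> t))"
proof -
  have gi: "g integrable_on {a..b}" for a b
    by (rule integrable_continuous_real, rule continuous_on_subset[OF g(1)]) simp
  have "1-lipschitz_on {0..T} \<sigma>"
  proof (rule lipschitz_onI)
    fix s t assume "s \<in> {0..T}" "t \<in> {0..T}"
    then show "dist (\<sigma> s) (\<sigma> t) \<le> 1 * dist s t"
      using \<sigma>(2,3)[of s t] \<sigma>(2,3)[of t s] by (cases "s \<le> t") (auto simp: dist_real_def)
  qed simp
  then have c\<sigma>: "continuous_on {0..T} \<sigma>" by (rule lipschitz_on_continuous_on)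
  have "integral {0..\<sigma> T} g - integral {0..\<sigma> 0} g \<le> integral {0..T} (\<lambda>t. g (\<sigma> t))"
  proof (rule integral_growth_bound[OF T continuous_on_compose2[OF g(1) c\<sigma>]])
    fix x e :: real assume x: "x \<in> {0..T}" and e: "0 < e"
    obtain d where d: "d > 0" "\<And>s. dist s (\<sigma> x) < d \<Longrightarrow> dist (g s) (g (\<sigma> x)) < e"
      using g(1) e unfolding continuous_on_iff by (metis UNIV_I)
    show "\<exists>d>0. \<forall>s t. 0 \<le> s \<and> s \<le> x \<and> x \<le> t \<and> t \<le> T \<and> t - s < d \<longrightarrow>
      integral {0..\<sigma> t} g - integral {0..\<sigma> s} g \<le> (g (\<sigma> x) + e) * (t - s)"
    proof (intro exI[of _ d] conjI d(1) allI impI)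
      fix s t assume st: "0 \<le> s \<and> s \<le> x \<and> x \<le> t \<and> t \<le> T \<and> t - s < d"
      have \<sigma>0: "0 \<le> \<sigma> s" using \<sigma>(1) \<sigma>(2)[of 0 s] st by simp
      have \<sigma>st: "\<sigma> s \<le> \<sigma> x" "\<sigma> x \<le> \<sigma> t" "\<sigma> t - \<sigma> s \<le> t - s"
        using \<sigma>(2)[of s x] \<sigma>(2)[of x t] \<sigma>(3)[of s t] st by auto
      have "integral {0..\<sigma> s} g + integral {\<sigma> s..\<sigma> t} g = integral {0..\<sigma> t} g"
        by (rule Henstock_Kurzweil_Integration.integral_combine[OF \<sigma>0 _ gi]) (use \<sigma>st in simp)
      moreover have "integral {\<sigma> s..\<sigma> t} g \<le> integral {\<sigma> s..\<sigma> t} (\<lambda>_. g (\<sigma> x) + e)"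
      proof (rule integral_le[OF gi])
        fix r assume "r \<in> {\<sigma> s..\<sigma> t}"
        then have "dist (g r) (g (\<sigma> x)) < e" using st \<sigma>st by (intro d(2)) (auto simp: dist_real_def)
        then show "g r \<le> g (\<sigma> x) + e" by (simp add: dist_real_def)
      qed (simp add: integrable_const_ivl)
      moreover have "integral {\<sigma> s..\<sigma> t} (\<lambda>_. g (\<sigma> x) + e) = (g (\<sigma> x) + e) * (\<sigma> t - \<sigma> s)"
        using \<sigma>st by simp
      moreover have "(g (\<sigma> x) + e) * (\<sigma> t - \<sigma> s) \<le> (g (\<sigma> x) + e) * (t - s)"
        using \<sigma>st(3) g(2)[of "\<sigma> x"] e by (intro mult_left_mono) auto
      ultimately show "integral {0..\<sigma> t} g - integral {0..\<sigma> s} g \<le> (g (\<sigma> x) + e) * (t - s)" by linarith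
    qed
  qed auto
  then show ?thesis by (simp add: \<sigma>(1))
qed

text \<open>A 1-Lipschitz map does not increase Lebesgue measure. The case of continuous integrands
  is extended to Borel sets by inner regularity of the left-hand side and cutoffs around compact
  sets.\<close>

lemma emeasure_lipschitz_preimage_ge:
  fixes \<sigma> :: "real \<Rightarrow> real"
  assumes T: "0 \<le> T" and \<sigma>: "\<sigma> 0 = 0" "\<And>s t. 0 \<le> s \<Longrightarrow> s \<le> t \<Longrightarrow> t \<le> T \<Longrightarrow> \<sigma> s \<le> \<sigma> t"
      "\<And>s t. 0 \<le> s \<Longrightarrow> s \<le> t \<Longrightarrow> t \<le> T \<Longrightarrow> \<sigma> t - \<sigma> s \<le> t - s"
    and E: "E \<in> sets borel"
  shows "(\<integral>\<^sup>+ s \<in> {0..\<sigma> T}. indicator E s \<partial>lborel) \<le> (\<integral>\<^sup>+ t \<in> {0..T}. indicator E (\<sigma> t) \<partial>lborel)"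
proof -
  \<comment> \<open>Clamping the argument makes the function monotone on the whole line, hence
    Borel.\<close>
  define \<sigma>' where "\<sigma>' t = \<sigma> (max 0 (min T t))" for t
  have "mono \<sigma>'" unfolding \<sigma>'_def by (rule monoI, rule \<sigma>(2)) (use T in auto)
  then have [measurable]: "\<sigma>' \<in> borel_measurable borel" by (rule borel_measurable_mono)
  define m1 where "m1 = density lborel (indicator {0..\<sigma> T} :: real \<Rightarrow> ennreal)"
  define m2 where "m2 = distr (density lborel (indicator {0..T} :: real \<Rightarrow> ennreal)) borel \<sigma>'"
  have s: "sets m1 = sets borel" "sets m2 = sets borel" by (auto simp: m1_def m2_def)
  have m1: "emeasure m1 A = (\<integral>\<^sup>+ s \<in> {0..\<sigma> T}. indicator A s \<partial>lborel)" if "A \<in> sets borel" for A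
    unfolding m1_def using that by (subst emeasure_density) (auto simp: mult.commute)
  have m2: "emeasure m2 A = (\<integral>\<^sup>+ t \<in> {0..T}. indicator A (\<sigma> t) \<partial>lborel)" if [measurable]: "A \<in> sets borel" for A
  proof -
    have "emeasure m2 A = emeasure (density lborel (indicator {0..T} :: real \<Rightarrow> ennreal)) (\<sigma>' -` A)"
      unfolding m2_def by (subst emeasure_distr) auto
    also have "\<dots> = (\<integral>\<^sup>+ t. indicator {0..T} t * indicator (\<sigma>' -` A) t \<partial>lborel)"
      using measurable_sets[of \<sigma>' borel borel A] by (intro emeasure_density) auto
    also have "\<dots> = (\<integral>\<^sup>+ t \<in> {0..T}. indicator A (\<sigma> t) \<partial>lborel)"
      by (intro nn_integral_cong) (auto simp: indicator_def \<sigma>'_def)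
    finally show ?thesis .
  qed
  have \<sigma>T: "0 \<le> \<sigma> T" using \<sigma>(1) \<sigma>(2)[of 0 T] T by simp
  have fin: "emeasure m1 UNIV < \<infinity>" "emeasure m2 UNIV < \<infinity>" using m1[of UNIV] m2[of UNIV] T \<sigma>T by auto
  have "space m1 = UNIV" using sets_eq_imp_space_eq[OF s(1)] by simp
  then have fin': "emeasure m1 (space m1) \<noteq> \<infinity>" using fin(1) by simp
  have "emeasure m1 E = (SUP K\<in>{K. K \<subseteq> E \<and> compact K}. emeasure m1 K)"
    by (rule inner_regular[OF s(1) fin' E])
  also have "\<dots> \<le> emeasure m2 E"
  proof (rule SUP_least, clarify)
    fix Z assume Z: "Z \<subseteq> E" "compact Z"
    have ZB: "Z \<in> sets borel" using Z(2) by (simp add: compact_imp_closed borel_closed)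
    show "emeasure m1 Z \<le> emeasure m2 E"
    proof (cases "Z = {}")
      case False
      show ?thesis
      proof (rule le_emeasure_of_neighbourhoods[OF s(2) fin(2) Z(2) False Z(1) E])
        fix n :: nat
        let ?g = "test_fun Z (Suc n)"
        have N: "{z. infdist z Z < 3 / real (Suc n)} \<in> sets borel"
          by (intro borel_open open_Collect_less continuous_intros)
        have "emeasure m1 Z = (\<integral>\<^sup>+ s \<in> {0..\<sigma> T}. indicator Z s \<partial>lborel)" by (rule m1[OF ZB])
        also have "\<dots> \<le> (\<integral>\<^sup>+ s \<in> {0..\<sigma> T}. ennreal (?g s) \<partial>lborel)"
          by (intro nn_integral_mono mult_right_mono) (auto simp: indicator_def test_fun_def)
        also have "\<dots> = ennreal (integral {0..\<sigma> T} ?g)"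
          by (rule nn_integral_Icc_eq_integral[OF continuous_on_subset[OF test_fun_continuous] test_fun_bounds(1)]) simp
        also have "\<dots> \<le> ennreal (integral {0..T} (\<lambda>t. ?g (\<sigma> t)))"
          by (intro ennreal_leI integral_monotone_substitution[OF T test_fun_continuous test_fun_bounds(1) \<sigma>])
        also have "integral {0..T} (\<lambda>t. ?g (\<sigma> t)) = integral {0..T} (\<lambda>t. ?g (\<sigma>' t))"
          by (rule Henstock_Kurzweil_Integration.integral_cong) (auto simp: \<sigma>'_def)
        also have "ennreal \<dots> = (\<integral>\<^sup>+ t \<in> {0..T}. ennreal (?g (\<sigma>' t)) \<partial>lborel)"
        proof (rule nn_integral_Icc_eq_integral[symmetric])
          have "1-lipschitz_on {0..T} \<sigma>'"
          proof (rule lipschitz_onI)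
            fix s t assume "s \<in> {0..T}" "t \<in> {0..T}"
            then show "dist (\<sigma>' s) (\<sigma>' t) \<le> 1 * dist s t"
              using \<sigma>(2,3)[of s t] \<sigma>(2,3)[of t s] by (cases "s \<le> t") (auto simp: dist_real_def \<sigma>'_def)
          qed simp
          then show "continuous_on {0..T} (\<lambda>t. ?g (\<sigma>' t))"
            by (intro continuous_on_compose2[OF test_fun_continuous lipschitz_on_continuous_on]) auto
        qed (rule test_fun_bounds)
        also have "\<dots> \<le> (\<integral>\<^sup>+ t \<in> {0..T}. indicator {z. infdist z Z < 3 / real (Suc n)} (\<sigma> t) \<partial>lborel)"
        proof (rule nn_integral_mono)
          fix t
          have "ennreal (?g z) \<le> indicator {z. infdist z Z < 3 / real (Suc n)} z" for z
          proof (cases "infdist z Z < 3 / real (Suc n)")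
            case True then show ?thesis using test_fun_bounds(2)[of Z "Suc n" z] by (simp add: ennreal_le_1)
          next
            case ge: False
            have "?g z = 0"
            proof (rule ccontr)
              assume "?g z \<noteq> 0"
              then have "0 < ?g z" using test_fun_bounds(1)[of Z "Suc n" z] by simp
              then have "infdist z Z < 3 / real (Suc n)"
                by (rule test_fun_support[OF False _ zero_less_Suc, rotated]) (auto intro!: bexI)
              with ge show False by simp
            qed
            then show ?thesis by simp
          qed
          then show "ennreal (?g (\<sigma>' t)) * indicator {0..T} t \<le> indicator {z. infdist z Z < 3 / real (Suc n)} (\<sigma> t) * indicator {0..T} t"
            by (cases "t \<in> {0..T}") (auto simp: \<sigma>'_def)
        qed
        also have "\<dots> = emeasure m2 {z. infdist z Z < 3 / real (Suc n)}" by (rule m2[OF N, symmetric])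
        finally show "emeasure m1 Z \<le> emeasure m2 {z. infdist z Z < 3 / real (Suc n)}" .
      qed
    qed simp
  qed
  finally show ?thesis by (simp only: m1[OF E] m2[OF E])
qed

section \<open>Length measure of a curve\<close>

text \<open>Path integrals are integrals against this measure, so measurability in the curve becomes
  measurability of a kernel, which can be tested on Lipschitz functions.\<close>

definition arc_measure :: "(real \<Rightarrow> 'a::metric_space) \<Rightarrow> real \<Rightarrow> 'a measure" where
  "arc_measure f T = distr (restrict_space lborel {0..arclen f 0 T}) borel (arclength_param f 0 T)"

context
  fixes f :: "real \<Rightarrow> 'a::metric_space" and T :: real
  assumes T: "0 \<le> T" and f: "1-lipschitz_on {0..T} f"
begin

private lemma rect: "rectifiable_curve f 0 T"
  by (rule rectifiable_curve_lipschitz[OF T f])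

lemma arclen_diff_le:
  assumes "0 \<le> s" "s \<le> t" "t \<le> T"
  shows "arclen f 0 t - arclen f 0 s \<le> t - s"
proof -
  have "ennreal (arclen f 0 t - arclen f 0 s) \<le> ennreal (t - s)"
    using curve_length_lipschitz[OF assms(2) lipschitz_on_subset[OF f]] curve_length_eq_arclen_diff[OF rect assms] assms by auto
  then show ?thesis using assms by (simp add: ennreal_le_iff)
qed

lemma arclength_param_measurable [measurable]:
  "arclength_param f 0 T \<in> borel_measurable (restrict_space borel {0..arclen f 0 T})"
  by (rule borel_measurable_continuous_on_restrict[OF lipschitz_on_continuous_on[OF arclength_param_lipschitz[OF rect]]])

lemma arclength_param_measurable_lborel [measurable]:
  "arclength_param f 0 T \<in> borel_measurable (restrict_space lborel {0..arclen f 0 T})"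
  using arclength_param_measurable
  unfolding measurable_cong_sets[OF sets_restrict_space_cong[OF sets_lborel] refl] .

lemma path_integral_eq_nn_integral_arc_measure:
  assumes "h \<in> borel_measurable borel"
  shows "path_integral f 0 T h = (\<integral>\<^sup>+ z. h z \<partial>arc_measure f T)"
proof -
  have "(\<integral>\<^sup>+ z. h z \<partial>arc_measure f T) = (\<integral>\<^sup>+ s. h (arclength_param f 0 T s) \<partial>restrict_space lborel {0..arclen f 0 T})"
    unfolding arc_measure_def by (rule nn_integral_distr) (use assms in auto)
  also have "\<dots> = path_integral f 0 T h"
    by (subst nn_integral_restrict_space) (auto simp: path_integral_def arclen_def)
  finally show ?thesis by simp
qed

lemma path_integral_indicator:
  assumes "A \<in> sets borel"
  shows "path_integral f 0 T (indicator A) = emeasure (arc_measure f T) A"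
  using assms by (subst path_integral_eq_nn_integral_arc_measure) (auto simp: arc_measure_def)

text \<open>Arc length runs no faster than the parameter: \<open>A\<close> pulls back to a set
  \<open>E\<close> of arc lengths, and \<open>arclen\<close> is a monotone 1-Lipschitz map onto the
  arc-length interval.\<close>

lemma path_integral_le_parameter_integral:
  assumes A: "A \<in> sets borel"
  shows "path_integral f 0 T (indicator A) \<le> (\<integral>\<^sup>+ t \<in> {0..T}. indicator A (f t) \<partial>lborel)"
proof -
  let ?l = "arclen f 0 T" and ?p = "arclength_param f 0 T"
  define E where "E = ?p -` A \<inter> {0..?l}"
  have E: "E \<in> sets borel"
    using measurable_sets[OF arclength_param_measurable A]
    by (simp add: E_def space_restrict_space sets_restrict_space_iff)
  have "path_integral f 0 T (indicator A) = (\<integral>\<^sup>+ s \<in> {0..?l}. indicator E s \<partial>lborel)"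
    unfolding path_integral_def by (intro nn_integral_cong) (auto simp: E_def indicator_def arclen_def)
  also have "\<dots> \<le> (\<integral>\<^sup>+ t \<in> {0..T}. indicator E (arclen f 0 t) \<partial>lborel)"
    by (rule emeasure_lipschitz_preimage_ge[OF T arclen_start[OF rect] arclen_mono[OF rect] arclen_diff_le E])
  also have "\<dots> \<le> (\<integral>\<^sup>+ t \<in> {0..T}. indicator A (f t) \<partial>lborel)"
  proof (rule nn_integral_mono)
    fix t
    show "indicator E (arclen f 0 t) * indicator {0..T} t \<le> (indicator A (f t) * indicator {0..T} t :: ennreal)"
      using arclength_param_arclen[OF rect, of t] by (auto simp: indicator_def E_def)
  qed
  finally show ?thesis .
qed

lemma arclen_le: "arclen f 0 T \<le> T"
  using arclen_diff_le[of 0 T] T arclen_start[OF rect] by simp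

lemma emeasure_arc_measure_UNIV: "emeasure (arc_measure f T) UNIV = ennreal (arclen f 0 T)"
proof -
  have "emeasure (arc_measure f T) UNIV = emeasure (restrict_space lborel {0..arclen f 0 T}) {0..arclen f 0 T}"
    unfolding arc_measure_def by (subst emeasure_distr) (auto simp: space_restrict_space)
  then show ?thesis by (simp add: emeasure_restrict_space arclen_nonneg[OF rect])
qed

text \<open>The sum involves only values of \<open>f\<close> and of its length function at finitely
  many parameters, whose dependence on the curve is measurable. On each cell the arc length is at
  most \<open>T / n\<close>, so \<open>h\<close> varies by at most \<open>L * T / n\<close>.\<close>

lemma riemann_sum_arc_measure:
  fixes h :: "'a \<Rightarrow> real"
  assumes h: "L-lipschitz_on UNIV h" and h0: "\<And>z. 0 \<le> h z" and n: "0 < n"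
  defines "t \<equiv> (\<lambda>i. real i * T / real n)"
  shows "\<bar>enn2real (\<integral>\<^sup>+ z. ennreal (h z) \<partial>arc_measure f T)
      - (\<Sum>i<n. h (f (t i)) * (arclen f 0 (t (Suc i)) - arclen f 0 (t i)))\<bar> \<le> L * T * T / real n"
proof -
  let ?p = "arclength_param f 0 T" and ?l = "arclen f 0"
  have L0: "0 \<le> L" by (rule lipschitz_on_nonneg[OF h])
  have hc: "continuous_on UNIV h" by (rule lipschitz_on_continuous_on[OF h])
  have pc: "continuous_on {0..?l T} ?p" by (rule lipschitz_on_continuous_on[OF arclength_param_lipschitz[OF rect]])
  have hpc: "continuous_on {0..?l T} (\<lambda>s. h (?p s))" by (rule continuous_on_compose2[OF hc pc]) auto
  have hm: "(\<lambda>z. ennreal (h z)) \<in> borel_measurable borel" using borel_measurable_continuous_onI[OF hc] by simp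
  have "(\<integral>\<^sup>+ z. ennreal (h z) \<partial>arc_measure f T) = (\<integral>\<^sup>+ s \<in> {0..?l T}. ennreal (h (?p s)) \<partial>lborel)"
    using path_integral_eq_nn_integral_arc_measure[OF hm] by (simp add: path_integral_def arclen_def)
  also have "\<dots> = ennreal (integral {0..?l T} (\<lambda>s. h (?p s)))"
    by (rule nn_integral_Icc_eq_integral[OF hpc h0])
  finally have eq: "enn2real (\<integral>\<^sup>+ z. ennreal (h z) \<partial>arc_measure f T) = integral {0..?l T} (\<lambda>s. h (?p s))"
    using Henstock_Kurzweil_Integration.integral_nonneg[OF integrable_continuous_real[OF hpc] h0] by simp
  have n0: "0 < real n" using n by simp
  have t0: "t 0 = 0" "t n = T" using n0 by (auto simp: t_def)
  have tS: "t (Suc i) - t i = T / n" for i using n0 by (simp add: t_def field_simps)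
  have tm: "0 \<le> t i" "t i \<le> T" if "i \<le> n" for i
    using that T n0 mult_right_mono[of "real i" "real n" T] by (auto simp: t_def field_simps)
  have tle: "t i \<le> t (Suc i)" for i using tS[of i] divide_nonneg_pos[OF T n0] by linarith
  have int: "(\<lambda>s. h (?p s)) integrable_on {a..b}" if "0 \<le> a" "b \<le> ?l T" for a b
    by (rule integrable_continuous_real, rule continuous_on_subset[OF hpc]) (use that in auto)
  have "\<bar>integral {0..?l (t k)} (\<lambda>s. h (?p s)) - (\<Sum>i<k. h (f (t i)) * (?l (t (Suc i)) - ?l (t i)))\<bar> \<le> L * (T / n) * ?l (t k)"
    if "k \<le> n" for k
    using that
  proof (induction k)
    case 0 then show ?case by (simp add: t0 arclen_start[OF rect])
  next
    case (Suc k)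
    let ?a = "?l (t k)" and ?b = "?l (t (Suc k))"
    have kn: "k \<le> n" using Suc.prems by simp
    have ab: "0 \<le> ?a" "?a \<le> ?b" "?b \<le> ?l T" "?b - ?a \<le> T / n"
      using arclen_nonneg[OF rect] arclen_mono[OF rect tm(1)[OF kn] tle tm(2)[OF Suc.prems]]
        arclen_mono[OF rect tm[OF Suc.prems]] arclen_diff_le[OF tm(1)[OF kn] tle tm(2)[OF Suc.prems]] tS[of k] by auto
    have fa: "f (t k) = ?p ?a" using arclength_param_arclen[OF rect, of "t k"] tm[OF kn] by simp
    have comb: "integral {0..?a} (\<lambda>s. h (?p s)) + integral {?a..?b} (\<lambda>s. h (?p s)) = integral {0..?b} (\<lambda>s. h (?p s))"
      by (rule Henstock_Kurzweil_Integration.integral_combine[OF ab(1,2) int]) (use ab in auto)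
    have "norm (integral {?a..?b} (\<lambda>s. h (?p s) - h (f (t k)))) \<le> (L * (T / n)) * (?b - ?a)"
    proof (rule integral_bound[OF ab(2)])
      show "continuous_on {?a..?b} (\<lambda>s. h (?p s) - h (f (t k)))"
        by (intro continuous_intros continuous_on_subset[OF hpc]) (use ab in auto)
      fix s assume s: "s \<in> {?a..?b}"
      have "dist (?p s) (?p ?a) \<le> 1 * dist s ?a"
        by (rule lipschitz_onD[OF arclength_param_lipschitz[OF rect]]) (use s ab in auto)
      then have "dist (?p s) (?p ?a) \<le> T / n" using s ab by (simp add: dist_real_def)
      then have "L * dist (?p s) (?p ?a) \<le> L * (T / n)" using L0 by (rule mult_left_mono)
      then show "norm (h (?p s) - h (f (t k))) \<le> L * (T / n)"
        using lipschitz_onD[OF h, of "?p s" "?p ?a"] by (simp add: fa dist_real_def)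
    qed
    moreover have "integral {?a..?b} (\<lambda>s. h (?p s) - h (f (t k))) = integral {?a..?b} (\<lambda>s. h (?p s)) - h (f (t k)) * (?b - ?a)"
      using int[of ?a ?b] ab by (subst Henstock_Kurzweil_Integration.integral_diff) (auto intro: integrable_const_ivl)
    ultimately have "\<bar>integral {?a..?b} (\<lambda>s. h (?p s)) - h (f (t k)) * (?b - ?a)\<bar> \<le> (L * (T / n)) * (?b - ?a)" by simp
    moreover have "(L * (T / n)) * (?b - ?a) + L * (T / n) * ?a = L * (T / n) * ?b" by (simp add: algebra_simps)
    ultimately show ?case using Suc.IH[OF kn] comb by simp
  qed
  from this[of n] have "\<bar>integral {0..?l T} (\<lambda>s. h (?p s)) - (\<Sum>i<n. h (f (t i)) * (?l (t (Suc i)) - ?l (t i)))\<bar> \<le> L * (T / n) * ?l T"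
    by (simp add: t0)
  also have "\<dots> \<le> L * (T / n) * T" using L0 T arclen_le by (intro mult_left_mono) auto
  finally show ?thesis by (simp add: eq mult_ac)
qed

end

text \<open>Open sets other than the whole space are treated through the increasing Lipschitz
  functions \<open>min 1 (real n * infdist z (- U))\<close>; disjoint unions and complements follow
  by a Dynkin class argument, where finiteness permits subtraction.\<close>

lemma kernel_measurableI:
  fixes \<kappa> :: "'p \<Rightarrow> 'a::metric_space measure"
  assumes sets_\<kappa>: "\<And>p. p \<in> space N \<Longrightarrow> sets (\<kappa> p) = sets borel"
    and fin: "\<And>p. p \<in> space N \<Longrightarrow> emeasure (\<kappa> p) UNIV < \<infinity>"
    and lip: "\<And>L h. L-lipschitz_on UNIV h \<Longrightarrow> (\<And>z. 0 \<le> h z) \<Longrightarrow> (\<And>z. h z \<le> 1) \<Longrightarrow> (\<lambda>p. \<integral>\<^sup>+ z. ennreal (h z) \<partial>\<kappa> p) \<in> borel_measurable N"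
    and A: "A \<in> sets borel"
  shows "(\<lambda>p. emeasure (\<kappa> p) A) \<in> borel_measurable N"
proof -
  have open_case: "(\<lambda>p. emeasure (\<kappa> p) U) \<in> borel_measurable N" if U: "open U" for U
  \<comment> \<open>\<open>infdist\<close> to the empty set is 0, so the cutoff functions would
    vanish for the whole space.\<close>
  proof (cases "U = UNIV")
    case True
    have "(\<lambda>p. \<integral>\<^sup>+ z. ennreal 1 \<partial>\<kappa> p) \<in> borel_measurable N"
      by (rule lip[of 0]) (auto intro: lipschitz_onI)
    moreover have "(\<integral>\<^sup>+ z. ennreal 1 \<partial>\<kappa> p) = emeasure (\<kappa> p) U" if "p \<in> space N" for p
      using sets_eq_imp_space_eq[OF sets_\<kappa>[OF that]] True by simp
    ultimately show ?thesis by (simp cong: measurable_cong)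
  next
    case False
    then have ne: "- U \<noteq> {}" by auto
    define h where "h n z = min 1 (real n * infdist z (- U))" for n and z :: 'a
    have h01: "0 \<le> h n z" "h n z \<le> 1" for n z by (auto simp: h_def infdist_nonneg)
    have hl: "(real n)-lipschitz_on UNIV (h n)" for n
    proof (rule lipschitz_onI)
      fix z w :: 'a
      have "\<bar>infdist z (- U) - infdist w (- U)\<bar> \<le> dist z w"
        using infdist_triangle[of z "- U" w] infdist_triangle[of w "- U" z] by (simp add: dist_commute)
      then have "real n * \<bar>infdist z (- U) - infdist w (- U)\<bar> \<le> real n * dist z w" by (intro mult_left_mono) auto
      moreover have "\<bar>real n * infdist z (- U) - real n * infdist w (- U)\<bar> = real n * \<bar>infdist z (- U) - infdist w (- U)\<bar>"
        by (simp add: abs_mult flip: right_diff_distrib)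
      ultimately show "dist (h n z) (h n w) \<le> real n * dist z w"
        unfolding h_def dist_real_def by linarith
    qed simp
    have sup: "(SUP n. ennreal (h n z)) = indicator U z" for z
    proof (cases "z \<in> U")
      case True
      have "infdist z (- U) \<noteq> 0"
        using in_closed_iff_infdist_zero[of "- U" z] ne U True by (auto simp: closed_def)
      then have pos: "0 < infdist z (- U)" using infdist_nonneg[of z "- U"] by simp
      obtain n where "1 / infdist z (- U) < real n" using reals_Archimedean2 by blast
      then have "h n z = 1" using pos by (simp add: h_def field_simps)
      then have "1 \<le> (SUP n. ennreal (h n z))" by (intro SUP_upper2[of n]) auto
      moreover have "(SUP n. ennreal (h n z)) \<le> 1" by (rule SUP_least) (use h01 in \<open>simp add: ennreal_le_1\<close>)
      ultimately show ?thesis using True by simp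
    next
      case False
      then have "h n z = 0" for n by (simp add: h_def)
      then show ?thesis using False by simp
    qed
    have "emeasure (\<kappa> p) U = (SUP n. \<integral>\<^sup>+ z. ennreal (h n z) \<partial>\<kappa> p)" if p: "p \<in> space N" for p
    proof -
      have "emeasure (\<kappa> p) U = (\<integral>\<^sup>+ z. (SUP n. ennreal (h n z)) \<partial>\<kappa> p)"
        unfolding sup by (rule nn_integral_indicator[symmetric]) (simp add: sets_\<kappa>[OF p] U)
      also have "\<dots> = (SUP n. \<integral>\<^sup>+ z. ennreal (h n z) \<partial>\<kappa> p)"
      proof (rule nn_integral_monotone_convergence_SUP)
        show "incseq (\<lambda>n z. ennreal (h n z))"
        proof (rule incseq_SucI, rule le_funI, rule ennreal_leI)
          fix n z
          have "real n * infdist z (- U) \<le> real (Suc n) * infdist z (- U)"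
            by (intro mult_right_mono infdist_nonneg) simp
          then show "h n z \<le> h (Suc n) z" by (simp add: h_def min.coboundedI2 del: of_nat_Suc)
        qed
        show "(\<lambda>z. ennreal (h n z)) \<in> borel_measurable (\<kappa> p)" for n
          using borel_measurable_continuous_onI[OF lipschitz_on_continuous_on[OF hl]]
          by (simp add: measurable_cong_sets[OF sets_\<kappa>[OF p] refl])
      qed
      finally show ?thesis .
    qed
    moreover have "(\<lambda>p. SUP n. \<integral>\<^sup>+ z. ennreal (h n z) \<partial>\<kappa> p) \<in> borel_measurable N"
      by (intro borel_measurable_SUP lip[OF hl h01]) simp
    ultimately show ?thesis by (simp cong: measurable_cong)
  qed
  have "Int_stable {U :: 'a set. open U}" by (auto simp: Int_stable_def)
  moreover have "{U :: 'a set. open U} \<subseteq> Pow UNIV" by simp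
  moreover have "A \<in> sigma_sets UNIV {U. open U}" using A by (simp add: borel_def)
  ultimately show ?thesis
  proof (induction rule: sigma_sets_induct_disjoint)
    case (compl B)
    then have B: "B \<in> sets borel" by (simp add: borel_def)
    have eq: "emeasure (\<kappa> p) (UNIV - B) = emeasure (\<kappa> p) UNIV - emeasure (\<kappa> p) B" if p: "p \<in> space N" for p
    proof (rule emeasure_Diff)
      show "emeasure (\<kappa> p) B \<noteq> \<infinity>"
        using emeasure_mono[of B UNIV "\<kappa> p"] fin[OF p] sets_\<kappa>[OF p] by (auto simp: top_unique less_top)
    qed (use B sets_\<kappa>[OF p] in auto)
    have "(\<lambda>p. emeasure (\<kappa> p) UNIV - emeasure (\<kappa> p) B) \<in> borel_measurable N"
      by (intro borel_measurable_minus_ennreal open_case compl(2)) simp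
    then show ?case by (simp add: eq cong: measurable_cong)
  next
    case (union B)
    then have B: "range B \<subseteq> sets borel" by (auto simp: borel_def)
    have eq: "emeasure (\<kappa> p) (\<Union>i. B i) = (\<Sum>i. emeasure (\<kappa> p) (B i))" if p: "p \<in> space N" for p
      by (rule suminf_emeasure[symmetric]) (use B union(1) sets_\<kappa>[OF p] in auto)
    have "(\<lambda>p. \<Sum>i. emeasure (\<kappa> p) (B i)) \<in> borel_measurable N"
      by (intro borel_measurable_suminf_order union(3))
    then show ?case by (simp add: eq cong: measurable_cong)
  qed (auto intro: open_case)
qed

section \<open>Measurability in the space of curves\<close>

text \<open>Freezing at both ends extends all curves to the same parameter line, so that curves with
  different parameter intervals can be compared pointwise.\<close>

definition curve_ext :: "'a curve \<Rightarrow> real \<Rightarrow> 'a" where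
  "curve_ext p t = fst p (max 0 (min t (Sup (snd p))))"

lemma curves_betweenE:
  assumes "p \<in> curves_between C x y"
  obtains \<gamma> T where "p = (\<gamma>, {0..T})" "0 \<le> T" "T \<le> C * dist x y" "Sup {0..T} = T" "1-lipschitz_on {0..T} \<gamma>" "\<gamma> 0 = x" "\<gamma> T = y"
proof -
  obtain \<gamma> T where p: "p = (\<gamma>, {0..T})" "0 \<le> T" "T \<le> C * dist x y" "1-lipschitz_on {0..T} \<gamma>" "\<gamma> 0 = x" "\<gamma> (Sup {0..T}) = y"
    using assms unfolding curves_between_def by blast
  have "Sup {0..T} = T" using p(2) by simp
  then show thesis using that[OF p(1-3) _ p(4,5)] p(6) by simp
qed

lemma curve_ext_lipschitz:
  assumes "p \<in> curves_between C x y"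
  shows "1-lipschitz_on UNIV (curve_ext p)"
proof -
  obtain \<gamma> T where p: "p = (\<gamma>, {0..T})" "0 \<le> T" "Sup {0..T} = T" "1-lipschitz_on {0..T} \<gamma>"
    using assms by (rule curves_betweenE)
  show ?thesis
  proof (rule lipschitz_onI)
    fix s t :: real
    have "dist (curve_ext p s) (curve_ext p t) \<le> 1 * dist (max 0 (min s T)) (max 0 (min t T))"
      unfolding curve_ext_def p(1) fst_conv snd_conv p(3) by (rule lipschitz_onD[OF p(4)]) (use p(2) in auto)
    also have "\<dots> \<le> 1 * dist s t" by (auto simp: dist_real_def)
    finally show "dist (curve_ext p s) (curve_ext p t) \<le> 1 * dist s t" .
  qed simp
qed

lemma curve_graph_near:
  assumes p: "(\<gamma>, {0..T}) \<in> curves_between C x y" and q: "(\<gamma>', {0..T'}) \<in> curves_between C x y" and s: "s \<in> {0..T}"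
  obtains s' where "s' \<in> {0..T'}" "\<bar>s - s'\<bar> \<le> curve_dist (\<gamma>, {0..T}) (\<gamma>', {0..T'})"
    "dist (\<gamma> s) (\<gamma>' s') \<le> curve_dist (\<gamma>, {0..T}) (\<gamma>', {0..T'})"
proof -
  let ?P = "curve_graph (\<gamma>, {0..T})" and ?Q = "curve_graph (\<gamma>', {0..T'})"
  note P = compact_curve_graph[OF p] and Q = compact_curve_graph[OF q]
  have a: "(s, \<gamma> s) \<in> ?P" using s by (auto simp: curve_graph_def)
  have "continuous_on ?Q (dist (s, \<gamma> s))" by (intro continuous_intros)
  then obtain b where b: "b \<in> ?Q" "\<And>c. c \<in> ?Q \<Longrightarrow> dist (s, \<gamma> s) b \<le> dist (s, \<gamma> s) c"
    using continuous_attains_inf[OF Q] by blast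
  have "dist (s, \<gamma> s) b \<le> infdist (s, \<gamma> s) ?Q"
    using b Q(2) by (auto simp: infdist_def intro!: cINF_greatest)
  also have "\<dots> \<le> curve_dist (\<gamma>, {0..T}) (\<gamma>', {0..T'})"
    unfolding curve_dist_def by (rule infdist_le_hausdorff_dist) (use P Q a compact_imp_bounded in auto)
  finally have le: "dist (s, \<gamma> s) b \<le> curve_dist (\<gamma>, {0..T}) (\<gamma>', {0..T'})" .
  obtain s' where s': "s' \<in> {0..T'}" "b = (s', \<gamma>' s')" using b(1) by (auto simp: curve_graph_def)
  show thesis
    using that[OF s'(1)] le dist_fst_le[of "(s, \<gamma> s)" b] dist_snd_le[of "(s, \<gamma> s)" b]
    by (simp add: s'(2) dist_real_def)
qed

text \<open>One distance comes from the matching point of the other graph, the other two from the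
  time shift between that point and the clamped parameter, as the end times differ by at most the
  distance of the curves.\<close>

lemma curve_ext_dist:
  assumes p: "p \<in> curves_between C x y" and q: "q \<in> curves_between C x y"
  shows "dist (curve_ext p t) (curve_ext q t) \<le> 3 * curve_dist p q"
proof -
  obtain \<gamma> T where p': "p = (\<gamma>, {0..T})" "0 \<le> T" "Sup {0..T} = T" "1-lipschitz_on {0..T} \<gamma>"
    using p by (rule curves_betweenE)
  obtain \<gamma>' T' where q': "q = (\<gamma>', {0..T'})" "0 \<le> T'" "Sup {0..T'} = T'" "1-lipschitz_on {0..T'} \<gamma>'"
    using q by (rule curves_betweenE)
  define d where "d = curve_dist p q"
  have d': "curve_dist q p = d" by (simp add: d_def curve_dist_def hausdorff_dist_commute)
  have Tp: "T \<in> {0..T}" and Tq: "T' \<in> {0..T'}" using p'(2) q'(2) by auto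
  have TT: "\<bar>T - T'\<bar> \<le> d"
  proof -
    obtain s' where "s' \<in> {0..T'}" "\<bar>T - s'\<bar> \<le> d"
      using curve_graph_near[OF p[unfolded p'(1)] q[unfolded q'(1)] Tp] unfolding d_def p'(1) q'(1) by blast
    moreover obtain s where "s \<in> {0..T}" "\<bar>T' - s\<bar> \<le> d"
      using curve_graph_near[OF q[unfolded q'(1)] p[unfolded p'(1)] Tq] d' unfolding p'(1) q'(1) by metis
    ultimately show ?thesis by auto
  qed
  define u v where "u = max 0 (min t T)" and "v = max 0 (min t T')"
  have uv: "u \<in> {0..T}" "v \<in> {0..T'}" "\<bar>u - v\<bar> \<le> d" using p'(2) q'(2) TT by (auto simp: u_def v_def)
  obtain s' where s': "s' \<in> {0..T'}" "\<bar>u - s'\<bar> \<le> d" "dist (\<gamma> u) (\<gamma>' s') \<le> d"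
    using curve_graph_near[OF p[unfolded p'(1)] q[unfolded q'(1)] uv(1)] unfolding d_def p'(1) q'(1) by blast
  have "dist (\<gamma>' s') (\<gamma>' v) \<le> \<bar>s' - v\<bar>"
    using lipschitz_onD[OF q'(4) s'(1) uv(2)] by (simp add: dist_real_def)
  also have "\<dots> \<le> 2 * d" using s'(2) uv(3) by linarith
  finally have "dist (\<gamma> u) (\<gamma>' v) \<le> 3 * d" using s'(3) dist_triangle[of "\<gamma> u" "\<gamma>' v" "\<gamma>' s'"] by linarith
  then show ?thesis
    by (simp add: d_def curve_ext_def p'(1,3) q'(1,3) u_def v_def)
qed

lemma curve_length_const: "curve_length (\<lambda>_. c) a b = 0"
proof -
  have "curve_length (\<lambda>_. c) a b \<le> 0" by (rule curve_length_least) simp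
  then show ?thesis by simp
qed

text \<open>The constant tail has length 0, so the arc-length parametrization does not see
  it.\<close>

lemma path_integral_curve_ext:
  assumes p: "p \<in> curves_between C x y"
  shows "path_integral (fst p) 0 (Sup (snd p)) h = path_integral (curve_ext p) 0 (C * dist x y) h"
proof -
  obtain \<gamma> T where p': "p = (\<gamma>, {0..T})" "0 \<le> T" "T \<le> C * dist x y" "Sup {0..T} = T" "1-lipschitz_on {0..T} \<gamma>"
    using p by (rule curves_betweenE)
  let ?S = "C * dist x y" and ?e = "curve_ext p"
  have S: "0 \<le> ?S" using p' by simp
  have e: "?e t = \<gamma> t" if "t \<in> {0..T}" for t using that by (simp add: curve_ext_def p'(1,4))
  have len: "curve_length \<gamma> 0 t = curve_length ?e 0 t" if "t \<le> T" for t
    by (rule curve_length_cong) (use e that in auto)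
  have "curve_length ?e T ?S = curve_length (\<lambda>_. \<gamma> T) T ?S"
    by (rule curve_length_cong) (use p'(2) in \<open>auto simp: curve_ext_def p'(1,4)\<close>)
  then have total: "curve_length ?e 0 ?S = curve_length \<gamma> 0 T"
    using curve_length_add[of 0 T ?S ?e] p'(2,3) len[of T] by (simp add: curve_length_const)
  have rg: "rectifiable_curve \<gamma> 0 T" by (rule rectifiable_curve_lipschitz[OF p'(2,5)])
  have re: "rectifiable_curve ?e 0 ?S"
    by (rule rectifiable_curve_lipschitz[OF S lipschitz_on_subset[OF curve_ext_lipschitz[OF p]]]) simp
  have "arclength_param \<gamma> 0 T s = arclength_param ?e 0 ?S s" if s: "s \<in> {0..arclen \<gamma> 0 T}" for s
  proof -
    obtain t where t: "t \<in> {0..T}" "arclen \<gamma> 0 t = s" using arclen_surj[OF rg s] by blast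
    have "arclen ?e 0 t = s" using t len[of t] by (simp add: arclen_def)
    then show ?thesis
      using arclength_param_arclen[OF rg t(1)] arclength_param_arclen[OF re, of t] t e[OF t(1)] p'(3) by auto
  qed
  then have "(\<integral>\<^sup>+ s \<in> {0..arclen \<gamma> 0 T}. h (arclength_param \<gamma> 0 T s) \<partial>lborel)
    = (\<integral>\<^sup>+ s \<in> {0..arclen \<gamma> 0 T}. h (arclength_param ?e 0 ?S s) \<partial>lborel)"
    by (intro nn_integral_cong) (auto simp: indicator_def)
  then show ?thesis using total by (simp add: path_integral_def arclen_def p'(1,4))
qed

lemma openin_lipschitz_superlevel:
  fixes \<psi> :: "'a::metric_space curve \<Rightarrow> real"
  assumes "\<And>p q. p \<in> curves_between C x y \<Longrightarrow> q \<in> curves_between C x y \<Longrightarrow> \<bar>\<psi> p - \<psi> q\<bar> \<le> c * curve_dist p q" and c: "0 \<le> c"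
  shows "openin (curve_topology C x y) {p \<in> curves_between C x y. a < \<psi> p}"
proof -
  interpret Metric_space "curves_between C x y" curve_dist by (rule Metric_space_curves_between)
  show ?thesis
    unfolding curve_topology_def openin_mtopology
  proof (intro conjI ballI allI impI)
    fix p assume p: "p \<in> {p \<in> curves_between C x y. a < \<psi> p}"
    define r where "r = (\<psi> p - a) / (c + 1)"
    have r: "0 < r" using p c by (simp add: r_def)
    have "mball p r \<subseteq> {p \<in> curves_between C x y. a < \<psi> p}"
    proof
      fix q assume "q \<in> mball p r"
      then have q: "q \<in> curves_between C x y" "curve_dist p q < r" by auto
      have "c * curve_dist p q \<le> c * r" using q c by (intro mult_left_mono) auto
      also have "\<dots> < (c + 1) * r" using r by (simp add: distrib_right)
      also have "\<dots> = \<psi> p - a" using c by (simp add: r_def)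
      finally have "a < \<psi> q" using assms(1)[of p q] p q by auto
      then show "q \<in> {p \<in> curves_between C x y. a < \<psi> p}" using q by simp
    qed
    then show "\<exists>r>0. mball p r \<subseteq> {p \<in> curves_between C x y. a < \<psi> p}" using r by blast
  qed auto
qed

context
  fixes C :: real and x y :: "'a::metric_space" and N :: "'a curve measure"
  assumes space_N: "space N \<subseteq> curves_between C x y"
    and open_N: "\<And>U. openin (curve_topology C x y) U \<Longrightarrow> U \<inter> space N \<in> sets N"
begin

lemma measurable_lipschitz_curves:
  assumes "\<And>p q. p \<in> curves_between C x y \<Longrightarrow> q \<in> curves_between C x y \<Longrightarrow> \<bar>\<psi> p - \<psi> q\<bar> \<le> c * curve_dist p q" "0 \<le> c"
  shows "(\<psi> :: 'a curve \<Rightarrow> real) \<in> borel_measurable N"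
proof (rule borel_measurableI_greater)
  fix a
  have "{p \<in> space N. a < \<psi> p} = {p \<in> curves_between C x y. a < \<psi> p} \<inter> space N" using space_N by auto
  then show "{p \<in> space N. a < \<psi> p} \<in> sets N" using open_N[OF openin_lipschitz_superlevel[OF assms]] by simp
qed

text \<open>Length is a supremum of continuous functions of the curve. There are uncountably many
  partitions in general, but the superlevel sets are unions of open sets, hence open.\<close>

lemma curve_length_measurable: "(\<lambda>p. curve_length (curve_ext p) a b) \<in> borel_measurable N"
proof (rule borel_measurableI_greater)
  fix c :: ennreal
  let ?I = "{(n::nat, t::nat \<Rightarrow> real). mono_on {..n} t \<and> t ` {..n} \<subseteq> {a..b}}"
  let ?s = "\<lambda>n t p. \<Sum>i<n. dist (curve_ext p (t i)) (curve_ext p (t (Suc i)))"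
  have op: "openin (curve_topology C x y) {p \<in> curves_between C x y. c < ennreal (?s n t p)}" for n :: nat and t
  proof (cases c)
    case (real r)
    have "openin (curve_topology C x y) {p \<in> curves_between C x y. r < ?s n t p}"
    proof (rule openin_lipschitz_superlevel[where c="6 * real n"])
      fix p q assume pq: "p \<in> curves_between C x y" "q \<in> curves_between C x y"
      have d: "\<bar>dist (curve_ext p u) (curve_ext p v) - dist (curve_ext q u) (curve_ext q v)\<bar> \<le> 6 * curve_dist p q" for u v
        using curve_ext_dist[OF pq, of u] curve_ext_dist[OF pq, of v]
          dist_triangle[of "curve_ext p u" "curve_ext p v" "curve_ext q u"] dist_triangle[of "curve_ext q u" "curve_ext p v" "curve_ext q v"]
          dist_triangle[of "curve_ext q u" "curve_ext q v" "curve_ext p u"] dist_triangle[of "curve_ext p u" "curve_ext q v" "curve_ext p v"]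
          dist_commute[of "curve_ext q u" "curve_ext p u"] dist_commute[of "curve_ext q v" "curve_ext p v"]
        unfolding abs_le_iff by linarith
      have "\<bar>?s n t p - ?s n t q\<bar> \<le> (\<Sum>i<n. \<bar>dist (curve_ext p (t i)) (curve_ext p (t (Suc i))) - dist (curve_ext q (t i)) (curve_ext q (t (Suc i)))\<bar>)"
        unfolding sum_subtractf[symmetric] by (rule sum_abs)
      also have "\<dots> \<le> (\<Sum>i<n. 6 * curve_dist p q)" by (rule sum_mono) (rule d)
      finally show "\<bar>?s n t p - ?s n t q\<bar> \<le> 6 * real n * curve_dist p q" by (simp add: mult_ac)
    qed simp
    then show ?thesis using real by (simp add: ennreal_less_iff)
  qed simp
  have "{p \<in> space N. c < curve_length (curve_ext p) a b}
    = (\<Union>(n, t)\<in>?I. {p \<in> curves_between C x y. c < ennreal (?s n t p)}) \<inter> space N"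
    using space_N by (auto simp: curve_length_def less_SUP_iff sum_ennreal)
  moreover have "openin (curve_topology C x y) (\<Union>(n, t)\<in>?I. {p \<in> curves_between C x y. c < ennreal (?s n t p)})"
    by (rule openin_Union) (use op in auto)
  ultimately show "{p \<in> space N. c < curve_length (curve_ext p) a b} \<in> sets N" using open_N by simp
qed

text \<open>The path integral is the mass that the length measure of the extended curve gives to
  \<open>A\<close>. For Lipschitz functions the integral is a limit of Riemann sums made of
  measurable quantities.\<close>

lemma path_integral_measurable:
  assumes A: "A \<in> sets borel"
  shows "(\<lambda>(\<gamma>, I). path_integral \<gamma> 0 (Sup I) (indicator A)) \<in> borel_measurable N"
proof (cases "space N = {}")
  case True
  then show ?thesis by (auto simp: measurable_def)
next
  case False
  then obtain p0 where "p0 \<in> curves_between C x y" using space_N by blast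
  then have S: "0 \<le> C * dist x y" by (rule curves_betweenE) linarith
  let ?S = "C * dist x y"
  have lip: "1-lipschitz_on {0..?S} (curve_ext p)" if "p \<in> space N" for p
    by (rule lipschitz_on_subset[OF curve_ext_lipschitz]) (use that space_N in auto)
  have fin: "emeasure (arc_measure (curve_ext p) ?S) UNIV < \<infinity>" if "p \<in> space N" for p
    using emeasure_arc_measure_UNIV[OF S lip[OF that]] by simp
  have [measurable]: "(\<lambda>p. arclen (curve_ext p) 0 t) \<in> borel_measurable N" for t
    unfolding arclen_def by (intro borel_measurable_enn2real curve_length_measurable)
  have "(\<lambda>p. emeasure (arc_measure (curve_ext p) ?S) A) \<in> borel_measurable N"
  proof (rule kernel_measurableI[OF _ fin _ A])
    show "sets (arc_measure (curve_ext p) ?S) = sets borel" for p by (simp add: arc_measure_def)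
    fix L and h :: "'a \<Rightarrow> real" assume h: "L-lipschitz_on UNIV h" "\<And>z. 0 \<le> h z" "\<And>z. h z \<le> 1"
    let ?t = "\<lambda>n i. real i * ?S / real n"
    let ?R = "\<lambda>n p. \<Sum>i<n. h (curve_ext p (?t n i)) * (arclen (curve_ext p) 0 (?t n (Suc i)) - arclen (curve_ext p) 0 (?t n i))"
    let ?J = "\<lambda>p. \<integral>\<^sup>+ z. ennreal (h z) \<partial>arc_measure (curve_ext p) ?S"
    have [measurable]: "(\<lambda>p. h (curve_ext p t)) \<in> borel_measurable N" for t
    proof (rule measurable_lipschitz_curves[where c="3 * L"])
      fix p q assume pq: "p \<in> curves_between C x y" "q \<in> curves_between C x y"
      have "\<bar>h (curve_ext p t) - h (curve_ext q t)\<bar> \<le> L * dist (curve_ext p t) (curve_ext q t)"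
        using lipschitz_onD[OF h(1), of "curve_ext p t" "curve_ext q t"] by (simp add: dist_real_def)
      also have "\<dots> \<le> L * (3 * curve_dist p q)"
        by (intro mult_left_mono curve_ext_dist[OF pq] lipschitz_on_nonneg[OF h(1)])
      finally show "\<bar>h (curve_ext p t) - h (curve_ext q t)\<bar> \<le> 3 * L * curve_dist p q" by simp
    qed (use lipschitz_on_nonneg[OF h(1)] in simp)
    have "(\<lambda>p. enn2real (?J p)) \<in> borel_measurable N"
    proof (rule borel_measurable_LIMSEQ_real)
      show "(\<lambda>n. ?R (Suc n) p) \<longlonglongrightarrow> enn2real (?J p)" if p: "p \<in> space N" for p
      proof (rule LIMSEQ_I)
        fix e :: real assume e: "0 < e"
        obtain k where k: "L * ?S * ?S / e < real k" using reals_Archimedean2 by blast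
        show "\<exists>no. \<forall>n\<ge>no. norm (?R (Suc n) p - enn2real (?J p)) < e"
        proof (intro exI allI impI)
          fix n assume "k \<le> n"
          then have "L * ?S * ?S / e < real (Suc n)" using k by simp
          then have "L * ?S * ?S / real (Suc n) < e" using e by (simp add: field_simps)
          then show "norm (?R (Suc n) p - enn2real (?J p)) < e"
            using riemann_sum_arc_measure[OF S lip[OF p] h(1,2) zero_less_Suc, of n] unfolding real_norm_def by linarith
        qed
      qed
      show "?R (Suc n) \<in> borel_measurable N" for n by measurable
    qed
    then have m: "(\<lambda>p. ennreal (enn2real (?J p))) \<in> borel_measurable N" by measurable
    have "?J p = ennreal (enn2real (?J p))" if p: "p \<in> space N" for p
    proof -
      have "?J p \<le> (\<integral>\<^sup>+ z. 1 \<partial>arc_measure (curve_ext p) ?S)"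
        by (intro nn_integral_mono) (use h(3) in \<open>simp add: ennreal_le_1\<close>)
      also have "\<dots> < top" using fin[OF p] by (simp add: arc_measure_def)
      finally show ?thesis by simp
    qed
    then show "?J \<in> borel_measurable N" using m by (simp cong: measurable_cong)
  qed
  moreover have "(case p of (\<gamma>, I) \<Rightarrow> path_integral \<gamma> 0 (Sup I) (indicator A)) = emeasure (arc_measure (curve_ext p) ?S) A"
    if p: "p \<in> space N" for p
    using path_integral_curve_ext[of p C x y "indicator A"] path_integral_indicator[OF S lip[OF p] A] p space_N
    by (auto simp: case_prod_beta)
  ultimately show ?thesis by (simp cong: measurable_cong)
qed

end

section \<open>Semmes families\<close>

definition curve_of_pair :: "real \<times> (real \<Rightarrow>\<^sub>C 'a::metric_space) \<Rightarrow> 'a curve" where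
  "curve_of_pair p = (restrict (apply_bcontfun (snd p)) {0..fst p}, {0..fst p})"

lemma curve_of_pair_mem:
  assumes "p \<in> curve_pairs S x y" "S \<le> C * dist x y"
  shows "curve_of_pair p \<in> curves_between C x y"
proof -
  obtain T f where p: "p = (T, f)" by (cases p)
  note c = curve_pairsD[OF assms(1)[unfolded p]]
  have "1-lipschitz_on {0..T} (restrict (apply_bcontfun f) {0..T})"
    by (rule lipschitz_on_transform[OF lipschitz_on_subset[OF c(3)]]) auto
  then show ?thesis
    using c assms(2) by (auto simp: curves_between_def curve_of_pair_def p)
qed

text \<open>A shift of the end time counts twice, once in time and once along a 1-Lipschitz curve;
  the supremum distance of the functions adds the third term.\<close>

lemma curve_of_pair_dist:
  assumes p: "p \<in> curve_pairs S x y" and q: "q \<in> curve_pairs S x y"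
  shows "curve_dist (curve_of_pair p) (curve_of_pair q) \<le> 3 * dist p q"
proof -
  have near: "infdist a (curve_graph (curve_of_pair q)) \<le> 3 * dist p q"
    if p: "p \<in> curve_pairs S x y" and q: "q \<in> curve_pairs S x y" and a: "a \<in> curve_graph (curve_of_pair p)" for p q a
  proof -
    obtain T f where pf: "p = (T, f)" by (cases p)
    obtain T' f' where qf: "q = (T', f')" by (cases q)
    note c = curve_pairsD[OF p[unfolded pf]] and c' = curve_pairsD[OF q[unfolded qf]]
    obtain t where t: "t \<in> {0..T}" "a = (t, apply_bcontfun f t)" using a by (auto simp: curve_graph_def curve_of_pair_def pf)
    define t' where "t' = min t T'"
    have t': "t' \<in> {0..T'}" "\<bar>t - t'\<bar> \<le> \<bar>T - T'\<bar>" using t c'(1) by (auto simp: t'_def)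
    have b: "(t', apply_bcontfun f' t') \<in> curve_graph (curve_of_pair q)"
      using t'(1) by (auto simp: curve_graph_def curve_of_pair_def qf)
    have "dist a (t', apply_bcontfun f' t') \<le> \<bar>t - t'\<bar> + dist (apply_bcontfun f t) (apply_bcontfun f' t')"
      using sqrt_sum_squares_le_sum[of "\<bar>t - t'\<bar>" "dist (apply_bcontfun f t) (apply_bcontfun f' t')"]
      by (simp add: t(2) dist_Pair_Pair dist_real_def)
    moreover have "dist (apply_bcontfun f t) (apply_bcontfun f' t') \<le> \<bar>t - t'\<bar> + dist f f'"
      using dist_triangle[of "apply_bcontfun f t" "apply_bcontfun f' t'" "apply_bcontfun f t'"]
        lipschitz_onD[OF c(3), of t t'] dist_bounded[of f t' f'] by (simp add: dist_real_def)
    moreover have "A \<le> 2 * w + e" if "A \<le> u + d" "d \<le> u + e" "u \<le> w" for A u d e w :: real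
      using that by linarith
    ultimately have "dist a (t', apply_bcontfun f' t') \<le> 2 * \<bar>T - T'\<bar> + dist f f'" using t'(2) by blast
    also have "\<dots> \<le> 3 * dist p q"
      using dist_fst_le[of p q] dist_snd_le[of p q] by (simp add: pf qf dist_real_def)
    finally show ?thesis using infdist_le2[OF b] by simp
  qed
  have ne: "curve_graph (curve_of_pair r) \<noteq> {}" if "r \<in> curve_pairs S x y" for r
  proof -
    obtain T f where r: "r = (T, f)" by (cases r)
    show ?thesis using curve_pairsD(1)[OF that[unfolded r]] by (auto simp: r curve_graph_def curve_of_pair_def)
  qed
  show ?thesis
    unfolding curve_dist_def
    by (rule hausdorff_dist_le[OF ne[OF p] ne[OF q] near[OF p q]]) (use near[OF q p] in \<open>auto simp: dist_commute\<close>)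
qed

lemma continuous_curve_of_pair:
  assumes S: "S \<le> C * dist x y" and cont: "continuous_on Sr \<phi>" and rng: "\<phi> ` Sr \<subseteq> curve_pairs S x y"
  shows "continuous_map (top_of_set Sr) (curve_topology C x y) (\<lambda>s :: 'c::metric_space. curve_of_pair (\<phi> s))"
proof -
  interpret Metric_space "curves_between C x y" curve_dist by (rule Metric_space_curves_between)
  show ?thesis
    unfolding curve_topology_def continuous_map_to_metric
  proof (intro ballI allI impI)
    fix s and e :: real assume s: "s \<in> topspace (top_of_set Sr)" and e: "0 < e"
    then obtain d where d: "d > 0" "\<And>t. t \<in> Sr \<Longrightarrow> dist t s < d \<Longrightarrow> dist (\<phi> t) (\<phi> s) < e / 3"
      using cont unfolding continuous_on_iff by (metis divide_pos_pos topspace_euclidean_subtopology zero_less_numeral)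
    show "\<exists>U. openin (top_of_set Sr) U \<and> s \<in> U \<and> (\<forall>t\<in>U. curve_of_pair (\<phi> t) \<in> mball (curve_of_pair (\<phi> s)) e)"
    proof (intro exI[of _ "Sr \<inter> ball s d"] conjI ballI)
      show "openin (top_of_set Sr) (Sr \<inter> ball s d)" by (simp add: openin_open_Int)
      show "s \<in> Sr \<inter> ball s d" using s d by simp
      fix t assume t: "t \<in> Sr \<inter> ball s d"
      have m: "\<phi> s \<in> curve_pairs S x y" "\<phi> t \<in> curve_pairs S x y" using s t rng by auto
      have "curve_dist (curve_of_pair (\<phi> s)) (curve_of_pair (\<phi> t)) \<le> 3 * dist (\<phi> s) (\<phi> t)"
        by (rule curve_of_pair_dist[OF m])
      also have "\<dots> < e" using d(2)[of t] t by (simp add: dist_commute)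
      finally show "curve_of_pair (\<phi> t) \<in> mball (curve_of_pair (\<phi> s)) e"
        using curve_of_pair_mem[OF m(1) S] curve_of_pair_mem[OF m(2) S] by simp
    qed
  qed
qed

context poincare_space
begin

text \<open>One constant has to bound the length and the integral (\<open>C5\<close>) and to size
  the double ball (\<open>C0\<close>); all three requirements relax as it grows.\<close>

theorem semmes_family_exists:
  assumes xy: "x \<noteq> y"
  shows "\<exists>\<Gamma> \<alpha>. semmes_family M (max C5 C0) x y \<Gamma> \<alpha>"
proof -
  define C where "C = max C5 C0"
  have C: "1 \<le> C" "C5 \<le> C" "C0 \<le> C" using C5_ge by (auto simp: C_def)
  have SC: "C5 * dist x y \<le> C * dist x y" using C by (intro mult_right_mono) auto
  let ?\<tau> = "curve_topology C x y"
  obtain Sr :: "real set" and \<phi> \<beta> where *: "compact Sr" "continuous_on Sr \<phi>" "\<phi> ` Sr \<subseteq> curve_pairs (C5 * dist x y) x y"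
    "prob_space \<beta>" "sets \<beta> = sets borel" "AE s in \<beta>. s \<in> Sr"
    "\<And>A. A \<in> sets borel \<Longrightarrow>
      (\<integral>\<^sup>+ s \<in> Sr. (\<integral>\<^sup>+ t \<in> {0..fst (\<phi> s)}. indicator A (apply_bcontfun (snd (\<phi> s)) t) \<partial>lborel) \<partial>\<beta>)
      \<le> ennreal C5 * (\<integral>\<^sup>+ z \<in> double_ball C0 x y \<inter> A. ennreal (riesz_kernel M x y z) \<partial>M)"
    by (rule random_curves[OF xy]) (rule that; assumption)
  interpret \<beta>: prob_space \<beta> by (rule *(4))
  define \<Psi> where "\<Psi> s = curve_of_pair (\<phi> s)" for s
  \<comment> \<open>A continuous image of the compact set \<open>Sr\<close>, hence compact; it
    carries the image of \<open>\<beta>\<close>, for which \<open>Sr\<close> has full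
    measure.\<close>
  define \<Gamma> where "\<Gamma> = \<Psi> ` Sr"
  have cont: "continuous_map (top_of_set Sr) ?\<tau> \<Psi>"
    unfolding \<Psi>_def[abs_def] by (rule continuous_curve_of_pair[OF SC *(2,3)])
  have compact_image: "compactin ?\<tau> (\<Psi> ` K)" if "compact K" "K \<subseteq> Sr" for K
    by (rule image_compactin[OF _ cont]) (use that in \<open>simp add: compactin_subtopology\<close>)
  have \<Gamma>c: "compactin ?\<tau> \<Gamma>" unfolding \<Gamma>_def by (rule compact_image[OF *(1)]) simp
  have top\<tau>: "topspace ?\<tau> = curves_between C x y"
    using Metric_space.topspace_mtopology[OF Metric_space_curves_between] by (simp add: curve_topology_def)
  have \<Gamma>sub: "\<Gamma> \<subseteq> curves_between C x y" using compactin_subset_topspace[OF \<Gamma>c] top\<tau> by simp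
  let ?T = "subtopology ?\<tau> \<Gamma>"
  have topT: "topspace ?T = \<Gamma>" using \<Gamma>sub top\<tau> by auto
  define N0 where "N0 = sigma \<Gamma> {U. openin ?T U}"
  have openPow: "{U. openin ?T U} \<subseteq> Pow \<Gamma>" using openin_subset[of ?T] topT by auto
  have N0: "space N0 = \<Gamma>" "sets N0 = sigma_sets \<Gamma> {U. openin ?T U}"
    using openPow by (auto simp: N0_def)
  define \<beta>' where "\<beta>' = restrict_space \<beta> Sr"
  have SrB: "Sr \<in> sets borel" using *(1) by (simp add: compact_imp_closed borel_closed)
  then have Sr\<beta>: "Sr \<in> sets \<beta>" by (simp add: *(5))
  have "emeasure \<beta> Sr = 1" using \<beta>.emeasure_eq_1_AE[OF Sr\<beta> *(6)] .
  then have prob': "prob_space \<beta>'" unfolding \<beta>'_def by (rule prob_space_restrict_space[OF Sr\<beta>])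
  have space\<beta>': "space \<beta>' = Sr" using sets_eq_imp_space_eq[OF *(5)] by (simp add: \<beta>'_def space_restrict_space)
  have \<Psi>m: "\<Psi> \<in> measurable \<beta>' N0"
    unfolding N0_def
  proof (rule measurable_measure_of[OF openPow])
    show "\<Psi> \<in> space \<beta>' \<rightarrow> \<Gamma>" by (auto simp: space\<beta>' \<Gamma>_def)
    fix U assume "U \<in> {U. openin ?T U}"
    then obtain V where V: "openin ?\<tau> V" "U = V \<inter> \<Gamma>" by (auto simp: openin_subtopology)
    have "openin (top_of_set Sr) {s \<in> Sr. \<Psi> s \<in> V}"
      using openin_continuous_map_preimage[OF cont V(1)] by simp
    then obtain W where W: "open W" "{s \<in> Sr. \<Psi> s \<in> V} = Sr \<inter> W" unfolding openin_open by blast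
    have "\<Psi> -` U \<inter> space \<beta>' = {s \<in> Sr. \<Psi> s \<in> V}"
      unfolding space\<beta>' V(2) \<Gamma>_def by blast
    then have "\<Psi> -` U \<inter> space \<beta>' = Sr \<inter> W" by (simp only: W(2))
    then show "\<Psi> -` U \<inter> space \<beta>' \<in> sets \<beta>'"
      using W(1) Sr\<beta> by (auto simp: \<beta>'_def sets_restrict_space_iff *(5))
  qed
  define \<alpha> where "\<alpha> = distr \<beta>' N0 \<Psi>"
  have \<alpha>: "space \<alpha> = \<Gamma>" "sets \<alpha> = sigma_sets \<Gamma> {U. openin ?T U}" by (simp_all add: \<alpha>_def N0)
  have prob\<alpha>: "prob_space \<alpha>" unfolding \<alpha>_def by (rule prob_space.prob_space_distr[OF prob' \<Psi>m])
  interpret \<alpha>: prob_space \<alpha> by (rule prob\<alpha>)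
  have open\<alpha>: "U \<inter> space \<alpha> \<in> sets \<alpha>" if "openin ?\<tau> U" for U
    unfolding \<alpha> by (rule sigma_sets.Basic) (use that in \<open>auto simp: openin_subtopology\<close>)
  have em\<alpha>: "emeasure \<alpha> A = emeasure \<beta> (\<Psi> -` A \<inter> Sr)" "\<Psi> -` A \<inter> Sr \<in> sets borel" if A: "A \<in> sets \<alpha>" for A
  proof -
    have "A \<in> sets N0" using A by (simp add: \<alpha>_def)
    then have m: "\<Psi> -` A \<inter> Sr \<in> sets \<beta>'" using measurable_sets[OF \<Psi>m] by (simp add: space\<beta>')
    then show "\<Psi> -` A \<inter> Sr \<in> sets borel" using Sr\<beta> by (auto simp: \<beta>'_def sets_restrict_space_iff *(5))
    show "emeasure \<alpha> A = emeasure \<beta> (\<Psi> -` A \<inter> Sr)"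
      using \<open>A \<in> sets N0\<close> Sr\<beta> unfolding \<alpha>_def
      by (subst emeasure_distr[OF \<Psi>m]) (auto simp: space\<beta>'[unfolded \<beta>'_def] \<beta>'_def emeasure_restrict_space)
  qed
  have radon: "radon_measure_on ?T \<alpha>"
    unfolding radon_measure_on_def topT
  proof (intro conjI ballI)
    show "space \<alpha> = \<Gamma>" "sets \<alpha> = sigma_sets \<Gamma> {U. openin ?T U}" by (rule \<alpha>)+
    fix p assume "p \<in> \<Gamma>"
    moreover have "emeasure \<alpha> \<Gamma> < \<infinity>" using \<alpha>.emeasure_space_1 \<alpha>(1) by simp
    ultimately show "\<exists>U. openin ?T U \<and> p \<in> U \<and> emeasure \<alpha> U < \<infinity>"
      using openin_topspace[of ?T] topT by auto
  next
    fix A assume A: "A \<in> sets \<alpha>"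
    have A\<Gamma>: "A \<subseteq> \<Gamma>" using sets.sets_into_space[OF A] \<alpha>(1) by simp
    show "emeasure \<alpha> A = (SUP K\<in>{K. compactin ?T K \<and> K \<subseteq> A}. emeasure \<alpha> K)"
    proof (rule antisym)
      \<comment> \<open>Inner regularity is inherited from the line: a compact \<open>K\<close>
        inside the preimage of \<open>A\<close> has a compact image inside \<open>A\<close>, and the
        preimage of that image contains \<open>K\<close>.\<close>
      have "emeasure \<beta> (space \<beta>) \<noteq> \<infinity>" by (simp add: \<beta>.emeasure_space_1)
      then have "emeasure \<alpha> A = (SUP K\<in>{K. K \<subseteq> \<Psi> -` A \<inter> Sr \<and> compact K}. emeasure \<beta> K)"
        unfolding em\<alpha>(1)[OF A] by (rule inner_regular[OF *(5) _ em\<alpha>(2)[OF A]])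
      also have "\<dots> \<le> (SUP K\<in>{K. compactin ?T K \<and> K \<subseteq> A}. emeasure \<alpha> K)"
      proof (rule SUP_least, clarify)
        fix K assume K: "K \<subseteq> \<Psi> -` A \<inter> Sr" "compact K"
        have cK: "compactin ?\<tau> (\<Psi> ` K)" by (rule compact_image) (use K in auto)
        then have cT: "compactin ?T (\<Psi> ` K)" using K by (auto simp: compactin_subtopology \<Gamma>_def)
        \<comment> \<open>Compact sets are closed in a Hausdorff space, which makes the image
          measurable.\<close>
        have "Hausdorff_space ?\<tau>"
          unfolding curve_topology_def by (rule Metric_space.Hausdorff_space_mtopology[OF Metric_space_curves_between])
        then have "closedin ?\<tau> (\<Psi> ` K)" using cK by (rule compactin_imp_closedin)
        then have "openin ?\<tau> (topspace ?\<tau> - \<Psi> ` K)" by blast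
        from open\<alpha>[OF this] have "\<Gamma> - ((topspace ?\<tau> - \<Psi> ` K) \<inter> \<Gamma>) \<in> sets \<alpha>"
          using sets.compl_sets[of _ \<alpha>] by (simp add: \<alpha>(1))
        moreover have "\<Gamma> - ((topspace ?\<tau> - \<Psi> ` K) \<inter> \<Gamma>) = \<Psi> ` K"
          using K \<Gamma>sub top\<tau> by (auto simp: \<Gamma>_def)
        ultimately have KB: "\<Psi> ` K \<in> sets \<alpha>" by simp
        have "emeasure \<beta> K \<le> emeasure \<beta> (\<Psi> -` (\<Psi> ` K) \<inter> Sr)"
          by (rule emeasure_mono) (use K em\<alpha>(2)[OF KB] *(5) in auto)
        also have "\<dots> = emeasure \<alpha> (\<Psi> ` K)" by (rule em\<alpha>(1)[OF KB, symmetric])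
        also have "\<dots> \<le> (SUP K\<in>{K. compactin ?T K \<and> K \<subseteq> A}. emeasure \<alpha> K)"
          by (rule SUP_upper) (use cT K in auto)
        finally show "emeasure \<beta> K \<le> (SUP K\<in>{K. compactin ?T K \<and> K \<subseteq> A}. emeasure \<alpha> K)" .
      qed
      finally show "emeasure \<alpha> A \<le> (SUP K\<in>{K. compactin ?T K \<and> K \<subseteq> A}. emeasure \<alpha> K)" .
      show "(SUP K\<in>{K. compactin ?T K \<and> K \<subseteq> A}. emeasure \<alpha> K) \<le> emeasure \<alpha> A"
        by (rule SUP_least) (use A in \<open>auto intro: emeasure_mono\<close>)
    qed
  qed
  have bound: "(\<integral>\<^sup>+ (\<gamma>, I) \<in> \<Gamma>. path_integral \<gamma> 0 (Sup I) (indicator A) \<partial>\<alpha>)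
      \<le> ennreal C * (\<integral>\<^sup>+ z \<in> double_ball C x y \<inter> A. ennreal (riesz_kernel M x y z) \<partial>M)"
    and meas: "(\<lambda>(\<gamma>, I). path_integral \<gamma> 0 (Sup I) (indicator A)) \<in> borel_measurable \<alpha>"
    if A: "A \<in> sets borel" for A
  proof -
    let ?J = "\<lambda>(\<gamma>, I). path_integral \<gamma> 0 (Sup I) (indicator A)"
    have sp: "space \<alpha> \<subseteq> curves_between C x y" using \<Gamma>sub by (simp add: \<alpha>(1))
    show meas: "?J \<in> borel_measurable \<alpha>" by (rule path_integral_measurable[OF sp open\<alpha> A])
    then have meas0: "?J \<in> borel_measurable N0" by (simp add: \<alpha>_def)
    have "(\<integral>\<^sup>+ (\<gamma>, I) \<in> \<Gamma>. path_integral \<gamma> 0 (Sup I) (indicator A) \<partial>\<alpha>) = (\<integral>\<^sup>+ p. ?J p \<partial>\<alpha>)"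
      by (rule nn_integral_cong) (auto simp: \<alpha>(1))
    also have "\<dots> = (\<integral>\<^sup>+ s. ?J (\<Psi> s) \<partial>\<beta>')" unfolding \<alpha>_def by (rule nn_integral_distr[OF \<Psi>m]) (use meas0 in simp)
    also have "\<dots> = (\<integral>\<^sup>+ s \<in> Sr. ?J (\<Psi> s) \<partial>\<beta>)"
      unfolding \<beta>'_def using Sr\<beta> by (subst nn_integral_restrict_space) auto
    also have "\<dots> \<le> (\<integral>\<^sup>+ s \<in> Sr. (\<integral>\<^sup>+ t \<in> {0..fst (\<phi> s)}. indicator A (apply_bcontfun (snd (\<phi> s)) t) \<partial>lborel) \<partial>\<beta>)"
    proof (rule nn_integral_mono)
      fix s
      show "?J (\<Psi> s) * indicator Sr s \<le> (\<integral>\<^sup>+ t \<in> {0..fst (\<phi> s)}. indicator A (apply_bcontfun (snd (\<phi> s)) t) \<partial>lborel) * indicator Sr s"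
      proof (cases "s \<in> Sr")
        case True
        obtain T f where pf: "\<phi> s = (T, f)" by (cases "\<phi> s")
        then have "(T, f) \<in> curve_pairs (C5 * dist x y) x y" using *(3) True by (metis image_subset_iff)
        note c = curve_pairsD[OF this]
        let ?g = "restrict (apply_bcontfun f) {0..T}"
        have "1-lipschitz_on {0..T} ?g"
          by (rule lipschitz_on_transform[OF lipschitz_on_subset[OF c(3)]]) auto
        from path_integral_le_parameter_integral[OF c(1) this A]
        have "path_integral ?g 0 T (indicator A) \<le> (\<integral>\<^sup>+ t \<in> {0..T}. indicator A (?g t) \<partial>lborel)" .
        also have "\<dots> = (\<integral>\<^sup>+ t \<in> {0..T}. indicator A (apply_bcontfun f t) \<partial>lborel)"
          by (intro nn_integral_cong) (auto simp: indicator_def)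
        finally show ?thesis using True c(1) by (simp add: \<Psi>_def curve_of_pair_def pf)
      qed simp
    qed
    also have "\<dots> \<le> ennreal C5 * (\<integral>\<^sup>+ z \<in> double_ball C0 x y \<inter> A. ennreal (riesz_kernel M x y z) \<partial>M)"
      by (rule *(7)[OF A])
    also have "\<dots> \<le> ennreal C * (\<integral>\<^sup>+ z \<in> double_ball C x y \<inter> A. ennreal (riesz_kernel M x y z) \<partial>M)"
    proof (rule mult_mono[OF ennreal_leI[OF C(2)] nn_integral_mono])
      have "C0 * dist x y \<le> C * dist x y" using C(3) by (intro mult_right_mono) auto
      then have "double_ball C0 x y \<subseteq> double_ball C x y" by (auto simp: double_ball_def)
      then show "ennreal (riesz_kernel M x y z) * indicator (double_ball C0 x y \<inter> A) z
        \<le> ennreal (riesz_kernel M x y z) * indicator (double_ball C x y \<inter> A) z" for z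
        by (auto simp: indicator_def)
    qed auto
    finally show "(\<integral>\<^sup>+ (\<gamma>, I) \<in> \<Gamma>. path_integral \<gamma> 0 (Sup I) (indicator A) \<partial>\<alpha>)
      \<le> ennreal C * (\<integral>\<^sup>+ z \<in> double_ball C x y \<inter> A. ennreal (riesz_kernel M x y z) \<partial>M)" .
  qed
  show ?thesis
    unfolding semmes_family_def C_def[symmetric]
    using \<Gamma>sub \<Gamma>c radon prob\<alpha> bound meas by blast
qed

end

section \<open>Normalization of the Poincare inequality and conclusion\<close>

theorem theorem3p7:
  fixes M :: "'a::complete_space measure"
  assumes borel: "sets M = sets borel"
    and balls: "\<And>(x::'a) r. 0 < r \<Longrightarrow> 0 < emeasure M (ball x r) \<and> emeasure M (ball x r) < \<infinity>"
    and doubling: "doubling_measure M"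
    and poincare: "supports_1_Poincare M"
  shows "\<exists>C::real. 1 \<le> C \<and> (\<forall>x y::'a. x \<noteq> y \<longrightarrow> (\<exists>\<Gamma> \<alpha>. semmes_family M C x y \<Gamma> \<alpha>))"
proof -
  obtain D where D: "1 \<le> D" "\<And>(x::'a) r. 0 < r \<Longrightarrow> emeasure M (ball x (2 * r)) \<le> ennreal D * emeasure M (ball x r)"
    using doubling by (auto simp: doubling_measure_def)
  interpret doubling_space M D
  proof
    show "emeasure M (ball x r) < \<infinity>" for x :: 'a and r
      using balls[of r x] by (cases "0 < r") (auto simp: ball_empty)
  qed (use borel balls D in auto)
  obtain P0 l0 where P0: "0 < P0" "0 < l0" and
    PI: "\<forall>(x::'a) r u g. 0 < r \<longrightarrow> (\<forall>y s. set_integrable M (ball y s) u) \<longrightarrow> upper_gradient u g \<longrightarrow>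
           ennreal (average_on M (ball x r) (\<lambda>z. \<bar>u z - average_on M (ball x r) u\<bar>))
           \<le> ennreal (P0 * r) * ((\<integral>\<^sup>+ z \<in> ball x (l0 * r). ennreal (g z) \<partial>M) / emeasure M (ball x (l0 * r)))"
    using poincare unfolding supports_1_Poincare_def by blast
  define l where "l = max 1 l0"
  \<comment> \<open>Enlarging the dilation factor to \<open>l\<close> increases the measure of the
    ball in the denominator by at most the factor \<open>D ^ k\<close>, which is absorbed into the
    constant.\<close>
  obtain k where k: "l / l0 < 2 ^ k" using real_arch_pow[of 2 "l / l0"] by auto
  interpret poincare_space M D "P0 * D ^ k" l
  proof
    show "0 < P0 * D ^ k" using P0 D by simp
    show "1 \<le> l" by (simp add: l_def)
    fix x :: 'a and r :: real and u g :: "'a \<Rightarrow> real"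
    assume r: "0 < r" and u: "\<And>y s. set_integrable M (ball y s) u" and g: "upper_gradient u g"
    let ?I = "\<lambda>s. \<integral>\<^sup>+ z \<in> ball x s. ennreal (g z) \<partial>M"
    have m0: "0 < m x (l0 * r)" and ml: "0 < m x (l * r)" using P0 r by (auto intro!: m_pos simp: l_def)
    have mm: "m x (l * r) \<le> D ^ k * m x (l0 * r)"
    proof (rule m_compare)
      have "l \<le> 2 ^ k * l0" using k P0 by (simp add: field_simps)
      then show "dist x x + l * r \<le> 2 ^ k * (l0 * r)" using r mult_right_mono[of l "2 ^ k * l0" r] by simp
    qed (use P0 r in simp)
    have "ennreal (average_on M (ball x r) (\<lambda>z. \<bar>u z - average_on M (ball x r) u\<bar>))
           \<le> ennreal (P0 * r) * (?I (l0 * r) / emeasure M (ball x (l0 * r)))" using PI r u g by blast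
    also have "\<dots> = ennreal (P0 * r / m x (l0 * r)) * ?I (l0 * r)"
    proof -
      have "?I (l0 * r) / ennreal (m x (l0 * r)) = ennreal (1 / m x (l0 * r)) * ?I (l0 * r)"
        using m0 by (simp add: divide_ennreal_def inverse_ennreal mult.commute inverse_eq_divide)
      then show ?thesis
        using P0 r m0 by (simp add: emeasure_ball mult.assoc[symmetric] flip: ennreal_mult)
    qed
    also have "\<dots> \<le> ennreal (P0 * D ^ k * r / m x (l * r)) * ?I (l * r)"
    proof (rule mult_mono[OF ennreal_leI nn_integral_mono])
      have "(P0 * r) * m x (l * r) \<le> (P0 * r) * (D ^ k * m x (l0 * r))" using P0 r by (intro mult_left_mono mm) auto
      then show "P0 * r / m x (l0 * r) \<le> P0 * D ^ k * r / m x (l * r)" using m0 ml by (simp add: field_simps)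
      have "ball x (l0 * r) \<subseteq> ball x (l * r)" using r by (intro subset_ball mult_right_mono) (auto simp: l_def)
      then show "ennreal (g z) * indicator (ball x (l0 * r)) z \<le> ennreal (g z) * indicator (ball x (l * r)) z" for z
        by (auto simp: indicator_def)
    qed auto
    finally show "ennreal (average_on M (ball x r) (\<lambda>z. \<bar>u z - average_on M (ball x r) u\<bar>))
      \<le> ennreal (P0 * D ^ k * r / m x (l * r)) * ?I (l * r)" .
  qed
  have "1 \<le> max C5 C0" using C5_ge by simp
  then show ?thesis using semmes_family_exists by blast
qed

end
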